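(* Let $H\in(0,1)$ and $T>0$. For every $\psi\in\mathcal{L}_T$ (represented by its version that is the restriction to $\mathbb{R}$ of an entire function) we have $$\int_{\mathbb{R}}\psi(\lambda)\overline{S_T(\omega,\lambda)}\,\mu(d\lambda)=\psi(\omega)$$ for all $\omega\in\mathbb{R}$.
   Context: $\Gamma$ is Euler's gamma function and $J_\nu$ the Bessel function of the first kind of order $\nu$. $\mu(d\lambda)=(2\pi)^{-1}\sin(\pi H)\Gamma(1+2H)|\lambda|^{1-2H}\,d\lambda$ on $\mathbb{R}$ (spectral measure of fractional Brownian motion). For $t\ge0$, $e_t(\lambda)=(e^{i\lambda t}-1)/(i\lambda)$ (with $e_t(0)=t$). $\mathcal{L}_T$ is the closure in $L^2(\mu)$ of the complex linear span of $\{e_t:t\in[0,T]\}$. Every element of $\mathcal{L}_T$ has a version that is the restriction to $\mathbb{R}$ of an entire function, and elements of $\mathcal{L}_T$ are always represented by this version. $V_t=d_H^2\,t^{2-2H}$ with $d_H^2=\dfrac{\Gamma(3/2-H)}{2H\,\Gamma(H+1/2)\,\Gamma(3-2H)}$. The function $\varphi:\mathbb{R}\to\mathbb{C}$ is $$\varphi(z)=\Gamma(1-H)\Big(\frac z4\Big)^H e^{iz/2}\Big(J_{-H}\Big(\frac z2\Big)+iJ_{1-H}\Big(\frac z2\Big)\Big)\ (z\ne0),\qquad \varphi(0)=1.$$ Here $z^{-\nu}J_\nu(z)$ is always understood as the entire even function $\sum_{k\ge0}\frac{(-1)^k 2^{-\nu}(z/2)^{2k}}{k!\,\Gamma(k+\nu+1)}$,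 so $z^HJ_{-H}(z)$ and $z^HJ_{1-H}(z)=z\cdot z^{-(1-H)}J_{1-H}(z)$ are entire and $\varphi$ is entire. $S_T(\omega,\lambda)=\int_0^T\overline{\varphi(u\omega)}\varphi(u\lambda)\,dV_u$ for $\omega,\lambda\in\mathbb{R}$. *)

theory Defs
  imports "HOL-Complex_Analysis.Complex_Analysis"
begin

definition fbm_spectral_measure :: "real \<Rightarrow> real measure" where
  "fbm_spectral_measure H =
     density lborel
       (\<lambda>x. ennreal (sin (pi * H) * Gamma (1 + 2 * H) / (2 * pi) * \<bar>x\<bar> powr (1 - 2 * H)))"

definition exp_kernel :: "real \<Rightarrow> real \<Rightarrow> complex" where
  "exp_kernel t x =
     (if x = 0 then of_real t else (exp (\<i> * of_real x * of_real t) - 1) / (\<i> * of_real x))"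

definition exp_kernel_span :: "real \<Rightarrow> (real \<Rightarrow> complex) set" where
  "exp_kernel_span T =
     {(\<lambda>x. \<Sum>t\<in>A. c t * exp_kernel t x) | A c. finite A \<and> A \<subseteq> {0..T}}"

definition square_integrable :: "'a measure \<Rightarrow> ('a \<Rightarrow> complex) set" where
  "square_integrable M = {f \<in> borel_measurable M. integrable M (\<lambda>x. (norm (f x))\<^sup>2)}"

text \<open>Elements of \<open>L\<^sup>2\<close> are represented by functions rather than by classes modulo null sets:
  the closure of \<open>A\<close> contains every version of each of its elements.  The distance is an extended
  nonnegative integral, so that it is infinite when the difference is not square integrable.\<close>

definition L2_closure :: "'a measure \<Rightarrow> ('a \<Rightarrow> complex) set \<Rightarrow> ('a \<Rightarrow> complex) set" where
  "L2_closure M A =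
     {f \<in> square_integrable M.
        \<forall>\<epsilon>>0. \<exists>g\<in>A. (\<integral>\<^sup>+x. ennreal ((norm (f x - g x))\<^sup>2) \<partial>M) < ennreal (\<epsilon>\<^sup>2)}"

definition fbm_space :: "real \<Rightarrow> real \<Rightarrow> (real \<Rightarrow> complex) set" where
  "fbm_space H T = L2_closure (fbm_spectral_measure H) (exp_kernel_span T)"

definition fbm_d2 :: "real \<Rightarrow> real" where
  "fbm_d2 H = Gamma (3/2 - H) / (2 * H * Gamma (H + 1/2) * Gamma (3 - 2 * H))"

text \<open>The function \<open>V\<close> only matters on \<open>[0, \<infinity>)\<close>; it is extended by \<open>0\<close> to a nondecreasing
  continuous function on the line, so that \<open>dV\<close> is \<^const>\<open>interval_measure\<close> of it.\<close>

definition fbm_V :: "real \<Rightarrow> real \<Rightarrow> real" where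
  "fbm_V H t = (if t < 0 then 0 else fbm_d2 H * t powr (2 - 2 * H))"

text \<open>The entire even function \<open>z\<^sup>-\<^sup>\<nu> J\<^sub>\<nu>(z)\<close>.\<close>

definition bessel_J_even :: "real \<Rightarrow> complex \<Rightarrow> complex" where
  "bessel_J_even \<nu> z =
     (\<Sum>k. (-1) ^ k * of_real (2 powr (-\<nu>)) * (z / 2) ^ (2 * k) /
            (fact k * of_real (Gamma (real k + \<nu> + 1))))"

text \<open>The Bessel function of the first kind (principal branch).\<close>

definition bessel_J :: "real \<Rightarrow> complex \<Rightarrow> complex" where
  "bessel_J \<nu> z = z powr of_real \<nu> * bessel_J_even \<nu> z"

text \<open>With \<open>w = z / 2\<close> one has \<open>(z/4)\<^sup>H = 2\<^sup>-\<^sup>H w\<^sup>H\<close>.  For negative \<open>z\<close> the products \<open>w\<^sup>H J\<^sub>-\<^sub>H(w)\<close> and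
  \<open>w\<^sup>H J\<^sub>1\<^sub>-\<^sub>H(w) = w \<cdot> w\<^sup>-\<^sup>(\<^sup>1\<^sup>-\<^sup>H\<^sup>) J\<^sub>1\<^sub>-\<^sub>H(w)\<close> denote the values of the respective entire functions and
  not products of principal branches; hence the use of \<^const>\<open>bessel_J_even\<close>.\<close>

definition fbm_phi :: "real \<Rightarrow> real \<Rightarrow> complex" where
  "fbm_phi H z =
     (if z = 0 then 1
      else let w = of_real (z / 2) in
        of_real (Gamma (1 - H) * 2 powr (-H)) * exp (\<i> * of_real z / 2) *
        (bessel_J_even (-H) w + \<i> * (w * bessel_J_even (1 - H) w)))"

lemma fbm_phi_eq:
  assumes "H < 1"
  shows "fbm_phi H z =
    of_real (Gamma (1 - H) * 2 powr (-H)) * exp (\<i> * of_real z / 2) *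
    (bessel_J_even (-H) (of_real (z / 2)) +
      \<i> * (of_real (z / 2) * bessel_J_even (1 - H) (of_real (z / 2))))"
proof (cases "z = 0")
  case True
  have "bessel_J_even (-H) 0 =
      (\<Sum>k\<in>{0}. (-1) ^ k * of_real (2 powr (- (-H))) * (0 / 2) ^ (2 * k) /
            (fact k * of_real (Gamma (real k + (-H) + 1))))"
    unfolding bessel_J_even_def by (rule suminf_finite) auto
  then have J: "bessel_J_even (-H) 0 = of_real (2 powr H / Gamma (1 - H))"
    by simp
  have "Gamma (1 - H) > 0"
    using assms by (intro Gamma_real_pos) auto
  moreover have "(2::real) powr (-H) * 2 powr H = 1"
    by (simp add: powr_add[symmetric])
  ultimately have "Gamma (1 - H) * 2 powr (-H) * (2 powr H / Gamma (1 - H)) = 1"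
    by (simp add: field_simps)
  then have "of_real (Gamma (1 - H) * 2 powr (-H)) * bessel_J_even (-H) 0 = 1"
    unfolding J of_real_mult[symmetric] by simp
  then show ?thesis
    using True by (simp add: fbm_phi_def)
qed (simp add: fbm_phi_def Let_def)

text \<open>On the positive half-line this is the formula with principal powers.\<close>

lemma fbm_phi_pos:
  assumes "z > 0"
  shows "fbm_phi H z =
    of_real (Gamma (1 - H)) * (of_real z / 4) powr of_real H * exp (\<i> * of_real z / 2) *
    (bessel_J (-H) (of_real z / 2) + \<i> * bessel_J (1 - H) (of_real z / 2))"
proof -
  define w :: complex where "w = of_real (z / 2)"
  have w: "w \<noteq> 0" using assms by (simp add: w_def)
  have "(of_real z / 4 :: complex) powr of_real H = of_real ((z / 4) powr H)"
    using assms powr_of_real[of "z / 4" H] by simp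
  also have "(z / 4) powr H = 2 powr (-H) * (z / 2) powr H"
    using assms by (simp add: powr_minus_divide powr_mult[symmetric] powr_divide field_simps)
  also have "complex_of_real \<dots> = of_real (2 powr (-H)) * w powr of_real H"
    using assms powr_of_real[of "z / 2" H] by (simp add: w_def)
  finally have 1: "(of_real z / 4 :: complex) powr of_real H = of_real (2 powr (-H)) * w powr of_real H" .
  have 2: "w powr of_real H * w powr of_real (-H) = 1"
    using w by (simp add: powr_minus)
  have 3: "w powr of_real H * w powr of_real (1 - H) = w"
    using w by (simp add: powr_add[symmetric])
  have w': "of_real z / 2 = w" by (simp add: w_def)
  have *: "p * s * (p1 * a + \<i> * (p2 * b)) = s * (a + \<i> * (w * b))"
    if "p * p1 = 1" "p * p2 = w" for p p1 p2 s a b :: complex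
    using that by (auto simp: algebra_simps)
  show ?thesis
    unfolding fbm_phi_def bessel_J_def 1 w' Let_def w_def[symmetric]
    using assms *[OF 2 3, of "of_real (2 powr (-H))" "bessel_J_even (-H) w" "bessel_J_even (1 - H) w"]
    by (simp add: mult_ac)
qed

definition fbm_S :: "real \<Rightarrow> real \<Rightarrow> real \<Rightarrow> real \<Rightarrow> complex" where
  "fbm_S H T \<omega> x =
     (LINT u:{0..T}|interval_measure (fbm_V H). cnj (fbm_phi H (u * \<omega>)) * fbm_phi H (u * x))"

end

theory Submission
  imports Defs
begin

text \<open>
  Centred at \<open>a = T/2\<close>, the function \<open>e\<^sub>t\<close> is the phase \<open>exp (\<i> a \<lambda>)\<close> times a combination of the even
  function \<open>sin (y \<lambda>) / \<lambda>\<close> and the odd function \<open>(cos (y \<lambda>) - cos (a \<lambda>)) / \<lambda>\<close>, \<open>y = t - a\<close>.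
  A Christoffel-Darboux computation writes \<open>S\<^sub>T(\<omega>, \<lambda>)\<close> as the phase \<open>exp (\<i> a (\<lambda> - \<omega>))\<close> times the sum
  of an even and an odd kernel, the Hankel transforms of order \<open>-H\<close> and \<open>1 - H\<close> of truncated
  Bessel functions; a truncated Bessel function represents evaluation at \<open>\<omega>\<close> on the transforms of
  functions with support in the same interval.  So reproduction of \<open>e\<^sub>t\<close> is Parseval's identity for
  the Hankel transform, applied to Sonine's integrals of \<open>(Y - x)\<^sup>H\<^sup>-\<^sup>1\<^sup>/\<^sup>2\<close>.  In the variables
  \<open>x = u\<^sup>2 / 16\<close> and \<open>\<tau> = \<lambda>\<^sup>2\<close> the Hankel transform has the kernel \<open>C\<^sub>\<nu>(x \<tau>)\<close> (Bessel-Clifford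
  function) with respect to \<open>x\<^sup>\<nu> dx\<close> and maps \<open>exp (- q x)\<close> to \<open>q\<^sup>-\<^sup>\<nu>\<^sup>-\<^sup>1 exp (- \<tau> / q)\<close>; hence it is
  isometric on the span of the exponentials, and Weierstrass approximation extends this to all
  functions needed.  The passage from the span of the \<open>e\<^sub>t\<close> to its closure uses only that the
  \<open>L\<^sup>2\<close>-norm of \<open>S\<^sub>T(\<omega>, \<cdot>)\<close> is locally bounded in \<open>\<omega>\<close> and that \<open>\<psi>\<close> is continuous.
\<close>

section \<open>Bessel-Clifford functions and the Hankel transform\<close>

text \<open>The scaling comes from \<open>J_nu(w) = (w/2)^nu C_nu(w^2/4)\<close>: \<phi>(z) contains
  Bessel functions of z/2, so the argument of C is z^2/16, and u <= T becomes x <= T^2/16. The same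
  bound appears on the other side: \<open>sinc_kernel y\<close> is the transform of a function
  living on x < y^2/4, and y <= T/2 gives exactly y^2/4 <= T^2/16. One spectral measure serves both
  orders. With \<tau> = \<lambda>^2 the weight \<lambda>^(1-2H) d\<lambda> is \<tau>^(-H) d\<tau> /
  2, of order -H; a product of two odd functions supplies another factor \<lambda>^2 = \<tau>, which
  makes the order 1-H. The order -H is the first obstacle: for H > 1/2 it lies below -1/2, where the
  kernel is unbounded in x. Hence the isometry is proved on a class of functions that come with
  approximants whose transforms converge pointwise, and it is applied to functions of bounded
  support. The second obstacle is the odd part of e_t: at order 1-H Sonine's integral yields sin(y
  \<lambda>)/\<lambda>^2 - y cos(y \<lambda>)/\<lambda> instead of it, and the two are related by an
  integration in y.\<close>

definition powr_measure :: "real \<Rightarrow> real measure" where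
  "powr_measure \<nu> = density lborel (\<lambda>x. ennreal (indicator {0<..} x * x powr \<nu>))"

lemma sets_powr_measure [simp, measurable_cong]: "sets (powr_measure \<nu>) = sets borel"
  and space_powr_measure [simp]: "space (powr_measure \<nu>) = UNIV"
  by (simp_all add: powr_measure_def)

lemma AE_powr_measure_pos: "AE x in powr_measure \<nu>. x > 0"
  unfolding powr_measure_def by (subst AE_density) (auto split: split_indicator)

lemma has_bochner_integral_powr_measure:
  fixes f :: "real \<Rightarrow> real"
  assumes [measurable]: "f \<in> borel_measurable borel"
  shows "has_bochner_integral (powr_measure \<nu>) f I \<longleftrightarrow>
    has_bochner_integral lborel (\<lambda>x. indicator {0<..} x * x powr \<nu> * f x) I"
  unfolding powr_measure_def has_bochner_integral_iff
  by (subst integrable_density, simp, simp, simp, subst integral_density) auto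

text \<open>Gauge integrability alone does not give Lebesgue integrability; the sign condition on
  \<open>f\<close> does, and so the gauge integrals for Gamma and Beta can be imported.\<close>

lemma has_bochner_integral_powr_measureI:
  fixes f :: "real \<Rightarrow> real"
  assumes [measurable]: "f \<in> borel_measurable borel"
    and nonneg: "\<And>x. x > 0 \<Longrightarrow> f x \<ge> 0"
    and I: "((\<lambda>x. x powr \<nu> * f x) has_integral I) {0<..}"
  shows "has_bochner_integral (powr_measure \<nu>) f I"
proof -
  have "((\<lambda>x. if x \<in> {0<..} then x powr \<nu> * f x else 0) has_integral I) UNIV"
    using I by (subst has_integral_restrict_UNIV)
  then have "((\<lambda>x. indicator {0<..} x * x powr \<nu> * f x) has_integral I) UNIV"
    by (rule has_integral_eq[rotated]) (auto split: split_indicator)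
  moreover have nn: "0 \<le> indicator {0<..} x * x powr \<nu> * f x" for x
    using nonneg by (auto split: split_indicator)
  ultimately have "(\<integral>\<^sup>+x. ennreal (indicator {0<..} x * x powr \<nu> * f x) \<partial>lborel) = ennreal I"
    by (intro nn_integral_has_integral_lborel) auto
  moreover have "I \<ge> 0"
    using I nonneg by (intro has_integral_nonneg[OF I]) auto
  ultimately have "has_bochner_integral lborel (\<lambda>x. indicator {0<..} x * x powr \<nu> * f x) I"
    using nn by (intro has_bochner_integral_nn_integral) auto
  then show ?thesis by (subst has_bochner_integral_powr_measure) auto
qed

lemma Gamma_integral_powr_measure:
  assumes "\<nu> > -1" "q > 0"
  shows "has_bochner_integral (powr_measure \<nu>) (\<lambda>x. x ^ k * exp (- q * x))
           (Gamma (real k + \<nu> + 1) / q powr (real k + \<nu> + 1))"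
proof -
  have "((\<lambda>t. t powr (real k + \<nu> + 1 - 1) / exp t) has_integral Gamma (real k + \<nu> + 1)) {0..}"
    using assms by (intro Gamma_integral_real) auto
  then have "((\<lambda>t. t powr (real k + \<nu>) / exp t) has_integral Gamma (real k + \<nu> + 1)) {0<..}"
    by (subst has_integral_spike_set_eq[of "{0<..}" "{0..}"])
       (auto intro: negligible_subset[OF negligible_sing[of 0]])
  then have "((\<lambda>x. x powr \<nu> * (x ^ k * exp (- x))) has_integral Gamma (real k + \<nu> + 1)) {0<..}"
    by (rule has_integral_eq[rotated])
       (auto simp: powr_add powr_realpow exp_minus field_simps)
  then have "has_bochner_integral (powr_measure \<nu>) (\<lambda>x. x ^ k * exp (- x)) (Gamma (real k + \<nu> + 1))"
    by (intro has_bochner_integral_powr_measureI) auto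
  then have "has_bochner_integral lborel
      (\<lambda>x. indicator {0<..} x * x powr \<nu> * (x ^ k * exp (- x))) (Gamma (real k + \<nu> + 1))"
    by (subst (asm) has_bochner_integral_powr_measure) auto
  then have "has_bochner_integral lborel
      (\<lambda>x. indicator {0<..} (0 + q * x) * (0 + q * x) powr \<nu> * ((0 + q * x) ^ k * exp (- (0 + q * x))))
      (Gamma (real k + \<nu> + 1) /\<^sub>R \<bar>q\<bar>)"
    using assms(2) by (subst (asm) lborel_has_bochner_integral_real_affine_iff[of q _ _ 0]) auto
  \<comment> \<open>This factor takes back the powers of \<open>q\<close> that the substitution has
    put into the weight and the monomial.\<close>
  note has_bochner_integral_mult_right[OF this, of "q powr - (real k + \<nu>)"]
  also have "(\<lambda>x. q powr - (real k + \<nu>) * (indicator {0<..} (0 + q * x) * (0 + q * x) powr \<nu> *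
        ((0 + q * x) ^ k * exp (- (0 + q * x))))) =
      (\<lambda>x. indicator {0<..} x * x powr \<nu> * (x ^ k * exp (- q * x)))"
  proof
    show "q powr - (real k + \<nu>) * (indicator {0<..} (0 + q * x) * (0 + q * x) powr \<nu> *
        ((0 + q * x) ^ k * exp (- (0 + q * x)))) =
      indicator {0<..} x * x powr \<nu> * (x ^ k * exp (- q * x))" for x
      using assms(2)
      by (cases "x > 0")
         (auto simp: zero_less_mult_iff powr_mult powr_diff powr_minus powr_add powr_realpow power_mult_distrib field_simps)
  qed
  also have "q powr - (real k + \<nu>) * (Gamma (real k + \<nu> + 1) /\<^sub>R \<bar>q\<bar>) =
     Gamma (real k + \<nu> + 1) / q powr (real k + \<nu> + 1)"
    using assms(2) by (simp add: powr_add powr_diff powr_minus field_simps)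
  finally show ?thesis by (subst has_bochner_integral_powr_measure) auto
qed

definition clifford_coeff :: "real \<Rightarrow> nat \<Rightarrow> real" where
  "clifford_coeff \<nu> k = (-1) ^ k / (fact k * Gamma (real k + \<nu> + 1))"

text \<open>This is \<open>z^(-nu/2) J_nu(2 sqrt z)\<close>: removing the branch factor leaves an
  entire function whose argument is a square of the usual one.\<close>

definition bessel_clifford :: "real \<Rightarrow> real \<Rightarrow> real" where
  "bessel_clifford \<nu> z = (\<Sum>k. clifford_coeff \<nu> k * z ^ k)"

lemma clifford_coeff_Suc:
  assumes "\<nu> > -1"
  shows "clifford_coeff \<nu> (Suc k) = - clifford_coeff \<nu> k / ((real k + 1) * (real k + \<nu> + 1))"
proof -
  have "real k + \<nu> + 1 \<notin> \<int>\<^sub>\<le>\<^sub>0" using assms by (auto elim!: nonpos_Ints_cases)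
  then have "Gamma (real k + \<nu> + 1 + 1) = (real k + \<nu> + 1) * Gamma (real k + \<nu> + 1)"
    by (rule Gamma_plus1)
  then show ?thesis by (simp add: clifford_coeff_def algebra_simps)
qed

lemma summable_clifford:
  assumes "\<nu> > -1"
  shows "summable (\<lambda>k. norm (clifford_coeff \<nu> k * z ^ k))"
\<comment> \<open>The summand 1 in \<open>N\<close> forces \<open>k \<ge> 1\<close>, so that
  \<open>real k + \<nu> + 1\<close> is at least 1 even for \<nu> close to -1; the other factor of
  the denominator then dominates twice the modulus of z.\<close>
proof (rule summable_ratio_test[where c = "1/2" and N = "nat \<lceil>2 * \<bar>z\<bar>\<rceil> + 1"])
  fix k assume k: "k \<ge> nat \<lceil>2 * \<bar>z\<bar>\<rceil> + 1"
  then have "2 * \<bar>z\<bar> \<le> real k" "k \<ge> 1" by linarith+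
  then have "2 * \<bar>z\<bar> * 1 \<le> (real k + 1) * (real k + \<nu> + 1)"
    using assms by (intro mult_mono) auto
  moreover have "0 < (real k + 1) * (real k + \<nu> + 1)"
    using assms \<open>k \<ge> 1\<close> by (intro mult_pos_pos) auto
  ultimately have 1: "\<bar>z\<bar> / ((real k + 1) * (real k + \<nu> + 1)) \<le> 1 / 2"
    by (subst pos_divide_le_eq) auto
  have "0 < real k + \<nu> + 1" using assms by linarith
  then have "norm (clifford_coeff \<nu> (Suc k) * z ^ Suc k) =
    norm (clifford_coeff \<nu> k * z ^ k) * (\<bar>z\<bar> / ((real k + 1) * (real k + \<nu> + 1)))"
    using assms by (simp add: clifford_coeff_Suc abs_mult power_abs)
  also have "\<dots> \<le> norm (clifford_coeff \<nu> k * z ^ k) * (1 / 2)"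
    by (rule mult_left_mono[OF 1]) simp
  finally show "norm (norm (clifford_coeff \<nu> (Suc k) * z ^ Suc k)) \<le>
     1 / 2 * norm (norm (clifford_coeff \<nu> k * z ^ k))"
    by (simp only: real_norm_def abs_idempotent mult.commute[of "1 / 2"])
qed simp

lemma summable_clifford': "\<nu> > -1 \<Longrightarrow> summable (\<lambda>k. clifford_coeff \<nu> k * z ^ k)"
  by (rule summable_norm_cancel[OF summable_clifford])

lemma sums_clifford: "\<nu> > -1 \<Longrightarrow> (\<lambda>k. clifford_coeff \<nu> k * z ^ k) sums bessel_clifford \<nu> z"
  unfolding bessel_clifford_def by (intro summable_sums summable_clifford')

text \<open>Differentiating a power series shifts the index: one factor of the factorial cancels and
  the argument of Gamma grows by 1, which amounts to raising the order.\<close>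

lemma DERIV_bessel_clifford:
  assumes "\<nu> > -1"
  shows "(bessel_clifford \<nu> has_real_derivative - bessel_clifford (\<nu> + 1) z) (at z)"
proof -
  have "diffs (clifford_coeff \<nu>) k = - clifford_coeff (\<nu> + 1) k" for k
  proof -
    have "real (Suc k) \<noteq> 0" by simp
    then have "diffs (clifford_coeff \<nu>) k = (-1) ^ Suc k / (fact k * Gamma (real (Suc k) + \<nu> + 1))"
      unfolding diffs_def clifford_coeff_def fact_Suc of_nat_mult by (simp del: of_nat_Suc)
    then show ?thesis by (simp add: clifford_coeff_def algebra_simps)
  qed
  moreover have "((\<lambda>x. \<Sum>k. clifford_coeff \<nu> k * x ^ k) has_real_derivative
      (\<Sum>k. diffs (clifford_coeff \<nu>) k * z ^ k)) (at z)"
    by (rule termdiffs_strong_converges_everywhere) (rule summable_clifford'[OF assms])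
  moreover have "(\<Sum>k. - clifford_coeff (\<nu> + 1) k * z ^ k) = - bessel_clifford (\<nu> + 1) z"
  proof -
    have "(\<lambda>k. - (clifford_coeff (\<nu> + 1) k * z ^ k)) sums - bessel_clifford (\<nu> + 1) z"
      using assms by (intro sums_minus sums_clifford) linarith
    then show ?thesis by (simp add: sums_iff)
  qed
  ultimately show ?thesis
    by (simp add: bessel_clifford_def[abs_def])
qed

lemma continuous_on_bessel_clifford [continuous_intros]:
  assumes "continuous_on A f" "\<nu> > -1"
  shows "continuous_on A (\<lambda>x. bessel_clifford \<nu> (f x))"
proof -
  have "continuous_on UNIV (bessel_clifford \<nu>)"
    by (intro continuous_at_imp_continuous_on ballI DERIV_isCont[OF DERIV_bessel_clifford[OF assms(2)]])
  from continuous_on_compose2[OF this assms(1)] show ?thesis by auto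
qed

lemma borel_measurable_bessel_clifford [measurable]: "bessel_clifford \<nu> \<in> borel_measurable borel"
proof -
  have "(\<lambda>z. \<Sum>k. clifford_coeff \<nu> k * z ^ k) \<in> borel_measurable borel"
    by (rule borel_measurable_suminf) measurable
  then show ?thesis by (simp add: bessel_clifford_def[abs_def])
qed

text \<open>The three-term recurrence of Bessel functions without branches. At \<open>z ^ k\<close>
  the shifted series contributes k times the coefficient of order \<nu> + 1, and (\<nu> + 1) + k is
  the factor in the functional equation of Gamma.\<close>

lemma bessel_clifford_recurrence:
  assumes "\<nu> > -1"
  shows "(\<nu> + 1) * bessel_clifford (\<nu> + 1) z - z * bessel_clifford (\<nu> + 2) z = bessel_clifford \<nu> z"
proof -
  have 1: "(\<lambda>k. (if k = 0 then 0 else clifford_coeff (\<nu> + 2) (k - 1)) * z ^ k) sums (z * bessel_clifford (\<nu> + 2) z)"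
    (is "?f sums _")
  proof -
    have "(\<lambda>k. z * (clifford_coeff (\<nu> + 2) k * z ^ k)) sums (z * bessel_clifford (\<nu> + 2) z)"
      using assms by (intro sums_mult sums_clifford) auto
    also have "(\<lambda>k. z * (clifford_coeff (\<nu> + 2) k * z ^ k)) = (\<lambda>k. ?f (Suc k))"
      by (auto simp: fun_eq_iff)
    finally show ?thesis by (subst (asm) sums_Suc_iff) simp
  qed
  have 2: "(\<nu> + 1) * (clifford_coeff (\<nu> + 1) k * z ^ k) -
      (if k = 0 then 0 else clifford_coeff (\<nu> + 2) (k - 1)) * z ^ k = clifford_coeff \<nu> k * z ^ k" for k
  proof -
    have "real k + \<nu> + 1 \<notin> \<int>\<^sub>\<le>\<^sub>0" using assms by (auto elim!: nonpos_Ints_cases)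
    then have G: "Gamma (real k + (\<nu> + 1) + 1) = (real k + \<nu> + 1) * Gamma (real k + \<nu> + 1)"
      using Gamma_plus1[of "real k + \<nu> + 1"] by (simp add: algebra_simps)
    have G0: "Gamma (real k + \<nu> + 1) > 0" "real k + \<nu> + 1 > 0"
      using assms by (auto intro!: Gamma_real_pos)
    have "(\<nu> + 1) * clifford_coeff (\<nu> + 1) k - (if k = 0 then 0 else clifford_coeff (\<nu> + 2) (k - 1))
       = clifford_coeff \<nu> k"
    proof (cases k)
      case 0
      then show ?thesis using G G0 by (simp add: clifford_coeff_def)
    next
      case (Suc j)
      have "clifford_coeff (\<nu> + 2) j = - real k * clifford_coeff (\<nu> + 1) k"
      proof -
        have "real (Suc j) \<noteq> 0" by simp
        then have "- real (Suc j) * clifford_coeff (\<nu> + 1) (Suc j) =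
            (-1) ^ j / (fact j * Gamma (real (Suc j) + (\<nu> + 1) + 1))"
          unfolding clifford_coeff_def fact_Suc of_nat_mult by (simp del: of_nat_Suc)
        then show ?thesis using Suc by (simp add: clifford_coeff_def algebra_simps)
      qed
      moreover have "clifford_coeff \<nu> k = (real k + \<nu> + 1) * clifford_coeff (\<nu> + 1) k"
        using G G0 unfolding clifford_coeff_def by simp
      ultimately show ?thesis using Suc by (simp add: algebra_simps)
    qed
    then show ?thesis by (simp flip: mult.assoc left_diff_distrib)
  qed
  have "(\<lambda>k. (\<nu> + 1) * (clifford_coeff (\<nu> + 1) k * z ^ k) -
      (if k = 0 then 0 else clifford_coeff (\<nu> + 2) (k - 1)) * z ^ k) sums
      ((\<nu> + 1) * bessel_clifford (\<nu> + 1) z - z * bessel_clifford (\<nu> + 2) z)"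
    using assms by (intro sums_diff sums_mult sums_clifford 1) auto
  then show ?thesis
    unfolding 2 using sums_unique2 sums_clifford[OF assms] by blast
qed

text \<open>In square variables the factors \<open>(x * \<tau>) powr (\<nu> / 2)\<close> of the
  Bessel function are absorbed into the functions and the measure; this is why
  \<open>powr_measure \<nu>\<close> serves on both sides of the isometry.\<close>

definition hankel :: "real \<Rightarrow> (real \<Rightarrow> real) \<Rightarrow> real \<Rightarrow> real" where
  "hankel \<nu> f \<tau> = (\<integral>x. f x * bessel_clifford \<nu> (x * \<tau>) \<partial>powr_measure \<nu>)"

text \<open>The moments of \<open>exp (- q * x)\<close> cancel the Gamma factors of
  \<open>clifford_coeff\<close>, and what remains is the exponential series at - \<tau> / q. The
  interchange of sum and integral is justified by the same computation with absolute values, which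
  sums to a multiple of \<open>exp (\<tau> / q)\<close>.\<close>

lemma hankel_exp:
  assumes "\<nu> > -1" "q > 0" "\<tau> \<ge> 0"
  shows "has_bochner_integral (powr_measure \<nu>) (\<lambda>x. exp (- q * x) * bessel_clifford \<nu> (x * \<tau>))
    (q powr (- \<nu> - 1) * exp (- \<tau> / q))"
proof -
  define f where "f k x = clifford_coeff \<nu> k * \<tau> ^ k * (x ^ k * exp (- q * x))" for k x
  have Gp: "Gamma (real k + \<nu> + 1) > 0" for k using assms by (intro Gamma_real_pos) auto
  have f_int: "has_bochner_integral (powr_measure \<nu>) (f k)
     (clifford_coeff \<nu> k * \<tau> ^ k * (Gamma (real k + \<nu> + 1) / q powr (real k + \<nu> + 1)))" for k
    unfolding f_def[abs_def]
    by (intro has_bochner_integral_mult_right Gamma_integral_powr_measure assms)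
  have coeff: "clifford_coeff \<nu> k * \<tau> ^ k * (Gamma (real k + \<nu> + 1) / q powr (real k + \<nu> + 1)) =
     q powr (- \<nu> - 1) * ((- \<tau> / q) ^ k /\<^sub>R fact k)" for k
  proof -
    have "(- \<tau> / q) ^ k = ((-1) * \<tau> / q) ^ k" by simp
    also have "\<dots> = (-1) ^ k * \<tau> ^ k / q ^ k" by (simp only: power_divide power_mult_distrib)
    finally show ?thesis
      using Gp[of k] assms(2)
      by (simp add: clifford_coeff_def powr_add powr_diff powr_minus powr_realpow divide_simps)
  qed
  have f_abs: "has_bochner_integral (powr_measure \<nu>) (\<lambda>x. norm (f k x))
     (q powr (- \<nu> - 1) * ((\<tau> / q) ^ k /\<^sub>R fact k))" for k
  proof -
    have "has_bochner_integral (powr_measure \<nu>) (\<lambda>x. (-1) ^ k * f k x)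
     ((-1) ^ k * (clifford_coeff \<nu> k * \<tau> ^ k * (Gamma (real k + \<nu> + 1) / q powr (real k + \<nu> + 1))))"
      by (intro has_bochner_integral_mult_right f_int)
    also have "(-1) ^ k * (clifford_coeff \<nu> k * \<tau> ^ k * (Gamma (real k + \<nu> + 1) / q powr (real k + \<nu> + 1)))
       = q powr (- \<nu> - 1) * ((\<tau> / q) ^ k /\<^sub>R fact k)"
    proof -
      have "(-1) ^ k * (- \<tau> / q) ^ k = (\<tau> / q) ^ k"
        by (subst power_mult_distrib[symmetric]) simp
      moreover have "s * (A * (c *\<^sub>R y)) = A * (c *\<^sub>R (s * y))" for s A c y :: real
        by simp
      ultimately show ?thesis unfolding coeff by presburger
    qed
    finally show ?thesis
    proof (rule has_bochner_integral_cong_AE[THEN iffD1, rotated -1])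
      show "AE x in powr_measure \<nu>. (-1) ^ k * f k x = norm (f k x)"
        using AE_powr_measure_pos
      proof eventually_elim
        case (elim x)
        have "norm (f k x) = \<bar>clifford_coeff \<nu> k\<bar> * \<tau> ^ k * (x ^ k * exp (- q * x))"
          using elim assms by (simp add: f_def abs_mult)
        moreover have "\<bar>clifford_coeff \<nu> k\<bar> = (-1) ^ k * clifford_coeff \<nu> k"
          using Gp[of k] by (simp add: clifford_coeff_def abs_mult flip: power_mult_distrib)
        ultimately show ?case by (simp add: f_def)
      qed
    qed (auto simp: f_def[abs_def])
  qed
  have exp_sums: "(\<lambda>k. z ^ k /\<^sub>R fact k) sums exp z" for z :: real
    by (rule exp_converges)
  have ptw: "(\<lambda>k. f k x) sums (exp (- q * x) * bessel_clifford \<nu> (x * \<tau>))" for x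
    using sums_mult[OF sums_clifford[OF assms(1)], of "exp (- q * x)" "x * \<tau>"]
    by (simp add: f_def power_mult_distrib mult_ac)
  have ptw_abs: "summable (\<lambda>k. norm (f k x))" for x
    using summable_mult[OF summable_clifford[OF assms(1)], of "exp (- q * x)" "x * \<tau>"]
    by (simp add: f_def power_mult_distrib mult_ac abs_mult)
  have *: "integrable (powr_measure \<nu>) (f k)" for k
    using f_int by (auto simp: has_bochner_integral_iff)
  have sm: "summable (\<lambda>k. \<integral>x. norm (f k x) \<partial>powr_measure \<nu>)"
  proof -
    have "(\<integral>x. norm (f k x) \<partial>powr_measure \<nu>) = q powr (- \<nu> - 1) * ((\<tau> / q) ^ k /\<^sub>R fact k)" for k
      using f_abs[of k] by (auto simp: has_bochner_integral_iff)
    then show ?thesis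
      using summable_mult[OF sums_summable[OF exp_sums[of "\<tau> / q"]]] by simp
  qed
  have "integrable (powr_measure \<nu>) (\<lambda>x. \<Sum>k. f k x)"
    by (rule integrable_suminf[OF * _ sm]) (use ptw_abs in auto)
  moreover have "(\<lambda>k. integral\<^sup>L (powr_measure \<nu>) (f k)) sums (\<integral>x. (\<Sum>k. f k x) \<partial>powr_measure \<nu>)"
    by (rule sums_integral[OF * _ sm]) (use ptw_abs in auto)
  moreover have "(\<Sum>k. f k x) = exp (- q * x) * bessel_clifford \<nu> (x * \<tau>)" for x
    using ptw sums_unique by metis
  moreover have "integral\<^sup>L (powr_measure \<nu>) (f k) = q powr (- \<nu> - 1) * ((- \<tau> / q) ^ k /\<^sub>R fact k)" for k
    using f_int[of k] coeff[of k] by (auto simp: has_bochner_integral_iff)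
  moreover have "(\<lambda>k. q powr (- \<nu> - 1) * ((- \<tau> / q) ^ k /\<^sub>R fact k)) sums (q powr (- \<nu> - 1) * exp (- \<tau> / q))"
    by (intro sums_mult exp_sums)
  ultimately show ?thesis
    by (auto simp: has_bochner_integral_iff dest: sums_unique2)
qed

section \<open>The Hankel transform is an isometry\<close>

lemma L2_Cauchy_Schwarz:
  fixes f g :: "'a \<Rightarrow> 'b::{real_normed_field, banach, second_countable_topology}"
  assumes [measurable]: "f \<in> borel_measurable M" "g \<in> borel_measurable M"
    and f: "integrable M (\<lambda>x. (norm (f x))\<^sup>2)" and g: "integrable M (\<lambda>x. (norm (g x))\<^sup>2)"
  shows "integrable M (\<lambda>x. f x * g x)"
    and "norm (\<integral>x. f x * g x \<partial>M) \<le> sqrt (\<integral>x. (norm (f x))\<^sup>2 \<partial>M) * sqrt (\<integral>x. (norm (g x))\<^sup>2 \<partial>M)"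
proof -
  show int: "integrable M (\<lambda>x. f x * g x)"
  proof (rule Bochner_Integration.integrable_bound[OF Bochner_Integration.integrable_add[OF f g]])
    show "AE x in M. norm (f x * g x) \<le> norm ((norm (f x))\<^sup>2 + (norm (g x))\<^sup>2)"
    proof (rule AE_I2)
      fix x
      have "2 * norm (f x) * norm (g x) \<le> (norm (f x))\<^sup>2 + (norm (g x))\<^sup>2"
        by (rule sum_squares_bound)
      moreover have "norm (f x) * norm (g x) \<ge> 0" by simp
      ultimately have "norm (f x) * norm (g x) \<le> (norm (f x))\<^sup>2 + (norm (g x))\<^sup>2"
        by linarith
      then show "norm (f x * g x) \<le> norm ((norm (f x))\<^sup>2 + (norm (g x))\<^sup>2)"
        by (simp add: norm_mult)
    qed
  qed measurable
  have sq: "(\<integral>\<^sup>+x. (ennreal (norm (h x)))\<^sup>2 \<partial>M) = ennreal (\<integral>x. (norm (h x))\<^sup>2 \<partial>M)"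
    if "integrable M (\<lambda>x. (norm (h x))\<^sup>2)" for h :: "'a \<Rightarrow> 'b"
    using nn_integral_eq_integral[OF that] by (simp add: ennreal_power)
  have "(\<integral>\<^sup>+x. ennreal (norm (f x)) * ennreal (norm (g x)) \<partial>M)\<^sup>2
      \<le> (\<integral>\<^sup>+x. (ennreal (norm (f x)))\<^sup>2 \<partial>M) * (\<integral>\<^sup>+x. (ennreal (norm (g x)))\<^sup>2 \<partial>M)"
    by (rule Cauchy_Schwarz_nn_integral) measurable
  also have "(\<integral>\<^sup>+x. ennreal (norm (f x)) * ennreal (norm (g x)) \<partial>M) = ennreal (\<integral>x. norm (f x * g x) \<partial>M)"
    using nn_integral_eq_integral[OF integrable_norm[OF int]] by (simp add: norm_mult ennreal_mult)
  finally have "ennreal ((\<integral>x. norm (f x * g x) \<partial>M)\<^sup>2) \<le>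
      ennreal ((\<integral>x. (norm (f x))\<^sup>2 \<partial>M) * (\<integral>x. (norm (g x))\<^sup>2 \<partial>M))"
    unfolding sq[OF f] sq[OF g] by (simp add: ennreal_power ennreal_mult)
  then have "(\<integral>x. norm (f x * g x) \<partial>M)\<^sup>2 \<le> (\<integral>x. (norm (f x))\<^sup>2 \<partial>M) * (\<integral>x. (norm (g x))\<^sup>2 \<partial>M)"
    by (subst (asm) ennreal_le_iff) auto
  then have "(\<integral>x. norm (f x * g x) \<partial>M) \<le> sqrt ((\<integral>x. (norm (f x))\<^sup>2 \<partial>M) * (\<integral>x. (norm (g x))\<^sup>2 \<partial>M))"
    by (rule real_le_rsqrt)
  moreover have "norm (\<integral>x. f x * g x \<partial>M) \<le> (\<integral>x. norm (f x * g x) \<partial>M)"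
    by (rule integral_norm_bound)
  ultimately show "norm (\<integral>x. f x * g x \<partial>M) \<le> sqrt (\<integral>x. (norm (f x))\<^sup>2 \<partial>M) * sqrt (\<integral>x. (norm (g x))\<^sup>2 \<partial>M)"
    unfolding real_sqrt_mult by linarith
qed

lemma integrable_square_add:
  fixes f g :: "'a \<Rightarrow> real"
  assumes [measurable]: "f \<in> borel_measurable M" "g \<in> borel_measurable M"
    and f: "integrable M (\<lambda>x. (f x)\<^sup>2)" and g: "integrable M (\<lambda>x. (g x)\<^sup>2)"
  shows "integrable M (\<lambda>x. (f x + g x)\<^sup>2)"
    and "(\<integral>x. (f x + g x)\<^sup>2 \<partial>M) = (\<integral>x. (f x)\<^sup>2 \<partial>M) + (\<integral>x. (g x)\<^sup>2 \<partial>M) + 2 * (\<integral>x. f x * g x \<partial>M)"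
proof -
  have fg: "integrable M (\<lambda>x. f x * g x)"
    by (rule L2_Cauchy_Schwarz) (use f g in auto)
  have eq: "(f x + g x)\<^sup>2 = (f x)\<^sup>2 + (g x)\<^sup>2 + 2 * (f x * g x)" for x
    by (simp add: power2_sum)
  show "integrable M (\<lambda>x. (f x + g x)\<^sup>2)" unfolding eq using f g fg by simp
  show "(\<integral>x. (f x + g x)\<^sup>2 \<partial>M) = (\<integral>x. (f x)\<^sup>2 \<partial>M) + (\<integral>x. (g x)\<^sup>2 \<partial>M) + 2 * (\<integral>x. f x * g x \<partial>M)"
    unfolding eq using f g fg by simp
qed

text \<open>Expanding the square of F + (Fn - F) leaves the error \<open>e n\<close> and a cross
  term, which Cauchy-Schwarz bounds by a multiple of \<open>sqrt (e n)\<close>.\<close>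

lemma integral_square_tendsto:
  fixes F :: "'a \<Rightarrow> real" and Fn :: "nat \<Rightarrow> 'a \<Rightarrow> real"
  assumes [measurable]: "F \<in> borel_measurable M" "\<And>n. Fn n \<in> borel_measurable M"
    and F: "integrable M (\<lambda>x. (F x)\<^sup>2)" and Fn: "\<And>n. integrable M (\<lambda>x. (Fn n x - F x)\<^sup>2)"
    and lim: "(\<lambda>n. \<integral>x. (Fn n x - F x)\<^sup>2 \<partial>M) \<longlonglongrightarrow> 0"
  shows "(\<lambda>n. \<integral>x. (Fn n x)\<^sup>2 \<partial>M) \<longlonglongrightarrow> (\<integral>x. (F x)\<^sup>2 \<partial>M)"
proof -
  define e where "e n = (\<integral>x. (Fn n x - F x)\<^sup>2 \<partial>M)" for n
  define c where "c n = (\<integral>x. F x * (Fn n x - F x) \<partial>M)" for n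
  have eq: "(\<integral>x. (Fn n x)\<^sup>2 \<partial>M) = (\<integral>x. (F x)\<^sup>2 \<partial>M) + e n + 2 * c n" for n
    using integrable_square_add(2)[of F M "\<lambda>x. Fn n x - F x"] F Fn by (simp add: e_def c_def)
  have c: "norm (c n) \<le> sqrt (\<integral>x. (F x)\<^sup>2 \<partial>M) * sqrt (e n)" for n
    using L2_Cauchy_Schwarz(2)[of F M "\<lambda>x. Fn n x - F x"] F Fn by (simp add: c_def e_def)
  have "(\<lambda>n. sqrt (\<integral>x. (F x)\<^sup>2 \<partial>M) * sqrt (e n)) \<longlonglongrightarrow> sqrt (\<integral>x. (F x)\<^sup>2 \<partial>M) * sqrt 0"
    using lim unfolding e_def by (intro tendsto_intros)
  then have "c \<longlonglongrightarrow> 0"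
    using c by (intro Lim_null_comparison[of c]) auto
  then have "(\<lambda>n. (\<integral>x. (F x)\<^sup>2 \<partial>M) + e n + 2 * c n) \<longlonglongrightarrow> (\<integral>x. (F x)\<^sup>2 \<partial>M) + 0 + 2 * 0"
    using lim unfolding e_def by (intro tendsto_intros)
  then show ?thesis unfolding eq by simp
qed

text \<open>Provides square integrability and a norm bound for functions that are known only as
  pointwise limits, as the transforms are.\<close>

lemma Fatou_square:
  fixes F :: "'a \<Rightarrow> real" and Fn :: "nat \<Rightarrow> 'a \<Rightarrow> real"
  assumes [measurable]: "F \<in> borel_measurable M" "\<And>n. Fn n \<in> borel_measurable M"
    and Fn: "\<And>n. integrable M (\<lambda>x. (Fn n x)\<^sup>2)"
    and lim: "(\<lambda>n. \<integral>x. (Fn n x)\<^sup>2 \<partial>M) \<longlonglongrightarrow> I"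
    and ptw: "AE x in M. (\<lambda>n. Fn n x) \<longlonglongrightarrow> F x"
  shows "integrable M (\<lambda>x. (F x)\<^sup>2)" "(\<integral>x. (F x)\<^sup>2 \<partial>M) \<le> I"
proof -
  have I: "I \<ge> 0" by (rule LIMSEQ_le_const[OF lim]) auto
  have "(\<integral>\<^sup>+x. ennreal ((F x)\<^sup>2) \<partial>M) = (\<integral>\<^sup>+x. liminf (\<lambda>n. ennreal ((Fn n x)\<^sup>2)) \<partial>M)"
  proof (rule nn_integral_cong_AE)
    show "AE x in M. ennreal ((F x)\<^sup>2) = liminf (\<lambda>n. ennreal ((Fn n x)\<^sup>2))"
      using ptw
    proof eventually_elim
      case (elim x)
      then have "(\<lambda>n. ennreal ((Fn n x)\<^sup>2)) \<longlonglongrightarrow> ennreal ((F x)\<^sup>2)"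
        by (intro tendsto_ennrealI tendsto_intros)
      then show ?case by (intro lim_imp_Liminf[symmetric]) auto
    qed
  qed
  also have "\<dots> \<le> liminf (\<lambda>n. \<integral>\<^sup>+x. ennreal ((Fn n x)\<^sup>2) \<partial>M)"
    by (rule nn_integral_liminf) measurable
  also have "(\<lambda>n. \<integral>\<^sup>+x. ennreal ((Fn n x)\<^sup>2) \<partial>M) = (\<lambda>n. ennreal (\<integral>x. (Fn n x)\<^sup>2 \<partial>M))"
    using Fn by (intro ext nn_integral_eq_integral) auto
  also have "liminf \<dots> = ennreal I"
    using lim by (intro lim_imp_Liminf tendsto_ennrealI) auto
  finally have *: "(\<integral>\<^sup>+x. ennreal ((F x)\<^sup>2) \<partial>M) \<le> ennreal I" .
  then show int: "integrable M (\<lambda>x. (F x)\<^sup>2)"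
    by (intro integrableI_bounded) (auto simp: top_unique less_top[symmetric] intro: order_le_less_trans)
  from * show "(\<integral>x. (F x)\<^sup>2 \<partial>M) \<le> I"
    unfolding nn_integral_eq_integral[OF int, simplified] using I by simp
qed

text \<open>The outer factor \<open>exp (- x)\<close> excludes a constant term: every exponent is at
  least 1, so these functions are square integrable for each weight with \<nu> > -1.\<close>

definition expoly :: "real poly \<Rightarrow> real \<Rightarrow> real" where
  "expoly p x = exp (- x) * poly p (exp (- x))"

lemma expoly_diff: "expoly (p - q) x = expoly p x - expoly q x"
  and expoly_add: "expoly (p + q) x = expoly p x + expoly q x"
  by (simp_all add: expoly_def algebra_simps)

lemma expoly_altdef: "expoly p x = (\<Sum>i\<le>degree p. coeff p i * exp (- (real i + 1) * x))"
  unfolding expoly_def poly_altdef sum_distrib_left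
  by (intro sum.cong) (auto simp: exp_of_nat_mult[symmetric] exp_add[symmetric] algebra_simps)

lemma borel_measurable_expoly [measurable]: "expoly p \<in> borel_measurable borel"
  unfolding expoly_altdef[abs_def] by (intro borel_measurable_sum) measurable

lemma borel_measurable_hankel [measurable]:
  assumes [measurable]: "f \<in> borel_measurable borel"
  shows "hankel \<nu> f \<in> borel_measurable borel"
proof -
  have "hankel \<nu> f = (\<lambda>\<tau>. \<integral>x. (indicator {0<..} x * x powr \<nu>) *
     (f x * bessel_clifford \<nu> (x * \<tau>)) \<partial>lborel)"
    unfolding hankel_def powr_measure_def by (intro ext, subst integral_density) auto
  then show ?thesis by simp
qed

lemma hankel_expoly:
  assumes "\<nu> > -1" "\<tau> \<ge> 0"
  shows "has_bochner_integral (powr_measure \<nu>) (\<lambda>x. expoly p x * bessel_clifford \<nu> (x * \<tau>))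
    (\<Sum>i\<le>degree p. coeff p i * ((real i + 1) powr (- \<nu> - 1) * exp (- \<tau> / (real i + 1))))"
proof -
  have "has_bochner_integral (powr_measure \<nu>)
    (\<lambda>x. \<Sum>i\<le>degree p. coeff p i * (exp (- (real i + 1) * x) * bessel_clifford \<nu> (x * \<tau>)))
    (\<Sum>i\<le>degree p. coeff p i * ((real i + 1) powr (- \<nu> - 1) * exp (- \<tau> / (real i + 1))))"
    using assms by (intro has_bochner_integral_sum has_bochner_integral_mult_right hankel_exp) auto
  then show ?thesis unfolding expoly_altdef by (simp only: sum_distrib_right mult.assoc)
qed

lemma exp_integral_powr_measure:
  assumes "\<nu> > -1" "q > 0"
  shows "has_bochner_integral (powr_measure \<nu>) (\<lambda>x. exp (- q * x)) (Gamma (\<nu> + 1) * q powr (- \<nu> - 1))"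
  using Gamma_integral_powr_measure[OF assms, of 0] by (simp add: powr_diff powr_minus powr_add divide_simps)

text \<open>For exponentials with rates p and q both Gram entries are Gamma(\<nu>+1)
  (p+q)^(-\<nu>-1). On the transformed side this rests on p q (1/p + 1/q) = p + q. The common value
  \<open>I\<close> carries integrability of both squares along.\<close>

lemma expoly_isometry:
  assumes "\<nu> > -1"
  obtains I where "has_bochner_integral (powr_measure \<nu>) (\<lambda>x. (expoly p x)\<^sup>2) I"
    "has_bochner_integral (powr_measure \<nu>) (\<lambda>\<tau>. (hankel \<nu> (expoly p) \<tau>)\<^sup>2) I"
proof
  define c where "c = coeff p"
  define d where "d = degree p"
  define a where "a i = real i + 1" for i
  have a: "a i > 0" for i by (simp add: a_def add_nonneg_pos)
  define I where "I = (\<Sum>i\<le>d. \<Sum>j\<le>d. c i * c j * (Gamma (\<nu> + 1) * (a i + a j) powr (- \<nu> - 1)))"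
  have "has_bochner_integral (powr_measure \<nu>)
     (\<lambda>x. \<Sum>i\<le>d. \<Sum>j\<le>d. c i * c j * exp (- (a i + a j) * x)) I"
    unfolding I_def using assms a
    by (intro has_bochner_integral_sum has_bochner_integral_mult_right exp_integral_powr_measure add_pos_pos)
  moreover have "(\<Sum>i\<le>d. \<Sum>j\<le>d. c i * c j * exp (- (a i + a j) * x)) = (expoly p x)\<^sup>2" for x
    unfolding expoly_altdef power2_eq_square sum_product c_def d_def a_def
    by (intro sum.cong refl) (simp add: exp_add[symmetric] algebra_simps)
  ultimately show "has_bochner_integral (powr_measure \<nu>) (\<lambda>x. (expoly p x)\<^sup>2) I" by simp
  have "has_bochner_integral (powr_measure \<nu>)
     (\<lambda>\<tau>. \<Sum>i\<le>d. \<Sum>j\<le>d. c i * c j * (a i * a j) powr (- \<nu> - 1) * exp (- (1 / a i + 1 / a j) * \<tau>))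
     (\<Sum>i\<le>d. \<Sum>j\<le>d. c i * c j * (a i * a j) powr (- \<nu> - 1) *
        (Gamma (\<nu> + 1) * (1 / a i + 1 / a j) powr (- \<nu> - 1)))"
    using assms a
    by (intro has_bochner_integral_sum has_bochner_integral_mult_right exp_integral_powr_measure
        add_pos_pos) auto
  also have "(\<Sum>i\<le>d. \<Sum>j\<le>d. c i * c j * (a i * a j) powr (- \<nu> - 1) *
        (Gamma (\<nu> + 1) * (1 / a i + 1 / a j) powr (- \<nu> - 1))) = I"
    unfolding I_def
  proof (intro sum.cong refl)
    fix i j
    have "a i + a j = (a i * a j) * (1 / a i + 1 / a j)"
      using a[of i] a[of j] by (simp add: field_simps)
    moreover have "1 / a i + 1 / a j > 0" using a by (intro add_pos_pos) auto
    ultimately have "(a i + a j) powr (- \<nu> - 1) =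
      (a i * a j) powr (- \<nu> - 1) * (1 / a i + 1 / a j) powr (- \<nu> - 1)"
      using a[of i] a[of j] by (metis powr_mult)
    then show "c i * c j * (a i * a j) powr (- \<nu> - 1) *
        (Gamma (\<nu> + 1) * (1 / a i + 1 / a j) powr (- \<nu> - 1)) =
      c i * c j * (Gamma (\<nu> + 1) * (a i + a j) powr (- \<nu> - 1))"
      by simp
  qed
  finally have *: "has_bochner_integral (powr_measure \<nu>)
     (\<lambda>\<tau>. \<Sum>i\<le>d. \<Sum>j\<le>d. c i * c j * (a i * a j) powr (- \<nu> - 1) * exp (- (1 / a i + 1 / a j) * \<tau>)) I" .
  have **: "(\<Sum>i\<le>d. \<Sum>j\<le>d. c i * c j * (a i * a j) powr (- \<nu> - 1) * exp (- (1 / a i + 1 / a j) * \<tau>)) =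
    (hankel \<nu> (expoly p) \<tau>)\<^sup>2" if "\<tau> > 0" for \<tau>
  proof -
    have h: "hankel \<nu> (expoly p) \<tau> = (\<Sum>i\<le>d. c i * (a i powr (- \<nu> - 1) * exp (- \<tau> / a i)))"
      using hankel_expoly[OF assms, of \<tau> p] that
      unfolding hankel_def has_bochner_integral_iff a_def c_def d_def by simp
    have e: "exp (- (1 / a i + 1 / a j) * \<tau>) = exp (- \<tau> / a i) * exp (- \<tau> / a j)" for i j
      by (simp add: exp_add[symmetric] algebra_simps)
    have m: "(a i * a j) powr (- \<nu> - 1) = a i powr (- \<nu> - 1) * a j powr (- \<nu> - 1)" for i j
      using a[of i] a[of j] by (simp add: powr_mult)
    show ?thesis
      unfolding h power2_eq_square sum_product e m by (simp add: mult_ac)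
  qed
  show "has_bochner_integral (powr_measure \<nu>) (\<lambda>\<tau>. (hankel \<nu> (expoly p) \<tau>)\<^sup>2) I"
    using AE_powr_measure_pos[of \<nu>] **
    by (intro has_bochner_integral_cong_AE[THEN iffD1, OF _ _ _ *]) (auto elim!: eventually_mono)
qed

text \<open>Convergence of the transforms is required separately: for \<open>\<nu> < -1/2\<close> the kernel is unbounded,
  so that it does not follow from the convergence in \<open>L\<^sup>2\<close>.\<close>

definition hankel_class :: "real \<Rightarrow> (real \<Rightarrow> real) set" where
  "hankel_class \<nu> = {f \<in> borel_measurable borel.
     integrable (powr_measure \<nu>) (\<lambda>x. (f x)\<^sup>2) \<and>
     (\<forall>\<tau>>0. integrable (powr_measure \<nu>) (\<lambda>x. f x * bessel_clifford \<nu> (x * \<tau>))) \<and>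
     (\<exists>p. (\<lambda>n. \<integral>x. (expoly (p n) x - f x)\<^sup>2 \<partial>powr_measure \<nu>) \<longlonglongrightarrow> 0 \<and>
          (\<forall>\<tau>>0. (\<lambda>n. hankel \<nu> (expoly (p n)) \<tau>) \<longlonglongrightarrow> hankel \<nu> f \<tau>))}"

lemma hankel_classD:
  assumes "f \<in> hankel_class \<nu>"
  shows "f \<in> borel_measurable borel"
    and "integrable (powr_measure \<nu>) (\<lambda>x. (f x)\<^sup>2)"
    and "\<tau> > 0 \<Longrightarrow> integrable (powr_measure \<nu>) (\<lambda>x. f x * bessel_clifford \<nu> (x * \<tau>))"
  using assms by (auto simp: hankel_class_def)

lemma integrable_expoly_square:
  assumes "\<nu> > -1"
  shows "integrable (powr_measure \<nu>) (\<lambda>x. (expoly p x)\<^sup>2)"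
  using expoly_isometry[OF assms, of p] by (metis has_bochner_integral_iff)

lemma hankel_add:
  assumes "integrable (powr_measure \<nu>) (\<lambda>x. f x * bessel_clifford \<nu> (x * \<tau>))"
    "integrable (powr_measure \<nu>) (\<lambda>x. g x * bessel_clifford \<nu> (x * \<tau>))"
  shows "hankel \<nu> (\<lambda>x. f x + g x) \<tau> = hankel \<nu> f \<tau> + hankel \<nu> g \<tau>"
  using assms by (simp add: hankel_def distrib_right)

lemma hankel_diff:
  assumes "integrable (powr_measure \<nu>) (\<lambda>x. f x * bessel_clifford \<nu> (x * \<tau>))"
    "integrable (powr_measure \<nu>) (\<lambda>x. g x * bessel_clifford \<nu> (x * \<tau>))"
  shows "hankel \<nu> (\<lambda>x. f x - g x) \<tau> = hankel \<nu> f \<tau> - hankel \<nu> g \<tau>"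
  using assms by (simp add: hankel_def left_diff_distrib)

lemma integrable_expoly_clifford:
  assumes "\<nu> > -1" "\<tau> > 0"
  shows "integrable (powr_measure \<nu>) (\<lambda>x. expoly p x * bessel_clifford \<nu> (x * \<tau>))"
  using hankel_expoly[OF assms(1), of \<tau> p] assms(2) by (auto simp: has_bochner_integral_iff)

lemma integrable_square_diff:
  fixes f g :: "'a \<Rightarrow> real"
  assumes [measurable]: "f \<in> borel_measurable M" "g \<in> borel_measurable M"
    and f: "integrable M (\<lambda>x. (f x)\<^sup>2)" and g: "integrable M (\<lambda>x. (g x)\<^sup>2)"
  shows "integrable M (\<lambda>x. (f x - g x)\<^sup>2)"
  using integrable_square_add(1)[of f M "\<lambda>x. - g x"] f g by simp

text \<open>The defect of the transform of an exponential polynomial approximating \<open>f\<close> is, by Fatou's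
  lemma, at most the defect of the approximation itself.\<close>

lemma hankel_isometry:
  assumes nu: "\<nu> > -1" and f: "f \<in> hankel_class \<nu>"
  shows "integrable (powr_measure \<nu>) (\<lambda>\<tau>. (hankel \<nu> f \<tau>)\<^sup>2)"
    and "(\<integral>\<tau>. (hankel \<nu> f \<tau>)\<^sup>2 \<partial>powr_measure \<nu>) = (\<integral>x. (f x)\<^sup>2 \<partial>powr_measure \<nu>)"
proof -
  let ?L = "powr_measure \<nu>"
  note [measurable] = hankel_classD(1)[OF f]
  have f2: "integrable ?L (\<lambda>x. (f x)\<^sup>2)" by (rule hankel_classD(2)[OF f])
  obtain p where p1: "(\<lambda>n. \<integral>x. (expoly (p n) x - f x)\<^sup>2 \<partial>?L) \<longlonglongrightarrow> 0"
    and p2: "\<And>\<tau>. \<tau> > 0 \<Longrightarrow> (\<lambda>n. hankel \<nu> (expoly (p n)) \<tau>) \<longlonglongrightarrow> hankel \<nu> f \<tau>"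
    using f by (auto simp: hankel_class_def)
  let ?g = "\<lambda>n. expoly (p n)"
  have g2: "integrable ?L (\<lambda>x. (?g n x)\<^sup>2)" for n by (rule integrable_expoly_square[OF nu])
  have fg: "integrable ?L (\<lambda>x. (?g n x - f x)\<^sup>2)" "integrable ?L (\<lambda>x. (f x - ?g n x)\<^sup>2)" for n
    by (intro integrable_square_diff g2 f2; measurable)+
  have h2: "integrable ?L (\<lambda>\<tau>. (hankel \<nu> (?g n) \<tau>)\<^sup>2)"
    "(\<integral>\<tau>. (hankel \<nu> (?g n) \<tau>)\<^sup>2 \<partial>?L) = (\<integral>x. (?g n x)\<^sup>2 \<partial>?L)" for n
    using expoly_isometry[OF nu, of "p n"] by (auto simp: has_bochner_integral_iff)
  have diff: "integrable ?L (\<lambda>\<tau>. (hankel \<nu> (?g m) \<tau> - hankel \<nu> (?g n) \<tau>)\<^sup>2)"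
    "(\<integral>\<tau>. (hankel \<nu> (?g m) \<tau> - hankel \<nu> (?g n) \<tau>)\<^sup>2 \<partial>?L) = (\<integral>x. (?g m x - ?g n x)\<^sup>2 \<partial>?L)" for m n
  proof -
    have h: "AE \<tau> in ?L. (hankel \<nu> (expoly (p m - p n)) \<tau>)\<^sup>2 = (hankel \<nu> (?g m) \<tau> - hankel \<nu> (?g n) \<tau>)\<^sup>2"
      using AE_powr_measure_pos[of \<nu>]
    proof eventually_elim
      case (elim \<tau>)
      have "hankel \<nu> (expoly (p m - p n)) \<tau> = hankel \<nu> (?g m) \<tau> - hankel \<nu> (?g n) \<tau>"
        unfolding expoly_diff[abs_def]
        by (intro hankel_diff integrable_expoly_clifford nu elim)
      then show ?case by simp
    qed
    obtain I where I: "has_bochner_integral ?L (\<lambda>x. (expoly (p m - p n) x)\<^sup>2) I"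
      "has_bochner_integral ?L (\<lambda>\<tau>. (hankel \<nu> (expoly (p m - p n)) \<tau>)\<^sup>2) I"
      by (rule expoly_isometry[OF nu])
    have "has_bochner_integral ?L (\<lambda>\<tau>. (hankel \<nu> (?g m) \<tau> - hankel \<nu> (?g n) \<tau>)\<^sup>2) I"
      by (rule has_bochner_integral_cong_AE[THEN iffD1, OF _ _ h I(2)]) measurable
    then show "integrable ?L (\<lambda>\<tau>. (hankel \<nu> (?g m) \<tau> - hankel \<nu> (?g n) \<tau>)\<^sup>2)"
      "(\<integral>\<tau>. (hankel \<nu> (?g m) \<tau> - hankel \<nu> (?g n) \<tau>)\<^sup>2 \<partial>?L) = (\<integral>x. (?g m x - ?g n x)\<^sup>2 \<partial>?L)"
      using I(1) by (auto simp: has_bochner_integral_iff expoly_diff)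
  qed
  \<comment> \<open>Now \<open>n\<close> is fixed and \<open>m\<close> tends to infinity, first for
    the functions and then, through Fatou, for their transforms.\<close>
  have lim: "(\<lambda>m. \<integral>x. (?g m x - ?g n x)\<^sup>2 \<partial>?L) \<longlonglongrightarrow> (\<integral>x. (f x - ?g n x)\<^sup>2 \<partial>?L)" for n
    by (rule integral_square_tendsto) (use fg p1 in auto)
  have F: "integrable ?L (\<lambda>\<tau>. (hankel \<nu> f \<tau> - hankel \<nu> (?g n) \<tau>)\<^sup>2)"
    "(\<integral>\<tau>. (hankel \<nu> f \<tau> - hankel \<nu> (?g n) \<tau>)\<^sup>2 \<partial>?L) \<le> (\<integral>x. (f x - ?g n x)\<^sup>2 \<partial>?L)" for n
  proof -
    have A: "AE \<tau> in ?L. (\<lambda>m. hankel \<nu> (?g m) \<tau> - hankel \<nu> (?g n) \<tau>) \<longlonglongrightarrow> hankel \<nu> f \<tau> - hankel \<nu> (?g n) \<tau>"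
      using AE_powr_measure_pos[of \<nu>] by eventually_elim (intro tendsto_intros p2)
    have B: "(\<lambda>m. \<integral>\<tau>. (hankel \<nu> (?g m) \<tau> - hankel \<nu> (?g n) \<tau>)\<^sup>2 \<partial>?L) \<longlonglongrightarrow> (\<integral>x. (f x - ?g n x)\<^sup>2 \<partial>?L)"
      unfolding diff by (rule lim)
    show "integrable ?L (\<lambda>\<tau>. (hankel \<nu> f \<tau> - hankel \<nu> (?g n) \<tau>)\<^sup>2)"
      by (rule Fatou_square(1)[OF _ _ diff(1) B A]) measurable
    show "(\<integral>\<tau>. (hankel \<nu> f \<tau> - hankel \<nu> (?g n) \<tau>)\<^sup>2 \<partial>?L) \<le> (\<integral>x. (f x - ?g n x)\<^sup>2 \<partial>?L)"
      by (rule Fatou_square(2)[OF _ _ diff(1) B A]) measurable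
  qed
  \<comment> \<open>So far only the distance to an approximant is known to be finite; adding the
    transform of one approximant back gives square integrability of \<open>hankel \<nu> f\<close>
    itself.\<close>
  have "integrable ?L (\<lambda>\<tau>. ((hankel \<nu> f \<tau> - hankel \<nu> (?g 0) \<tau>) + hankel \<nu> (?g 0) \<tau>)\<^sup>2)"
    by (intro integrable_square_add(1) F h2; measurable)
  then show hf: "integrable ?L (\<lambda>\<tau>. (hankel \<nu> f \<tau>)\<^sup>2)" by simp
  have lim0: "(\<lambda>n. \<integral>\<tau>. (hankel \<nu> (?g n) \<tau> - hankel \<nu> f \<tau>)\<^sup>2 \<partial>?L) \<longlonglongrightarrow> 0"
  proof (rule Lim_null_comparison[OF _ p1], intro always_eventually allI)
    show "norm (\<integral>\<tau>. (hankel \<nu> (?g n) \<tau> - hankel \<nu> f \<tau>)\<^sup>2 \<partial>?L) \<le> (\<integral>x. (?g n x - f x)\<^sup>2 \<partial>?L)" for n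
      using F(2)[of n] by (simp add: power2_commute)
  qed
  have "(\<lambda>n. \<integral>\<tau>. (hankel \<nu> (?g n) \<tau>)\<^sup>2 \<partial>?L) \<longlonglongrightarrow> (\<integral>\<tau>. (hankel \<nu> f \<tau>)\<^sup>2 \<partial>?L)"
    by (rule integral_square_tendsto) (use hf lim0 F(1) in \<open>auto simp: power2_commute\<close>)
  moreover have "(\<lambda>n. \<integral>x. (?g n x)\<^sup>2 \<partial>?L) \<longlonglongrightarrow> (\<integral>x. (f x)\<^sup>2 \<partial>?L)"
    by (rule integral_square_tendsto) (use f2 p1 fg in auto)
  ultimately show "(\<integral>\<tau>. (hankel \<nu> f \<tau>)\<^sup>2 \<partial>?L) = (\<integral>x. (f x)\<^sup>2 \<partial>?L)"
    unfolding h2 by (rule LIMSEQ_unique)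
qed

text \<open>Needed for polarisation, which applies the isometry to a sum. The approximants are the
  sums of those of the summands.\<close>

lemma hankel_class_add:
  assumes nu: "\<nu> > -1" and f: "f \<in> hankel_class \<nu>" and g: "g \<in> hankel_class \<nu>"
  shows "(\<lambda>x. f x + g x) \<in> hankel_class \<nu>"
proof -
  let ?L = "powr_measure \<nu>"
  note [measurable] = hankel_classD(1)[OF f] hankel_classD(1)[OF g]
  obtain p where p1: "(\<lambda>n. \<integral>x. (expoly (p n) x - f x)\<^sup>2 \<partial>?L) \<longlonglongrightarrow> 0"
    and p2: "\<And>\<tau>. \<tau> > 0 \<Longrightarrow> (\<lambda>n. hankel \<nu> (expoly (p n)) \<tau>) \<longlonglongrightarrow> hankel \<nu> f \<tau>"
    using f by (auto simp: hankel_class_def)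
  obtain q where q1: "(\<lambda>n. \<integral>x. (expoly (q n) x - g x)\<^sup>2 \<partial>?L) \<longlonglongrightarrow> 0"
    and q2: "\<And>\<tau>. \<tau> > 0 \<Longrightarrow> (\<lambda>n. hankel \<nu> (expoly (q n)) \<tau>) \<longlonglongrightarrow> hankel \<nu> g \<tau>"
    using g by (auto simp: hankel_class_def)
  have I: "integrable ?L (\<lambda>x. (expoly (p n) x - f x)\<^sup>2)" "integrable ?L (\<lambda>x. (expoly (q n) x - g x)\<^sup>2)" for n
    by (intro integrable_square_diff integrable_expoly_square nu hankel_classD(2)[OF f] hankel_classD(2)[OF g]; measurable)+
  have "(\<lambda>n. \<integral>x. (expoly (p n + q n) x - (f x + g x))\<^sup>2 \<partial>?L) \<longlonglongrightarrow> 0"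
  proof (rule Lim_null_comparison, intro always_eventually allI)
    fix n
    let ?a = "\<lambda>x. expoly (p n) x - f x" and ?b = "\<lambda>x. expoly (q n) x - g x"
    have "(\<integral>x. (?a x + ?b x)\<^sup>2 \<partial>?L) \<le> (\<integral>x. 2 * (?a x)\<^sup>2 + 2 * (?b x)\<^sup>2 \<partial>?L)"
    proof (rule integral_mono)
      show "integrable ?L (\<lambda>x. (?a x + ?b x)\<^sup>2)"
        by (intro integrable_square_add(1) I; measurable)
      show "(?a x + ?b x)\<^sup>2 \<le> 2 * (?a x)\<^sup>2 + 2 * (?b x)\<^sup>2" for x
        using sum_squares_bound[of "?a x" "?b x"] by (simp add: power2_sum)
    qed (use I in auto)
    also have "\<dots> = 2 * (\<integral>x. (?a x)\<^sup>2 \<partial>?L) + 2 * (\<integral>x. (?b x)\<^sup>2 \<partial>?L)"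
      using I by simp
    also have "(\<lambda>x. (?a x + ?b x)\<^sup>2) = (\<lambda>x. (expoly (p n + q n) x - (f x + g x))\<^sup>2)"
      by (simp add: expoly_add algebra_simps)
    finally show "norm (\<integral>x. (expoly (p n + q n) x - (f x + g x))\<^sup>2 \<partial>?L) \<le>
       2 * (\<integral>x. (?a x)\<^sup>2 \<partial>?L) + 2 * (\<integral>x. (?b x)\<^sup>2 \<partial>?L)"
      by simp
  next
    show "(\<lambda>n. 2 * (\<integral>x. (expoly (p n) x - f x)\<^sup>2 \<partial>?L) + 2 * (\<integral>x. (expoly (q n) x - g x)\<^sup>2 \<partial>?L)) \<longlonglongrightarrow> 0"
      by (rule tendsto_eq_intros p1 q1 refl)+ simp
  qed
  moreover have "(\<lambda>n. hankel \<nu> (expoly (p n + q n)) \<tau>) \<longlonglongrightarrow> hankel \<nu> (\<lambda>x. f x + g x) \<tau>" if "\<tau> > 0" for \<tau>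
  proof -
    have "hankel \<nu> (expoly (p n + q n)) \<tau> = hankel \<nu> (expoly (p n)) \<tau> + hankel \<nu> (expoly (q n)) \<tau>" for n
      unfolding expoly_add[abs_def] by (intro hankel_add integrable_expoly_clifford nu that)
    moreover have "hankel \<nu> (\<lambda>x. f x + g x) \<tau> = hankel \<nu> f \<tau> + hankel \<nu> g \<tau>"
      using that by (intro hankel_add hankel_classD(3) f g)
    ultimately show ?thesis using tendsto_add[OF p2 q2] that by simp
  qed
  moreover have "integrable ?L (\<lambda>x. (f x + g x)\<^sup>2)"
    by (intro integrable_square_add hankel_classD(2) f g; measurable)
  moreover have "integrable ?L (\<lambda>x. (f x + g x) * bessel_clifford \<nu> (x * \<tau>))" if "\<tau> > 0" for \<tau>
    using hankel_classD(3)[OF f that] hankel_classD(3)[OF g that] by (simp add: distrib_right)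
  ultimately show ?thesis
    unfolding hankel_class_def by (auto intro!: exI[of _ "\<lambda>n. p n + q n"])
qed

text \<open>Polarisation: the isometry for f, g and f + g determines the integral of the
  product.\<close>

lemma hankel_Parseval:
  assumes nu: "\<nu> > -1" and f: "f \<in> hankel_class \<nu>" and g: "g \<in> hankel_class \<nu>"
  shows "has_bochner_integral (powr_measure \<nu>) (\<lambda>\<tau>. hankel \<nu> f \<tau> * hankel \<nu> g \<tau>)
           (\<integral>x. f x * g x \<partial>powr_measure \<nu>)"
proof -
  let ?L = "powr_measure \<nu>"
  note [measurable] = hankel_classD(1)[OF f] hankel_classD(1)[OF g]
  note iso = hankel_isometry[OF nu f] hankel_isometry[OF nu g]
    hankel_isometry[OF nu hankel_class_add[OF nu f g]]
  have "AE \<tau> in ?L. (hankel \<nu> (\<lambda>x. f x + g x) \<tau>)\<^sup>2 = (hankel \<nu> f \<tau> + hankel \<nu> g \<tau>)\<^sup>2"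
    using AE_powr_measure_pos[of \<nu>]
  proof eventually_elim
    case (elim \<tau>)
    then have "hankel \<nu> (\<lambda>x. f x + g x) \<tau> = hankel \<nu> f \<tau> + hankel \<nu> g \<tau>"
      by (intro hankel_add hankel_classD(3) f g)
    then show ?case by simp
  qed
  then have "(\<integral>\<tau>. (hankel \<nu> (\<lambda>x. f x + g x) \<tau>)\<^sup>2 \<partial>?L) = (\<integral>\<tau>. (hankel \<nu> f \<tau> + hankel \<nu> g \<tau>)\<^sup>2 \<partial>?L)"
    by (intro integral_cong_AE) measurable
  also have "\<dots> = (\<integral>\<tau>. (hankel \<nu> f \<tau>)\<^sup>2 \<partial>?L) + (\<integral>\<tau>. (hankel \<nu> g \<tau>)\<^sup>2 \<partial>?L) +
      2 * (\<integral>\<tau>. hankel \<nu> f \<tau> * hankel \<nu> g \<tau> \<partial>?L)"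
    by (intro integrable_square_add(2) iso; measurable)
  finally have "(\<integral>\<tau>. hankel \<nu> f \<tau> * hankel \<nu> g \<tau> \<partial>?L) = (\<integral>x. f x * g x \<partial>?L)"
    using integrable_square_add(2)[of f ?L g] hankel_classD(2)[OF f] hankel_classD(2)[OF g] iso by simp
  moreover have "integrable ?L (\<lambda>\<tau>. hankel \<nu> f \<tau> * hankel \<nu> g \<tau>)"
    by (rule L2_Cauchy_Schwarz) (use iso in auto)
  ultimately show ?thesis by (simp add: has_bochner_integral_iff)
qed

text \<open>The substitution \<open>s = exp (- x)\<close> turns this into polynomial approximation on \<open>[0, 1]\<close> of
  \<open>h(- ln s) / s\<close>, which vanishes for \<open>s\<close> near \<open>0\<close>.\<close>

lemma expoly_approximation:
  assumes h: "continuous_on {0..} h" and h0: "\<And>x. x \<ge> Y \<Longrightarrow> h x = 0" and Y: "Y \<ge> 0" and e: "e > 0"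
  obtains p where "\<And>x. x \<ge> 0 \<Longrightarrow> \<bar>h x - expoly p x\<bar> \<le> e * exp (- x)"
proof -
  define s0 where "s0 = exp (- Y)"
  \<comment> \<open>Clamping \<open>s\<close> at \<open>s0 = exp (- Y)\<close> avoids the
    singularity at 0. Below \<open>s0\<close> it yields the value \<open>h Y = 0\<close>, which is
    the right one there.\<close>
  define k where "k s = h (- ln (max s s0)) / max s s0" for s
  have s0: "s0 > 0" "s0 \<le> 1" using Y by (auto simp: s0_def)
  have pos: "max s s0 > 0" for s using s0 by (auto simp: max_def)
  have "continuous_on {0..1} (\<lambda>s. h (- ln (max s s0)))"
  proof (rule continuous_on_compose2[OF h])
    show "continuous_on {0..1} (\<lambda>s. - ln (max s s0))"
      using pos by (intro continuous_intros) (auto simp: less_le)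
    show "(\<lambda>s. - ln (max s s0)) ` {0..1} \<subseteq> {0..}"
      using s0 pos by (auto simp: max_def)
  qed
  then have "continuous_on {0..1} k"
    unfolding k_def[abs_def] using pos by (intro continuous_intros) (auto simp: less_le)
  then obtain g where g: "real_polynomial_function g" "\<And>s. s \<in> {0..1} \<Longrightarrow> \<bar>k s - g s\<bar> < e"
    using Stone_Weierstrass_real_polynomial_function[OF compact_Icc _ e] by blast
  obtain a n where an: "g = (\<lambda>x. \<Sum>i\<le>n. a i * x ^ i)"
    using g(1) unfolding real_polynomial_function_iff_sum by blast
  define p where "p = (\<Sum>i\<le>n. Polynomial.monom (a i) i)"
  have gp: "g s = poly p s" for s
    by (simp add: an p_def poly_sum poly_monom)
  show thesis
  proof (rule that[of p])
    fix x :: real assume x: "x \<ge> 0"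
    have "h x = exp (- x) * k (exp (- x))"
    proof (cases "x \<le> Y")
      case True
      then have "max (exp (- x)) s0 = exp (- x)" by (simp add: s0_def)
      then show ?thesis by (simp add: k_def)
    next
      case False
      then have "max (exp (- x)) s0 = s0" by (simp add: s0_def)
      then show ?thesis using h0[of x] h0[of Y] False by (simp add: k_def s0_def)
    qed
    then have "\<bar>h x - expoly p x\<bar> = exp (- x) * \<bar>k (exp (- x)) - g (exp (- x))\<bar>"
      by (simp add: expoly_def gp abs_mult right_diff_distrib[symmetric])
    also have "\<dots> \<le> exp (- x) * e"
      using g(2)[of "exp (- x)"] x by (intro mult_left_mono less_imp_le) auto
    finally show "\<bar>h x - expoly p x\<bar> \<le> e * exp (- x)" by (simp add: mult.commute)
  qed
qed

text \<open>On the bounded support the kernel is bounded, and \<open>f\<close> is dominated by its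
  square plus 1; there 1 is at most \<open>exp Y * exp (- x)\<close>, which the weight
  integrates.\<close>

lemma integrable_mult_clifford:
  assumes nu: "\<nu> > -1" and [measurable]: "f \<in> borel_measurable borel" and f2: "integrable (powr_measure \<nu>) (\<lambda>x. (f x)\<^sup>2)"
    and supp: "\<And>x. x \<ge> Y \<Longrightarrow> f x = 0"
  shows "integrable (powr_measure \<nu>) (\<lambda>x. f x * bessel_clifford \<nu> (x * \<tau>))"
proof -
  have "compact ((\<lambda>x. bessel_clifford \<nu> (x * \<tau>)) ` {0..Y})"
    by (intro compact_continuous_image continuous_intros nu) auto
  then obtain B where B: "\<And>x. x \<in> {0..Y} \<Longrightarrow> \<bar>bessel_clifford \<nu> (x * \<tau>)\<bar> \<le> B"
    unfolding compact_eq_bounded_closed bounded_iff by (metis atLeastAtMost_iff image_eqI real_norm_def)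
  have E: "integrable (powr_measure \<nu>) (\<lambda>x. exp (- x))"
    using exp_integral_powr_measure[OF nu, of 1] by (simp add: has_bochner_integral_iff)
  show ?thesis
  proof (rule Bochner_Integration.integrable_bound)
    show "integrable (powr_measure \<nu>) (\<lambda>x. B * ((f x)\<^sup>2 + exp Y * exp (- x)))"
      using E f2 by simp
    show "AE x in powr_measure \<nu>. norm (f x * bessel_clifford \<nu> (x * \<tau>)) \<le> norm (B * ((f x)\<^sup>2 + exp Y * exp (- x)))"
      using AE_powr_measure_pos[of \<nu>]
    proof eventually_elim
      case (elim x)
      show ?case
      proof (cases "x < Y")
        case True
        then have b: "\<bar>bessel_clifford \<nu> (x * \<tau>)\<bar> \<le> B" using B elim by auto
        have "\<bar>f x\<bar> \<le> (f x)\<^sup>2 + 1"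
          using sum_squares_bound[of "\<bar>f x\<bar>" 1] by simp
        also have "1 \<le> exp Y * exp (- x)" using True by (simp flip: exp_add)
        finally have "\<bar>f x\<bar> \<le> (f x)\<^sup>2 + exp Y * exp (- x)" by simp
        then have "\<bar>f x\<bar> * \<bar>bessel_clifford \<nu> (x * \<tau>)\<bar> \<le> ((f x)\<^sup>2 + exp Y * exp (- x)) * B"
          using b by (intro mult_mono) auto
        also have "\<dots> \<le> \<bar>B * ((f x)\<^sup>2 + exp Y * exp (- x))\<bar>" by (simp add: mult.commute)
        finally show ?thesis by (simp add: abs_mult)
      qed (use supp in simp)
    qed
  qed measurable
qed

text \<open>Since \<open>f\<close> may blow up at \<open>Y\<close>, it is first multiplied by a ramp
  \<open>r n\<close> that equals 1 up to \<open>Y - 2 * d n\<close> and 0 from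
  \<open>Y - d n\<close> on. The error of the ramp tends to 0 by dominated convergence. The
  remaining continuous function is approximated within \<open>exp (- x) / (n + 1)\<close>, an error
  that is small both in the mean square and against the kernel, whatever the growth of the
  latter.\<close>

lemma hankel_class_cutoff:
  assumes nu: "\<nu> > -1" and Y: "Y > 0" and k: "continuous_on {0..<Y} k"
    and [measurable]: "f \<in> borel_measurable borel"
    and f: "\<And>x. 0 \<le> x \<Longrightarrow> x < Y \<Longrightarrow> f x = k x" and supp: "\<And>x. x \<ge> Y \<Longrightarrow> f x = 0"
    and f2: "integrable (powr_measure \<nu>) (\<lambda>x. (f x)\<^sup>2)"
  shows "f \<in> hankel_class \<nu>"
proof -
  let ?L = "powr_measure \<nu>"
  define d where "d n = Y / 2 * inverse (real (Suc n))" for n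
  define r where "r n x = max 0 (min 1 ((Y - d n - x) / d n))" for n x
  \<comment> \<open>The minimum keeps the argument of \<open>k\<close> inside [0, Y), where
    \<open>k\<close> is continuous; beyond \<open>Y - d n\<close> the ramp vanishes anyway.\<close>
  define h where "h n x = k (min x (Y - d n)) * r n x" for n x
  have d: "d n > 0" "d n < Y" for n
  proof -
    have "0 < inverse (real (Suc n))" "inverse (real (Suc n)) \<le> 1" by (auto simp: field_simps)
    then have "Y / 2 * inverse (real (Suc n)) \<le> Y / 2 * 1" "0 < Y / 2 * inverse (real (Suc n))"
      using Y by (auto intro!: mult_left_mono mult_pos_pos simp del: of_nat_Suc)
    then show "d n > 0" "d n < Y" using Y unfolding d_def by linarith+
  qed
  have d_lim: "d \<longlonglongrightarrow> 0"
    unfolding d_def using tendsto_mult_left[OF LIMSEQ_inverse_real_of_nat, of "Y / 2"] by simp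
  have r01: "0 \<le> r n x" "r n x \<le> 1" for n x by (auto simp: r_def)
  have r0: "r n x = 0" if "x \<ge> Y - d n" for n x
  proof -
    have "(Y - d n - x) / d n \<le> 0" using that d[of n] by (intro divide_nonpos_pos) auto
    then show ?thesis by (simp add: r_def)
  qed
  have h_eq: "h n x = f x * r n x" if "x \<ge> 0" for n x
  proof (cases "x < Y - d n")
    case True
    then show ?thesis using f[of x] that d[of n] by (simp add: h_def)
  qed (simp add: h_def r0)
  have h_cont: "continuous_on {0..} (h n)" for n
    unfolding h_def[abs_def] r_def
    by (intro continuous_intros continuous_on_compose2[OF k]) (use d[of n] in \<open>auto simp: min_def\<close>)
  have "\<exists>p. \<forall>x\<ge>0. \<bar>h n x - expoly p x\<bar> \<le> inverse (real (Suc n)) * exp (- x)" for n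
    by (rule expoly_approximation[OF h_cont[of n], of Y "inverse (real (Suc n))"])
       (use Y d[of n] in \<open>auto simp: h_def r0\<close>)
  then obtain p where p: "\<And>n x. x \<ge> 0 \<Longrightarrow> \<bar>h n x - expoly (p n) x\<bar> \<le> inverse (real (Suc n)) * exp (- x)"
    by metis
  have r_lim: "(\<lambda>n. f x * r n x) \<longlonglongrightarrow> f x" for x
  proof (cases "x < Y")
    case True
    have "(\<lambda>n. Y - x - 2 * d n) \<longlonglongrightarrow> Y - x - 2 * 0"
      by (intro tendsto_intros d_lim)
    then have "eventually (\<lambda>n. Y - x - 2 * d n > 0) sequentially"
      using True by (intro order_tendstoD(1)[of _ "Y - x"]) auto
    then have "eventually (\<lambda>n. f x * r n x = f x) sequentially"
    proof eventually_elim
      case (elim n)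
      then have "(Y - d n - x) / d n \<ge> 1" using d[of n] by (simp add: field_simps)
      then show ?case by (simp add: r_def)
    qed
    then show ?thesis by (rule tendsto_eventually)
  qed (simp add: supp)
  have r_meas [measurable]: "r n \<in> borel_measurable borel" for n
    unfolding r_def[abs_def] by measurable
  have sq_le: "(f x * r n x - f x)\<^sup>2 \<le> (f x)\<^sup>2" for n x
  proof -
    have "(f x * r n x - f x)\<^sup>2 = (f x)\<^sup>2 * (1 - r n x)\<^sup>2"
      by (simp add: power2_eq_square algebra_simps)
    also have "\<dots> \<le> (f x)\<^sup>2 * 1\<^sup>2"
      using r01[of n x] by (intro mult_left_mono power_mono) auto
    finally show ?thesis by simp
  qed
  have sq_int: "integrable ?L (\<lambda>x. (f x * r n x - f x)\<^sup>2)" for n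
    by (rule Bochner_Integration.integrable_bound[OF f2]) (use sq_le in \<open>auto intro!: AE_I2\<close>)
  have sq_lim: "(\<lambda>n. \<integral>x. (f x * r n x - f x)\<^sup>2 \<partial>?L) \<longlonglongrightarrow> 0"
  proof -
    have "(\<lambda>n. \<integral>x. (f x * r n x - f x)\<^sup>2 \<partial>?L) \<longlonglongrightarrow> (\<integral>x. 0 \<partial>?L)"
    proof (rule integral_dominated_convergence[OF _ _ f2])
      show "AE x in ?L. (\<lambda>n. (f x * r n x - f x)\<^sup>2) \<longlonglongrightarrow> 0"
      proof (rule AE_I2)
        fix x
        have "(\<lambda>n. (f x * r n x - f x)\<^sup>2) \<longlonglongrightarrow> (f x - f x)\<^sup>2"
          by (intro tendsto_intros r_lim)
        then show "(\<lambda>n. (f x * r n x - f x)\<^sup>2) \<longlonglongrightarrow> 0" by simp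
      qed
    qed (use sq_le in auto)
    then show ?thesis by simp
  qed
  have E: "integrable ?L (\<lambda>x. exp (- 2 * x))"
    using exp_integral_powr_measure[OF nu, of 2] by (simp add: has_bochner_integral_iff)
  have L2: "(\<lambda>n. \<integral>x. (expoly (p n) x - f x)\<^sup>2 \<partial>?L) \<longlonglongrightarrow> 0"
  proof (rule Lim_null_comparison, intro always_eventually allI)
    fix n
    let ?c = "inverse (real (Suc n))"
    have "(\<integral>x. (expoly (p n) x - f x)\<^sup>2 \<partial>?L) \<le> (\<integral>x. 2 * (?c\<^sup>2 * exp (- 2 * x)) + 2 * (f x * r n x - f x)\<^sup>2 \<partial>?L)"
    proof (rule integral_mono_AE)
      show "integrable ?L (\<lambda>x. (expoly (p n) x - f x)\<^sup>2)"
        by (intro integrable_square_diff integrable_expoly_square nu f2; measurable)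
      show "integrable ?L (\<lambda>x. 2 * (?c\<^sup>2 * exp (- 2 * x)) + 2 * (f x * r n x - f x)\<^sup>2)"
        using E sq_int by simp
      show "AE x in ?L. (expoly (p n) x - f x)\<^sup>2 \<le> 2 * (?c\<^sup>2 * exp (- 2 * x)) + 2 * (f x * r n x - f x)\<^sup>2"
        using AE_powr_measure_pos[of \<nu>]
      proof eventually_elim
        case (elim x)
        \<comment> \<open>\<open>?a\<close> is the error of the Weierstrass approximation and
          \<open>?b\<close> that of the ramp.\<close>
        let ?a = "expoly (p n) x - h n x" and ?b = "f x * r n x - f x"
        have "\<bar>?a\<bar> \<le> ?c * exp (- x)" using p[of x n] elim by (simp add: abs_minus_commute)
        then have "?a\<^sup>2 \<le> (?c * exp (- x))\<^sup>2"
          by (rule abs_le_square_iff[THEN iffD1, OF order_trans]) simp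
        also have "\<dots> = ?c\<^sup>2 * exp (- 2 * x)"
          by (simp add: power_mult_distrib exp_double[symmetric] power2_eq_square flip: exp_add)
        finally have a: "?a\<^sup>2 \<le> ?c\<^sup>2 * exp (- 2 * x)" .
        have "(expoly (p n) x - f x)\<^sup>2 = (?a + ?b)\<^sup>2" using h_eq[of x n] elim by simp
        also have "\<dots> \<le> 2 * ?a\<^sup>2 + 2 * ?b\<^sup>2"
          using sum_squares_bound[of ?a ?b] by (simp add: power2_sum)
        finally show ?case using a by linarith
      qed
    qed
    also have "\<dots> = 2 * (?c\<^sup>2 * (\<integral>x. exp (- 2 * x) \<partial>?L)) + 2 * (\<integral>x. (f x * r n x - f x)\<^sup>2 \<partial>?L)"
      using E sq_int by simp
    finally show "norm (\<integral>x. (expoly (p n) x - f x)\<^sup>2 \<partial>?L) \<le>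
        2 * (?c\<^sup>2 * (\<integral>x. exp (- 2 * x) \<partial>?L)) + 2 * (\<integral>x. (f x * r n x - f x)\<^sup>2 \<partial>?L)"
      by simp
  next
    have "(\<lambda>n. (inverse (real (Suc n)))\<^sup>2) \<longlonglongrightarrow> 0"
      using tendsto_power[OF LIMSEQ_inverse_real_of_nat, of 2] by simp
    from tendsto_add[OF tendsto_mult_left[OF tendsto_mult_right[OF this], of 2] tendsto_mult_left[OF sq_lim, of 2]]
    show "(\<lambda>n. 2 * ((inverse (real (Suc n)))\<^sup>2 * (\<integral>x. exp (- 2 * x) \<partial>?L)) + 2 * (\<integral>x. (f x * r n x - f x)\<^sup>2 \<partial>?L)) \<longlonglongrightarrow> 0"
      by simp
  qed
  have fC: "integrable ?L (\<lambda>x. f x * bessel_clifford \<nu> (x * \<tau>))" for \<tau>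
    by (rule integrable_mult_clifford[OF nu _ f2 supp]) auto
  have lim: "(\<lambda>n. hankel \<nu> (expoly (p n)) \<tau>) \<longlonglongrightarrow> hankel \<nu> f \<tau>" if "\<tau> > 0" for \<tau>
  proof -
    let ?C = "\<lambda>x. bessel_clifford \<nu> (x * \<tau>)"
    have EC: "integrable ?L (\<lambda>x. exp (- x) * ?C x)"
      using hankel_exp[OF nu, of 1 \<tau>] that by (simp add: has_bochner_integral_iff)
    have fr: "integrable ?L (\<lambda>x. (f x * r n x) * ?C x)" for n
    proof (rule Bochner_Integration.integrable_bound[OF fC[of \<tau>]])
      show "AE x in ?L. norm (f x * r n x * ?C x) \<le> norm (f x * ?C x)"
        using r01[of n] by (intro AE_I2) (auto simp: abs_mult intro!: mult_right_mono mult_left_le)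
    qed measurable
    have 1: "(\<lambda>n. \<integral>x. (f x * r n x) * ?C x \<partial>?L) \<longlonglongrightarrow> (\<integral>x. f x * ?C x \<partial>?L)"
    proof (rule integral_dominated_convergence)
      show "integrable ?L (\<lambda>x. norm (f x * ?C x))" using fC by (rule integrable_norm)
      show "AE x in ?L. (\<lambda>n. f x * r n x * ?C x) \<longlonglongrightarrow> f x * ?C x"
        by (intro AE_I2 tendsto_intros r_lim)
      show "AE x in ?L. norm (f x * r n x * ?C x) \<le> norm (f x * ?C x)" for n
        using r01[of n] by (intro AE_I2) (auto simp: abs_mult intro!: mult_right_mono mult_left_le)
    qed measurable
    have 2: "(\<lambda>n. hankel \<nu> (expoly (p n)) \<tau> - (\<integral>x. (f x * r n x) * ?C x \<partial>?L)) \<longlonglongrightarrow> 0"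
    proof (rule Lim_null_comparison, intro always_eventually allI)
      fix n
      have "hankel \<nu> (expoly (p n)) \<tau> - (\<integral>x. (f x * r n x) * ?C x \<partial>?L) =
        (\<integral>x. (expoly (p n) x - f x * r n x) * ?C x \<partial>?L)"
        unfolding hankel_def using fr integrable_expoly_clifford[OF nu that, of "p n"]
        by (simp add: left_diff_distrib)
      also have "norm \<dots> \<le> (\<integral>x. norm ((expoly (p n) x - f x * r n x) * ?C x) \<partial>?L)"
        by (rule integral_norm_bound)
      also have "\<dots> \<le> (\<integral>x. inverse (real (Suc n)) * norm (exp (- x) * ?C x) \<partial>?L)"
      proof (rule integral_mono_AE)
        show "integrable ?L (\<lambda>x. norm ((expoly (p n) x - f x * r n x) * ?C x))"
          unfolding left_diff_distrib
          by (intro integrable_norm Bochner_Integration.integrable_diff fr integrable_expoly_clifford nu that)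
        show "integrable ?L (\<lambda>x. inverse (real (Suc n)) * norm (exp (- x) * ?C x))"
          by (intro integrable_mult_right integrable_norm EC)
        show "AE x in ?L. norm ((expoly (p n) x - f x * r n x) * ?C x) \<le> inverse (real (Suc n)) * norm (exp (- x) * ?C x)"
          using AE_powr_measure_pos[of \<nu>]
        proof eventually_elim
          case (elim x)
          have "\<bar>expoly (p n) x - f x * r n x\<bar> \<le> inverse (real (Suc n)) * exp (- x)"
            using p[of x n] h_eq[of x n] elim by (simp add: abs_minus_commute)
          from mult_right_mono[OF this, of "\<bar>?C x\<bar>"] show ?case
            by (simp add: abs_mult)
        qed
      qed
      also have "\<dots> = inverse (real (Suc n)) * (\<integral>x. norm (exp (- x) * ?C x) \<partial>?L)" by simp
      finally show "norm (hankel \<nu> (expoly (p n)) \<tau> - (\<integral>x. (f x * r n x) * ?C x \<partial>?L)) \<le>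
          inverse (real (Suc n)) * (\<integral>x. norm (exp (- x) * ?C x) \<partial>?L)" .
    next
      from tendsto_mult_left_zero[OF LIMSEQ_inverse_real_of_nat]
      show "(\<lambda>n. inverse (real (Suc n)) * (\<integral>x. norm (exp (- x) * ?C x) \<partial>?L)) \<longlonglongrightarrow> 0" .
    qed
    from tendsto_add[OF 1 2] show ?thesis by (simp add: hankel_def)
  qed
  show ?thesis
    unfolding hankel_class_def using f2 fC L2 lim by auto
qed

section \<open>Sonine's integral and elementary Bessel functions\<close>

text \<open>Up to the factor 1 / Gamma(b) the kernel of fractional integration of order b, and b is
  the amount by which it raises the order of a Bessel-Clifford function.\<close>

definition power_cutoff :: "real \<Rightarrow> real \<Rightarrow> real \<Rightarrow> real" where
  "power_cutoff b Y x = (if x < Y then (Y - x) powr (b - 1) else 0)"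

lemma borel_measurable_power_cutoff [measurable]: "power_cutoff b Y \<in> borel_measurable borel"
  unfolding power_cutoff_def[abs_def] by measurable

text \<open>Euler's Beta integral stretched to [0, Y]. The value is arranged so that the quotient of
  Gammas is the one that turns \<open>clifford_coeff \<nu> k\<close> into
  \<open>clifford_coeff (\<nu> + b) k\<close>.\<close>

lemma power_cutoff_moment:
  assumes nu: "\<nu> > -1" and b: "b > 0" and Y: "Y > 0"
  shows "has_bochner_integral (powr_measure \<nu>) (\<lambda>x. power_cutoff b Y x * x ^ k)
    (Gamma b * Y powr (\<nu> + b) * (Gamma (real k + \<nu> + 1) / Gamma (real k + \<nu> + b + 1) * Y ^ k))"
proof (rule has_bochner_integral_powr_measureI)
  define a where "a = real k + \<nu> + 1"
  have a: "a > 0" using nu by (simp add: a_def)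
  have "((\<lambda>t. (1 / Y * t) powr (a - 1) * (1 - 1 / Y * t) powr (b - 1)) has_integral
      (1 / \<bar>1 / Y\<bar>) *\<^sub>R Beta a b) ((\<lambda>x. x / (1 / Y)) ` {0..1})"
    using Y by (intro has_integral_stretch_real has_integral_Beta_real a b) auto
  also have "(\<lambda>x. x / (1 / Y)) ` {0..1} = {0..Y}"
    using Y by (auto simp: image_iff intro!: bexI[of _ "x / Y" for x])
  finally have "((\<lambda>t. (1 / Y * t) powr (a - 1) * (1 - 1 / Y * t) powr (b - 1)) has_integral Y * Beta a b) {0..Y}"
    using Y by simp
  from has_integral_mult_right[OF this, of "Y powr (a - 1) * Y powr (b - 1)"]
  have "((\<lambda>t. Y powr (a - 1) * Y powr (b - 1) * ((1 / Y * t) powr (a - 1) * (1 - 1 / Y * t) powr (b - 1)))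
    has_integral Y powr (a - 1) * Y powr (b - 1) * (Y * Beta a b)) {0..Y}" .
  then have "((\<lambda>t. t powr (a - 1) * power_cutoff b Y t)
    has_integral Y powr (a - 1) * Y powr (b - 1) * (Y * Beta a b)) {0..Y}"
  proof (rule has_integral_eq[rotated])
    fix t assume t: "t \<in> {0..Y}"
    have 1: "Y powr (a - 1) * (1 / Y * t) powr (a - 1) = t powr (a - 1)"
      using Y t by (subst powr_mult[symmetric]) auto
    have 2: "Y powr (b - 1) * (1 - 1 / Y * t) powr (b - 1) = (Y - t) powr (b - 1)"
    proof -
      have "Y * (1 - 1 / Y * t) = Y - t" using Y by (simp add: right_diff_distrib)
      then show ?thesis using powr_mult[of Y "1 - 1 / Y * t" "b - 1"] Y t by simp
    qed
    \<comment> \<open>At \<open>t = Y\<close> both sides are 0, since a power of base 0 is 0 by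
      convention.\<close>
    have 3: "(Y - t) powr (b - 1) = power_cutoff b Y t"
      using t by (auto simp: power_cutoff_def)
    show "Y powr (a - 1) * Y powr (b - 1) * ((1 / Y * t) powr (a - 1) * (1 - 1 / Y * t) powr (b - 1)) =
       t powr (a - 1) * power_cutoff b Y t"
      unfolding 3[symmetric] 1[symmetric] 2[symmetric] by (simp only: mult_ac)
  qed
  then have "((\<lambda>t. t powr (a - 1) * power_cutoff b Y t)
    has_integral Y powr (a - 1) * Y powr (b - 1) * (Y * Beta a b)) {0<..}"
  proof (subst has_integral_spike_set_eq[of "{0<..}" "{0..Y}"])
    have "{x \<in> {0<..} - {0..Y}. x powr (a - 1) * power_cutoff b Y x \<noteq> 0} = {}"
      by (auto simp: power_cutoff_def)
    then show "negligible {x \<in> {0<..} - {0..Y}. x powr (a - 1) * power_cutoff b Y x \<noteq> 0}"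
      by (simp only: negligible_empty)
    have "{x \<in> {0..Y} - {0<..}. x powr (a - 1) * power_cutoff b Y x \<noteq> 0} \<subseteq> {0}" by auto
    then show "negligible {x \<in> {0..Y} - {0<..}. x powr (a - 1) * power_cutoff b Y x \<noteq> 0}"
      by (rule negligible_subset[OF negligible_sing])
  qed
  then have "((\<lambda>x. x powr \<nu> * (power_cutoff b Y x * x ^ k))
    has_integral Y powr (a - 1) * Y powr (b - 1) * (Y * Beta a b)) {0<..}"
    by (rule has_integral_eq[rotated])
       (auto simp: a_def powr_add powr_realpow mult_ac)
  also have "Y powr (a - 1) * Y powr (b - 1) * (Y * Beta a b) =
     Gamma b * Y powr (\<nu> + b) * (Gamma (real k + \<nu> + 1) / Gamma (real k + \<nu> + b + 1) * Y ^ k)"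
  proof -
    have 1: "Y powr (a - 1) * Y powr (b - 1) * Y = Y powr (\<nu> + b) * Y ^ k"
      using Y by (simp add: a_def powr_add powr_diff powr_realpow)
    have 2: "Beta a b = Gamma (real k + \<nu> + 1) * Gamma b / Gamma (real k + \<nu> + b + 1)"
      by (simp add: Beta_def a_def algebra_simps)
    have "Y powr (a - 1) * Y powr (b - 1) * (Y * Beta a b) = Y powr (\<nu> + b) * Y ^ k * Beta a b"
      by (simp only: mult.assoc[symmetric] 1)
    then show ?thesis unfolding 2 by simp
  qed
  finally show "((\<lambda>x. x powr \<nu> * (power_cutoff b Y x * x ^ k)) has_integral
     Gamma b * Y powr (\<nu> + b) * (Gamma (real k + \<nu> + 1) / Gamma (real k + \<nu> + b + 1) * Y ^ k)) {0<..}" .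
qed (auto simp: power_cutoff_def)

text \<open>Squaring a cut-off power of parameter b gives the one of parameter 2 b - 1, which has
  finite moments because b > 1/2.\<close>

lemma power_cutoff_hankel_class:
  assumes nu: "\<nu> > -1" and b: "b > 1/2" and Y: "Y > 0"
  shows "power_cutoff b Y \<in> hankel_class \<nu>"
proof (rule hankel_class_cutoff[OF nu Y, where k = "\<lambda>x. (Y - x) powr (b - 1)"])
  show "continuous_on {0..<Y} (\<lambda>x. (Y - x) powr (b - 1))"
    by (intro continuous_intros) auto
  have eq: "(power_cutoff b Y x)\<^sup>2 = power_cutoff (2 * b - 1) Y x" for x
    by (auto simp: power_cutoff_def power2_eq_square powr_add[symmetric])
  show "integrable (powr_measure \<nu>) (\<lambda>x. (power_cutoff b Y x)\<^sup>2)"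
    unfolding eq using power_cutoff_moment[OF nu _ Y, of "2 * b - 1" 0] b
    by (simp add: has_bochner_integral_iff)
qed (auto simp: power_cutoff_def)

text \<open>Sonine's first finite integral, obtained by inserting the moments into the series of the
  kernel term by term.\<close>

lemma hankel_power_cutoff:
  assumes nu: "\<nu> > -1" and b: "b > 0" and Y: "Y > 0" and tau: "\<tau> \<ge> 0"
  shows "hankel \<nu> (power_cutoff b Y) \<tau> = Gamma b * Y powr (\<nu> + b) * bessel_clifford (\<nu> + b) (Y * \<tau>)"
proof -
  let ?L = "powr_measure \<nu>"
  define K where "K = Gamma b * Y powr (\<nu> + b)"
  define f where "f k x = clifford_coeff \<nu> k * \<tau> ^ k * (power_cutoff b Y x * x ^ k)" for k x
  have nn: "power_cutoff b Y x \<ge> 0" for x by (auto simp: power_cutoff_def)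
  have m: "Gamma (real k + \<nu> + 1) > 0" for k
    using nu by (intro Gamma_real_pos) auto
  have I: "has_bochner_integral ?L (f k) (K * (clifford_coeff (\<nu> + b) k * (Y * \<tau>) ^ k))" for k
  proof -
    have "has_bochner_integral ?L (f k) (clifford_coeff \<nu> k * \<tau> ^ k *
      (Gamma b * Y powr (\<nu> + b) * (Gamma (real k + \<nu> + 1) / Gamma (real k + \<nu> + b + 1) * Y ^ k)))"
      unfolding f_def[abs_def] by (intro has_bochner_integral_mult_right power_cutoff_moment nu b Y)
    moreover have "clifford_coeff \<nu> k * Gamma (real k + \<nu> + 1) / Gamma (real k + \<nu> + b + 1) =
        clifford_coeff (\<nu> + b) k"
      using m[of k] by (simp add: clifford_coeff_def add.assoc)
    then have "clifford_coeff \<nu> k * \<tau> ^ k *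
      (Gamma b * Y powr (\<nu> + b) * (Gamma (real k + \<nu> + 1) / Gamma (real k + \<nu> + b + 1) * Y ^ k)) =
      K * (clifford_coeff (\<nu> + b) k * (Y * \<tau>) ^ k)"
      by (simp add: K_def power_mult_distrib mult_ac flip: times_divide_eq_right)
    ultimately show ?thesis by simp
  qed
  \<comment> \<open>On the positive half-line each term keeps the sign of its coefficient, so the
    integral of its norm is the modulus of its integral. These moduli form the absolutely convergent
    series of order \<nu> + b.\<close>
  have N: "(\<integral>x. norm (f k x) \<partial>?L) = K * norm (clifford_coeff (\<nu> + b) k * (Y * \<tau>) ^ k)" for k
  proof -
    have "has_bochner_integral ?L (\<lambda>x. sgn (clifford_coeff \<nu> k) * f k x)
       (sgn (clifford_coeff \<nu> k) * (K * (clifford_coeff (\<nu> + b) k * (Y * \<tau>) ^ k)))"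
      by (intro has_bochner_integral_mult_right I)
    moreover have "AE x in ?L. sgn (clifford_coeff \<nu> k) * f k x = norm (f k x)"
      using AE_powr_measure_pos[of \<nu>]
    proof eventually_elim
      case (elim x)
      then have "norm (f k x) = \<bar>clifford_coeff \<nu> k\<bar> * \<tau> ^ k * (power_cutoff b Y x * x ^ k)"
        using nn[of x] tau by (simp add: f_def abs_mult)
      moreover have "sgn (clifford_coeff \<nu> k) * f k x =
          (sgn (clifford_coeff \<nu> k) * clifford_coeff \<nu> k) * \<tau> ^ k * (power_cutoff b Y x * x ^ k)"
        by (simp only: f_def mult.assoc)
      moreover have "sgn (clifford_coeff \<nu> k) * clifford_coeff \<nu> k = \<bar>clifford_coeff \<nu> k\<bar>"
        by (simp add: abs_sgn mult.commute)
      ultimately show ?case by simp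
    qed
    ultimately have "has_bochner_integral ?L (\<lambda>x. norm (f k x))
       (sgn (clifford_coeff \<nu> k) * (K * (clifford_coeff (\<nu> + b) k * (Y * \<tau>) ^ k)))"
      by (subst (asm) has_bochner_integral_cong_AE[where g = "\<lambda>x. norm (f k x)"])
         (auto simp: f_def[abs_def])
    moreover have "sgn (clifford_coeff \<nu> k) * (K * (clifford_coeff (\<nu> + b) k * (Y * \<tau>) ^ k)) =
        K * norm (clifford_coeff (\<nu> + b) k * (Y * \<tau>) ^ k)"
    proof -
      have "sgn (clifford_coeff \<nu> k) = (-1) ^ k" "sgn (clifford_coeff (\<nu> + b) k) = (-1) ^ k"
        using m[of k] Gamma_real_pos[of "real k + (\<nu> + b) + 1"] nu b
        by (auto simp: clifford_coeff_def sgn_mult sgn_divide sgn_power_injE)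
      then have "sgn (clifford_coeff \<nu> k) * clifford_coeff (\<nu> + b) k = \<bar>clifford_coeff (\<nu> + b) k\<bar>"
        by (simp add: abs_sgn mult.commute)
      moreover have "(Y * \<tau>) ^ k \<ge> 0" using Y tau by simp
      ultimately show ?thesis by (simp add: abs_mult)
    qed
    ultimately show ?thesis by (simp add: has_bochner_integral_iff)
  qed
  have ptw: "(\<lambda>k. f k x) sums (power_cutoff b Y x * bessel_clifford \<nu> (x * \<tau>))" for x
    using sums_mult[OF sums_clifford[OF nu], of "power_cutoff b Y x" "x * \<tau>"]
    by (simp add: f_def power_mult_distrib mult_ac)
  have ptw_abs: "summable (\<lambda>k. norm (f k x))" for x
  proof -
    have "norm (f k x) = power_cutoff b Y x * norm (clifford_coeff \<nu> k * (x * \<tau>) ^ k)" for k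
      using nn[of x] by (simp add: f_def power_mult_distrib abs_mult)
    then show ?thesis using summable_mult[OF summable_clifford[OF nu]] by simp
  qed
  have "(\<lambda>k. integral\<^sup>L ?L (f k)) sums (\<integral>x. (\<Sum>k. f k x) \<partial>?L)"
  proof (rule sums_integral)
    show "integrable ?L (f k)" for k using I by (auto simp: has_bochner_integral_iff)
    show "summable (\<lambda>k. \<integral>x. norm (f k x) \<partial>?L)"
      unfolding N using nu b by (intro summable_mult summable_clifford) auto
  qed (use ptw_abs in auto)
  moreover have "(\<Sum>k. f k x) = power_cutoff b Y x * bessel_clifford \<nu> (x * \<tau>)" for x
    using ptw sums_unique by metis
  moreover have "integral\<^sup>L ?L (f k) = K * (clifford_coeff (\<nu> + b) k * (Y * \<tau>) ^ k)" for k
    using I by (auto simp: has_bochner_integral_iff)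
  ultimately have "(\<lambda>k. K * (clifford_coeff (\<nu> + b) k * (Y * \<tau>) ^ k)) sums hankel \<nu> (power_cutoff b Y) \<tau>"
    by (simp add: hankel_def)
  moreover have "(\<lambda>k. K * (clifford_coeff (\<nu> + b) k * (Y * \<tau>) ^ k)) sums (K * bessel_clifford (\<nu> + b) (Y * \<tau>))"
    using nu b by (intro sums_mult sums_clifford) auto
  ultimately show ?thesis unfolding K_def by (rule sums_unique2)
qed

section \<open>Bessel-Clifford functions of half-integer order\<close>

lemma Gamma_half_plus_nat: "Gamma (real k + 1 / 2) = fact (2 * k) * sqrt pi / (4 ^ k * fact k)"
proof (induction k)
  case (Suc k)
  have "Gamma (real k + 1 / 2 + 1) = (real k + 1 / 2) * Gamma (real k + 1 / 2)"
    by (intro Gamma_plus1) (auto elim!: nonpos_Ints_cases)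
  moreover have "(r + 1 / 2) * (F * s / (p * f)) = (2 * r + 2) * (2 * r + 1) * F * s / (4 * p * ((r + 1) * f))"
    if "p > 0" "f > 0" "r \<ge> 0" for r F s p f :: real
    using that by (simp add: divide_simps) (simp add: algebra_simps)
  from this[of "4 ^ k" "fact k" "real k" "fact (2 * k)" "sqrt pi"]
  have "(real k + 1 / 2) * (fact (2 * k) * sqrt pi / (4 ^ k * fact k)) =
      fact (2 * Suc k) * sqrt pi / (4 ^ Suc k * fact (Suc k))"
    by (simp add: algebra_simps)
  ultimately show ?case unfolding Suc.IH by (simp add: algebra_simps)
qed (simp add: Gamma_one_half_real)

lemma bessel_clifford_minus_half: "bessel_clifford (-1/2) (z\<^sup>2 / 4) = cos z / sqrt pi"
proof -
  have "clifford_coeff (-1/2) k * (z\<^sup>2 / 4) ^ k = 1 / sqrt pi * ((-1) ^ k / fact (2 * k) * z ^ (2 * k))" for k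
  proof -
    have "Gamma (real k + - 1 / 2 + 1) = fact (2 * k) * sqrt pi / (4 ^ k * fact k)"
      using Gamma_half_plus_nat[of k] by (simp add: add.commute)
    then show ?thesis unfolding clifford_coeff_def by (simp add: power_divide power_mult)
  qed
  moreover have "(\<lambda>k. 1 / sqrt pi * ((-1) ^ k / fact (2 * k) * z ^ (2 * k))) sums (1 / sqrt pi * cos z)"
    by (intro sums_mult cos_paired)
  moreover have "(\<lambda>k. clifford_coeff (-1/2) k * (z\<^sup>2 / 4) ^ k) sums bessel_clifford (-1/2) (z\<^sup>2 / 4)"
    by (rule sums_clifford) simp
  ultimately show ?thesis using sums_unique2 by fastforce
qed

text \<open>Differentiation raises the order, so this is the derivative of the cosine formula; the
  factor \<open>z\<close> is the inner derivative of \<open>z\<^sup>2 / 4\<close> up to a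
  constant.\<close>

lemma bessel_clifford_half: "z * bessel_clifford (1/2) (z\<^sup>2 / 4) = 2 / sqrt pi * sin z"
proof -
  have 1: "((\<lambda>z. bessel_clifford (-1/2) (z\<^sup>2 / 4)) has_real_derivative
     - bessel_clifford (-1/2 + 1) (z\<^sup>2 / 4) * (2 * z / 4)) (at z)"
    by (rule DERIV_chain2[OF DERIV_bessel_clifford]) (auto intro!: derivative_eq_intros)
  have 2: "((\<lambda>z. bessel_clifford (-1/2) (z\<^sup>2 / 4)) has_real_derivative - sin z / sqrt pi) (at z)"
    unfolding bessel_clifford_minus_half by (intro DERIV_cdivide DERIV_cos)
  have "bessel_clifford (1/2) (z\<^sup>2 / 4) * (2 * z / 4) = sin z / sqrt pi"
    using DERIV_unique[OF 1 2] by simp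
  moreover have "z * B = 2 * (B * (2 * z / 4))" for B by simp
  ultimately show ?thesis by (simp only: times_divide_eq_left times_divide_eq_right)
qed

text \<open>The recurrence at -1/2 expresses the order 3/2 through the two preceding ones.\<close>

lemma bessel_clifford_three_halves:
  "z ^ 3 / 4 * bessel_clifford (3/2) (z\<^sup>2 / 4) = (sin z - z * cos z) / sqrt pi"
proof -
  have "1/2 * bessel_clifford (1/2) (z\<^sup>2 / 4) - z\<^sup>2 / 4 * bessel_clifford (3/2) (z\<^sup>2 / 4) = bessel_clifford (-1/2) (z\<^sup>2 / 4)"
    using bessel_clifford_recurrence[of "-1/2" "z\<^sup>2 / 4"] by simp
  then have "z * (1/2 * bessel_clifford (1/2) (z\<^sup>2 / 4) - z\<^sup>2 / 4 * bessel_clifford (3/2) (z\<^sup>2 / 4)) =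
     z * (cos z / sqrt pi)"
    by (simp only: bessel_clifford_minus_half)
  then have "z ^ 3 / 4 * bessel_clifford (3/2) (z\<^sup>2 / 4) =
      1/2 * (z * bessel_clifford (1/2) (z\<^sup>2 / 4)) - z * cos z / sqrt pi"
    by (simp add: algebra_simps power2_eq_square power3_eq_cube)
  then show ?thesis unfolding bessel_clifford_half by (simp add: field_simps)
qed

section \<open>The spectral measure and the variance measure\<close>

lemma measure_eqI_Ioc:
  fixes M N :: "real measure"
  assumes sets: "sets M = sets borel" "sets N = sets borel"
    and eq: "\<And>a b. emeasure M {a<..b} = emeasure N {a<..b}"
    and fin: "\<And>a b. emeasure M {a<..b} \<noteq> \<infinity>"
  shows "M = N"
proof (rule measure_eqI_generator_eq)
  let ?E = "range (\<lambda>(a, b). {a<..b::real})"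
  show "Int_stable ?E"
    by (auto simp: Int_stable_def Int_greaterThanAtMost intro!: rangeI image_eqI[where x = "(max a c, min b d)" for a b c d])
  show "?E \<subseteq> Pow UNIV" by auto
  show "sets M = sigma_sets UNIV ?E" "sets N = sigma_sets UNIV ?E"
    unfolding sets borel_sigma_sets_Ioc by simp_all
  show "emeasure M X = emeasure N X" if "X \<in> ?E" for X using that eq by auto
  show "range (\<lambda>i. {- real i<..real i}) \<subseteq> ?E" by auto
  show "(\<Union>i. {- real i<..real i}) = UNIV"
  proof (intro set_eqI iffI UNIV_I)
    fix x :: real
    obtain n where "\<bar>x\<bar> < real n" using reals_Archimedean2 by blast
    then show "x \<in> (\<Union>i. {- real i<..real i})" by (auto intro!: exI[of _ n])
  qed
  show "emeasure M {- real i<..real i} \<noteq> \<infinity>" for i by (rule fin)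
qed

lemma emeasure_powr_measure_Ioc:
  assumes nu: "\<nu> > -1" and "a \<le> b"
  shows "emeasure (powr_measure \<nu>) {a<..b} =
    ennreal (max b 0 powr (\<nu> + 1) / (\<nu> + 1) - max a 0 powr (\<nu> + 1) / (\<nu> + 1))"
proof -
  define A B where "A = max a 0" and "B = max b 0"
  have AB: "0 \<le> A" "A \<le> B" using assms(2) by (auto simp: A_def B_def)
  have "((\<lambda>x. x powr \<nu>) has_integral (B powr (\<nu> + 1) / (\<nu> + 1) - A powr (\<nu> + 1) / (\<nu> + 1))) {A..B}"
  \<comment> \<open>Only interior derivatives are available: for \<open>A = 0\<close> and \<nu> < 0
    the primitive is continuous at 0 but not differentiable there.\<close>
  proof (rule fundamental_theorem_of_calculus_interior[OF AB(2)])
    show "continuous_on {A..B} (\<lambda>x. x powr (\<nu> + 1) / (\<nu> + 1))"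
      using AB nu by (intro continuous_on_divide continuous_on_powr' continuous_intros) auto
    show "((\<lambda>x. x powr (\<nu> + 1) / (\<nu> + 1)) has_vector_derivative x powr \<nu>) (at x)" if "x \<in> {A<..<B}" for x
    proof -
      have "((\<lambda>x. x powr (\<nu> + 1) / (\<nu> + 1)) has_real_derivative (\<nu> + 1) * x powr (\<nu> + 1 - 1) / (\<nu> + 1)) (at x)"
        using that AB by (intro DERIV_cdivide has_real_derivative_powr) auto
      then show ?thesis using nu by (simp add: has_real_derivative_iff_has_vector_derivative)
    qed
  qed
  then have "((\<lambda>x. if x \<in> {A..B} then x powr \<nu> else 0) has_integral
      (B powr (\<nu> + 1) / (\<nu> + 1) - A powr (\<nu> + 1) / (\<nu> + 1))) UNIV"
    by (subst has_integral_restrict_UNIV)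
  then have "((\<lambda>x. indicator {0<..} x * x powr \<nu> * indicator {a<..b} x) has_integral
      (B powr (\<nu> + 1) / (\<nu> + 1) - A powr (\<nu> + 1) / (\<nu> + 1))) UNIV"
  proof (rule has_integral_spike[OF negligible_sing[of A], rotated])
    show "indicator {0<..} x * x powr \<nu> * indicator {a<..b} x = (if x \<in> {A..B} then x powr \<nu> else 0)"
      if "x \<in> UNIV - {A}" for x
      using that by (auto simp: A_def B_def max_def indicator_def split: if_splits)
  qed
  then have "(\<integral>\<^sup>+x. ennreal (indicator {0<..} x * x powr \<nu> * indicator {a<..b} x) \<partial>lborel) =
      ennreal (B powr (\<nu> + 1) / (\<nu> + 1) - A powr (\<nu> + 1) / (\<nu> + 1))"
    by (intro nn_integral_has_integral_lborel) auto
  moreover have "emeasure (powr_measure \<nu>) {a<..b} =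
      (\<integral>\<^sup>+x. ennreal (indicator {0<..} x * x powr \<nu> * indicator {a<..b} x) \<partial>lborel)"
    unfolding powr_measure_def
    by (subst emeasure_density) (auto intro!: nn_integral_cong split: split_indicator)
  ultimately show ?thesis by (simp add: A_def B_def)
qed

lemma emeasure_powr_measure_Ioc_finite:
  assumes nu: "\<nu> > -1"
  shows "emeasure (powr_measure \<nu>) {a<..b} \<noteq> \<infinity>"
  by (cases "a \<le> b") (auto simp: emeasure_powr_measure_Ioc[OF nu])

text \<open>The substitution \<tau> = \<lambda>^2, that is \<lambda>^(2\<nu>+1) d\<lambda> =
  \<tau>^\<nu> d\<tau> / 2. At \<nu> = -H the left weight is that of the spectral measure on the
  half-line.\<close>

lemma distr_square_powr_measure:
  assumes nu: "\<nu> > -1"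
  shows "distr (powr_measure (2 * \<nu> + 1)) borel (\<lambda>x. x\<^sup>2) = density (powr_measure \<nu>) (\<lambda>_. ennreal (1 / 2))"
proof (rule sym, rule measure_eqI_Ioc)
  fix a b :: real
  show "emeasure (density (powr_measure \<nu>) (\<lambda>_. ennreal (1 / 2))) {a<..b} \<noteq> \<infinity>"
    using emeasure_powr_measure_Ioc_finite[OF nu, of a b]
    by (simp add: emeasure_density_const ennreal_mult_eq_top_iff)
  show "emeasure (density (powr_measure \<nu>) (\<lambda>_. ennreal (1 / 2))) {a<..b} =
      emeasure (distr (powr_measure (2 * \<nu> + 1)) borel (\<lambda>x. x\<^sup>2)) {a<..b}"
  proof (cases "a \<le> b")
    case True
    define A B where "A = max a 0" and "B = max b 0"
    have AB: "0 \<le> A" "A \<le> B" using True by (auto simp: A_def B_def)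
    have sq: "sqrt z powr (2 * \<nu> + 1 + 1) = z powr (\<nu> + 1)" if "z \<ge> 0" for z
    proof -
      have "1 / 2 * (2 * \<nu> + 1 + 1) = \<nu> + 1" by (simp add: field_simps)
      then show ?thesis by (simp only: powr_half_sqrt[OF that, symmetric] powr_powr)
    qed
    have "emeasure (distr (powr_measure (2 * \<nu> + 1)) borel (\<lambda>x. x\<^sup>2)) {a<..b} =
       emeasure (powr_measure (2 * \<nu> + 1)) ((\<lambda>x. x\<^sup>2) -` {a<..b})"
      by (subst emeasure_distr) auto
    also have "\<dots> = emeasure (powr_measure (2 * \<nu> + 1)) {sqrt A<..sqrt B}"
    proof (rule emeasure_eq_AE)
      show "AE x in powr_measure (2 * \<nu> + 1). (x \<in> (\<lambda>x. x\<^sup>2) -` {a<..b}) = (x \<in> {sqrt A<..sqrt B})"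
        using AE_powr_measure_pos
      proof eventually_elim
        case (elim x)
        have "a < x\<^sup>2 \<longleftrightarrow> A < x\<^sup>2" using elim by (auto simp: A_def)
        also have "\<dots> \<longleftrightarrow> sqrt A < x"
          using elim real_sqrt_less_iff[of A "x\<^sup>2"] by simp
        finally have 1: "a < x\<^sup>2 \<longleftrightarrow> sqrt A < x" .
        have "x\<^sup>2 \<le> b \<longleftrightarrow> x\<^sup>2 \<le> B"
          unfolding B_def le_max_iff_disj
          using zero_less_power[OF elim, of 2, unfolded linorder_not_le[symmetric]] by blast
        also have "\<dots> \<longleftrightarrow> x \<le> sqrt B"
          using elim real_sqrt_le_iff[of "x\<^sup>2" B] by simp
        finally show ?case using 1 by auto
      qed
      have "(\<lambda>x::real. x\<^sup>2) -` {a<..b} \<inter> space borel \<in> sets borel"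
        by (rule measurable_sets[of _ borel borel]) auto
      then show "(\<lambda>x. x\<^sup>2) -` {a<..b} \<in> sets (powr_measure (2 * \<nu> + 1))" by simp
    qed auto
    also have "\<dots> = ennreal (B powr (\<nu> + 1) / (2 * (\<nu> + 1)) - A powr (\<nu> + 1) / (2 * (\<nu> + 1)))"
    proof -
      have "2 * \<nu> + 1 > -1" using nu by simp
      then have "emeasure (powr_measure (2 * \<nu> + 1)) {sqrt A<..sqrt B} =
        ennreal (max (sqrt B) 0 powr (2 * \<nu> + 1 + 1) / (2 * \<nu> + 1 + 1) -
          max (sqrt A) 0 powr (2 * \<nu> + 1 + 1) / (2 * \<nu> + 1 + 1))"
        using AB by (intro emeasure_powr_measure_Ioc) auto
      moreover have "max (sqrt B) 0 = sqrt B" "max (sqrt A) 0 = sqrt A" "A \<ge> 0" "B \<ge> 0"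
        using AB by auto
      moreover have "2 * (\<nu> + 1) = 2 * \<nu> + 1 + 1" by simp
      ultimately show ?thesis by (simp only: sq)
    qed
    also have "\<dots> = ennreal (1 / 2) * ennreal (B powr (\<nu> + 1) / (\<nu> + 1) - A powr (\<nu> + 1) / (\<nu> + 1))"
    proof -
      have "A powr (\<nu> + 1) \<le> B powr (\<nu> + 1)" using AB nu by (intro powr_mono2) auto
      then have "B powr (\<nu> + 1) / (\<nu> + 1) - A powr (\<nu> + 1) / (\<nu> + 1) \<ge> 0"
        using nu by (simp add: divide_right_mono)
      then show ?thesis by (subst ennreal_mult[symmetric]) (auto simp: diff_divide_distrib mult.commute)
    qed
    finally show ?thesis
      unfolding A_def B_def
      by (simp only: emeasure_powr_measure_Ioc[OF nu True, symmetric])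
         (subst emeasure_density_const, auto)
  qed simp
qed auto

lemma has_bochner_integral_powr_measure_square:
  fixes f :: "real \<Rightarrow> real"
  assumes nu: "\<nu> > -1" and f: "has_bochner_integral (powr_measure \<nu>) f I"
  shows "has_bochner_integral (powr_measure (2 * \<nu> + 1)) (\<lambda>x. f (x\<^sup>2)) (I / 2)"
proof -
  have [measurable]: "f \<in> borel_measurable borel"
    using borel_measurable_has_bochner_integral[OF f] by simp
  have "has_bochner_integral (density (powr_measure \<nu>) (\<lambda>_. ennreal (1 / 2))) f (I / 2)"
  proof -
    have "integrable (density (powr_measure \<nu>) (\<lambda>_. ennreal (1 / 2))) f \<longleftrightarrow>
        integrable (powr_measure \<nu>) (\<lambda>x. (1 / 2) *\<^sub>R f x)"
      by (rule integrable_density) auto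
    moreover have "(\<integral>x. f x \<partial>density (powr_measure \<nu>) (\<lambda>_. ennreal (1 / 2))) =
        (\<integral>x. (1 / 2) *\<^sub>R f x \<partial>powr_measure \<nu>)"
      by (rule integral_density) auto
    ultimately show ?thesis using f unfolding has_bochner_integral_iff by simp
  qed
  then have "has_bochner_integral (distr (powr_measure (2 * \<nu> + 1)) borel (\<lambda>x. x\<^sup>2)) f (I / 2)"
    unfolding distr_square_powr_measure[OF nu] .
  then show ?thesis
    by (auto simp: has_bochner_integral_iff integrable_distr_eq integral_distr)
qed

text \<open>Moving a factor x from the weight to the integrand brings the odd part, of order 1 - H,
  to the weight of order -H used for the even part.\<close>

lemma has_bochner_integral_powr_measure_Suc:
  fixes f :: "real \<Rightarrow> real"
  assumes f: "has_bochner_integral (powr_measure (\<nu> + 1)) f I"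
  shows "has_bochner_integral (powr_measure \<nu>) (\<lambda>x. x * f x) I"
proof -
  have [measurable]: "f \<in> borel_measurable borel"
    using borel_measurable_has_bochner_integral[OF f] by simp
  have "has_bochner_integral lborel (\<lambda>x. indicator {0<..} x * x powr (\<nu> + 1) * f x) I"
    using f by (subst (asm) has_bochner_integral_powr_measure) auto
  also have "(\<lambda>x. indicator {0<..} x * x powr (\<nu> + 1) * f x) =
      (\<lambda>x. indicator {0<..} x * x powr \<nu> * (x * f x))"
    by (auto simp: powr_add fun_eq_iff split: split_indicator)
  finally show ?thesis by (subst has_bochner_integral_powr_measure) auto
qed

lemma has_bochner_integral_powr_measure_iff:
  fixes f :: "real \<Rightarrow> complex"
  assumes [measurable]: "f \<in> borel_measurable borel"
  shows "has_bochner_integral (powr_measure \<nu>) f I \<longleftrightarrow>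
    has_bochner_integral lborel (\<lambda>x. (indicator {0<..} x * x powr \<nu>) *\<^sub>R f x) I"
  unfolding powr_measure_def has_bochner_integral_iff
  by (subst integrable_density, simp, simp, simp, subst integral_density) auto

section \<open>Half-line densities of the spectral measure and of dV\<close>

definition fbm_const :: "real \<Rightarrow> real" where
  "fbm_const H = sin (pi * H) * Gamma (1 + 2 * H) / (2 * pi)"

lemma fbm_const_pos: "0 < H \<Longrightarrow> H < 1 \<Longrightarrow> fbm_const H > 0"
  unfolding fbm_const_def by (intro divide_pos_pos mult_pos_pos sin_gt_zero Gamma_real_pos) auto

lemma has_bochner_integral_fbm_spectral_measure:
  fixes F :: "real \<Rightarrow> complex"
  assumes H: "0 < H" "H < 1" and [measurable]: "F \<in> borel_measurable borel"
  shows "has_bochner_integral (fbm_spectral_measure H) F I \<longleftrightarrow>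
    has_bochner_integral lborel (\<lambda>x. (fbm_const H * \<bar>x\<bar> powr (1 - 2 * H)) *\<^sub>R F x) I"
  using fbm_const_pos[OF H]
  unfolding fbm_spectral_measure_def has_bochner_integral_iff fbm_const_def[symmetric]
  by (subst integrable_density, simp, simp, simp, subst integral_density) auto

text \<open>The integrands to come are neither even nor odd. Keeping the two half-lines apart lets
  their odd contributions cancel in \<open>I1 + I2\<close>.\<close>

lemma fbm_spectral_measure_fold:
  fixes F :: "real \<Rightarrow> complex"
  assumes H: "0 < H" "H < 1" and F [measurable]: "F \<in> borel_measurable borel"
    and F1: "has_bochner_integral (powr_measure (1 - 2 * H)) F I1"
    and F2: "has_bochner_integral (powr_measure (1 - 2 * H)) (\<lambda>x. F (- x)) I2"
  shows "has_bochner_integral (fbm_spectral_measure H) F (fbm_const H *\<^sub>R (I1 + I2))"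
proof -
  let ?w = "\<lambda>x::real. indicator {0<..} x * x powr (1 - 2 * H)"
  have G1: "has_bochner_integral lborel (\<lambda>x. ?w x *\<^sub>R F x) I1"
    using F1 by (subst (asm) has_bochner_integral_powr_measure_iff) auto
  have "has_bochner_integral lborel (\<lambda>x. ?w x *\<^sub>R F (- x)) I2"
    using F2 by (subst (asm) has_bochner_integral_powr_measure_iff) auto
  then have G2: "has_bochner_integral lborel (\<lambda>x. ?w (- x) *\<^sub>R F x) I2"
    by (subst (asm) lborel_has_bochner_integral_real_affine_iff[of "-1" _ _ 0]) auto
  have "has_bochner_integral lborel (\<lambda>x. fbm_const H *\<^sub>R (?w x *\<^sub>R F x + ?w (- x) *\<^sub>R F x)) (fbm_const H *\<^sub>R (I1 + I2))"
    by (intro has_bochner_integral_scaleR_right has_bochner_integral_add G1 G2)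
  moreover have "AE x in lborel. fbm_const H *\<^sub>R (?w x *\<^sub>R F x + ?w (- x) *\<^sub>R F x) =
      (fbm_const H * \<bar>x\<bar> powr (1 - 2 * H)) *\<^sub>R F x"
    using AE_lborel_singleton[of "0::real"]
  proof eventually_elim
    case (elim x)
    then show ?case by (cases "x > 0") (auto simp: indicator_def)
  qed
  ultimately have "has_bochner_integral lborel (\<lambda>x. (fbm_const H * \<bar>x\<bar> powr (1 - 2 * H)) *\<^sub>R F x) (fbm_const H *\<^sub>R (I1 + I2))"
    by (subst (asm) has_bochner_integral_cong_AE) auto
  then show ?thesis using H by (subst has_bochner_integral_fbm_spectral_measure) auto
qed

lemma fbm_d2_pos: "0 < H \<Longrightarrow> H < 1 \<Longrightarrow> fbm_d2 H > 0"
  unfolding fbm_d2_def by (intro divide_pos_pos mult_pos_pos Gamma_real_pos) auto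

text \<open>The derivative of V is a multiple of t^(1-2H), so time and frequency carry the same
  weight. V is continuous and nondecreasing, hence both measures can be compared on half-open
  intervals.\<close>

lemma interval_measure_fbm_V:
  assumes H: "0 < H" "H < 1"
  shows "interval_measure (fbm_V H) = density (powr_measure (1 - 2 * H)) (\<lambda>_. ennreal (fbm_d2 H * (2 - 2 * H)))"
proof -
  have V: "fbm_V H = (\<lambda>t. fbm_d2 H * max t 0 powr (2 - 2 * H))"
    by (auto simp: fbm_V_def max_def fun_eq_iff)
  have d2: "fbm_d2 H > 0" by (rule fbm_d2_pos[OF H])
  have mono: "fbm_V H x \<le> fbm_V H y" if "x \<le> y" for x y
    unfolding V using that H d2 by (intro mult_left_mono powr_mono2) auto
  have "continuous_on UNIV (fbm_V H)"
    unfolding V using H by (intro continuous_intros continuous_on_powr') auto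
  then have cont: "continuous (at_right a) (fbm_V H)" for a
    by (meson UNIV_I continuous_on_eq_continuous_at continuous_at_imp_continuous_at_within open_UNIV)
  have nu: "1 - 2 * H > -1" using H by simp
  have eq: "emeasure (density (powr_measure (1 - 2 * H)) (\<lambda>_. ennreal (fbm_d2 H * (2 - 2 * H)))) {a<..b} =
      emeasure (interval_measure (fbm_V H)) {a<..b}" for a b
  proof (cases "a \<le> b")
    case True
    have e: "1 - 2 * H + 1 = 2 - 2 * H" by simp
    have c: "fbm_d2 H * (2 - 2 * H) \<ge> 0" using H d2 by simp
    have "max a 0 powr (2 - 2 * H) \<le> max b 0 powr (2 - 2 * H)"
      using True H by (intro powr_mono2) auto
    then have nn: "max b 0 powr (2 - 2 * H) / (2 - 2 * H) - max a 0 powr (2 - 2 * H) / (2 - 2 * H) \<ge> 0"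
      using H by (simp add: divide_right_mono)
    have "fbm_d2 H * (2 - 2 * H) * (max b 0 powr (2 - 2 * H) / (2 - 2 * H) - max a 0 powr (2 - 2 * H) / (2 - 2 * H)) =
        fbm_V H b - fbm_V H a"
    proof -
      have "d * s * (B / s - A / s) = d * B - d * A" if "s \<noteq> 0" for d s A B :: real
        using that by (simp add: field_simps)
      then show ?thesis using H by (simp add: V)
    qed
    moreover have "emeasure (interval_measure (fbm_V H)) {a<..b} = ennreal (fbm_V H b - fbm_V H a)"
      by (rule emeasure_interval_measure_Ioc[OF True mono cont])
    ultimately show ?thesis
      by (subst emeasure_density_const)
         (auto simp: emeasure_powr_measure_Ioc[OF nu True] e ennreal_mult[OF c nn, symmetric])
  qed simp
  show ?thesis
  proof (rule sym, rule measure_eqI_Ioc[OF _ _ eq])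
    show "emeasure (density (powr_measure (1 - 2 * H)) (\<lambda>_. ennreal (fbm_d2 H * (2 - 2 * H)))) {a<..b} \<noteq> \<infinity>" for a b
      using emeasure_powr_measure_Ioc_finite[OF nu, of a b]
      by (simp add: emeasure_density_const ennreal_mult_eq_top_iff)
  qed auto
qed

section \<open>The Christoffel-Darboux formula\<close>

text \<open>The representer of evaluation at w: for a function supported in x < X, its pairing with
  this one is its transform at \<open>w\<^sup>2\<close>.\<close>

definition bessel_cutoff :: "real \<Rightarrow> real \<Rightarrow> real \<Rightarrow> real \<Rightarrow> real" where
  "bessel_cutoff \<nu> X w x = (if x < X then bessel_clifford \<nu> (x * w\<^sup>2) else 0)"

lemma borel_measurable_bessel_cutoff [measurable]: "bessel_cutoff \<nu> X w \<in> borel_measurable borel"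
  unfolding bessel_cutoff_def[abs_def] by measurable

text \<open>The kernel is bounded on the compact range [0, X R^2] of its argument. Uniformity in
  \<open>w\<close> is what later makes the norm of the reproducing kernel locally bounded.\<close>

lemma bessel_cutoff_square_bound:
  assumes nu: "\<nu> > -1" and X: "X > 0"
  shows "integrable (powr_measure \<nu>) (\<lambda>x. (bessel_cutoff \<nu> X w x)\<^sup>2)"
    and "\<exists>M. \<forall>w. \<bar>w\<bar> \<le> R \<longrightarrow> (\<integral>x. (bessel_cutoff \<nu> X w x)\<^sup>2 \<partial>powr_measure \<nu>) \<le> M"
proof -
  let ?L = "powr_measure \<nu>"
  have "\<exists>M. \<forall>w. \<bar>w\<bar> \<le> R \<longrightarrow> integrable ?L (\<lambda>x. (bessel_cutoff \<nu> X w x)\<^sup>2) \<and>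
     (\<integral>x. (bessel_cutoff \<nu> X w x)\<^sup>2 \<partial>?L) \<le> M" for R
  proof -
    have "compact (bessel_clifford \<nu> ` {0..X * R\<^sup>2})"
      by (intro compact_continuous_image continuous_intros nu) auto
    then obtain B where B: "\<And>z. z \<in> {0..X * R\<^sup>2} \<Longrightarrow> \<bar>bessel_clifford \<nu> z\<bar> \<le> B"
      unfolding compact_eq_bounded_closed bounded_iff by (metis image_eqI real_norm_def)
    have E: "integrable ?L (\<lambda>x. B\<^sup>2 * (exp X * exp (- x)))"
      using exp_integral_powr_measure[OF nu, of 1] by (simp add: has_bochner_integral_iff)
    have le: "AE x in ?L. (bessel_cutoff \<nu> X w x)\<^sup>2 \<le> B\<^sup>2 * (exp X * exp (- x))" if w: "\<bar>w\<bar> \<le> R" for w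
      using AE_powr_measure_pos[of \<nu>]
    proof eventually_elim
      case (elim x)
      show ?case
      proof (cases "x < X")
        case True
        have "w\<^sup>2 \<le> R\<^sup>2" using w by (simp add: abs_le_square_iff[symmetric])
        then have "x * w\<^sup>2 \<in> {0..X * R\<^sup>2}"
          using elim True by (auto intro!: mult_mono)
        from B[OF this] have "(bessel_cutoff \<nu> X w x)\<^sup>2 \<le> B\<^sup>2"
          using True by (auto simp: bessel_cutoff_def intro: power2_le_iff_abs_le[THEN iffD2])
        also have "B\<^sup>2 * 1 \<le> B\<^sup>2 * (exp X * exp (- x))"
          using True by (intro mult_left_mono) (auto simp flip: exp_add)
        finally show ?thesis by simp
      qed (simp add: bessel_cutoff_def)
    qed
    have int: "integrable ?L (\<lambda>x. (bessel_cutoff \<nu> X w x)\<^sup>2)" if w: "\<bar>w\<bar> \<le> R" for w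
    proof (rule Bochner_Integration.integrable_bound[OF E])
      show "AE x in ?L. norm ((bessel_cutoff \<nu> X w x)\<^sup>2) \<le> norm (B\<^sup>2 * (exp X * exp (- x)))"
        using le[OF w] by eventually_elim simp
    qed measurable
    show ?thesis
      by (intro exI[of _ "\<integral>x. B\<^sup>2 * (exp X * exp (- x)) \<partial>?L"] allI impI conjI int integral_mono_AE E le)
  qed
  then show "integrable (powr_measure \<nu>) (\<lambda>x. (bessel_cutoff \<nu> X w x)\<^sup>2)"
    "\<exists>M. \<forall>w. \<bar>w\<bar> \<le> R \<longrightarrow> (\<integral>x. (bessel_cutoff \<nu> X w x)\<^sup>2 \<partial>powr_measure \<nu>) \<le> M"
    by (meson order_refl)+
qed

lemma bessel_cutoff_hankel_class:
  assumes nu: "\<nu> > -1" and X: "X > 0"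
  shows "bessel_cutoff \<nu> X w \<in> hankel_class \<nu>"
proof (rule hankel_class_cutoff[OF nu X, where k = "\<lambda>x. bessel_clifford \<nu> (x * w\<^sup>2)"])
  show "continuous_on {0..<X} (\<lambda>x. bessel_clifford \<nu> (x * w\<^sup>2))"
    by (intro continuous_intros nu)
qed (auto simp: bessel_cutoff_def[abs_def] bessel_cutoff_square_bound[OF nu X, unfolded bessel_cutoff_def[abs_def]])

text \<open>Back to the gauge integral over [0, X], in the form to which the fundamental theorem of
  calculus applies.\<close>

lemma hankel_bessel_cutoff:
  assumes nu: "\<nu> > -1" and X: "X > 0"
  shows "((\<lambda>x. x powr \<nu> * bessel_clifford \<nu> (x * w\<^sup>2) * bessel_clifford \<nu> (x * \<tau>)) has_integral
    hankel \<nu> (bessel_cutoff \<nu> X w) \<tau>) {0..X}"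
proof -
  have "integrable (powr_measure \<nu>) (\<lambda>x. bessel_cutoff \<nu> X w x * bessel_clifford \<nu> (x * \<tau>))"
    by (rule integrable_mult_clifford[OF nu _ bessel_cutoff_square_bound(1)[OF nu X], where Y = X])
       (auto simp: bessel_cutoff_def)
  then have "has_bochner_integral (powr_measure \<nu>) (\<lambda>x. bessel_cutoff \<nu> X w x * bessel_clifford \<nu> (x * \<tau>))
      (hankel \<nu> (bessel_cutoff \<nu> X w) \<tau>)"
    by (simp add: has_bochner_integral_iff hankel_def)
  then have "has_bochner_integral lborel (\<lambda>x. indicator {0<..} x * x powr \<nu> *
      (bessel_cutoff \<nu> X w x * bessel_clifford \<nu> (x * \<tau>))) (hankel \<nu> (bessel_cutoff \<nu> X w) \<tau>)"
    by (subst (asm) has_bochner_integral_powr_measure) auto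
  then have "((\<lambda>x. indicator {0<..} x * x powr \<nu> *
      (bessel_cutoff \<nu> X w x * bessel_clifford \<nu> (x * \<tau>))) has_integral (hankel \<nu> (bessel_cutoff \<nu> X w) \<tau>)) UNIV"
    using has_integral_integral_lborel unfolding has_bochner_integral_iff by metis
  then have "((\<lambda>x. if x \<in> {0..X} then x powr \<nu> * bessel_clifford \<nu> (x * w\<^sup>2) * bessel_clifford \<nu> (x * \<tau>) else 0)
      has_integral (hankel \<nu> (bessel_cutoff \<nu> X w) \<tau>)) UNIV"
  proof (rule has_integral_spike_finite[of "{0, X}", rotated 2])
    show "(if x \<in> {0..X} then x powr \<nu> * bessel_clifford \<nu> (x * w\<^sup>2) * bessel_clifford \<nu> (x * \<tau>) else 0) =
        indicator {0<..} x * x powr \<nu> * (bessel_cutoff \<nu> X w x * bessel_clifford \<nu> (x * \<tau>))"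
      if "x \<in> UNIV - {0, X}" for x
      using that by (auto simp: bessel_cutoff_def indicator_def)
  qed simp
  then show ?thesis by (subst (asm) has_integral_restrict_UNIV)
qed

text \<open>The product rule produces exactly the left-hand side of
  \<open>bessel_clifford_recurrence\<close>.\<close>

lemma DERIV_powr_bessel_clifford:
  assumes nu: "\<nu> > -1" and x: "x > 0"
  shows "((\<lambda>x. x powr (\<nu> + 1) * bessel_clifford (\<nu> + 1) (x * s)) has_real_derivative
     x powr \<nu> * bessel_clifford \<nu> (x * s)) (at x)"
proof -
  have 1: "((\<lambda>x. bessel_clifford (\<nu> + 1) (x * s)) has_real_derivative
      - bessel_clifford (\<nu> + 1 + 1) (x * s) * (1 * s)) (at x)"
    by (rule DERIV_chain2[OF DERIV_bessel_clifford DERIV_cmult_right[OF DERIV_ident]]) (use nu in simp)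
  have 2: "((\<lambda>x. x powr (\<nu> + 1)) has_real_derivative (\<nu> + 1) * x powr (\<nu> + 1 - 1)) (at x)"
    using x by (rule has_real_derivative_powr)
  have "x powr \<nu> * bessel_clifford \<nu> (x * s) =
      (\<nu> + 1) * x powr (\<nu> + 1 - 1) * bessel_clifford (\<nu> + 1) (x * s) +
      (- bessel_clifford (\<nu> + 1 + 1) (x * s) * (1 * s)) * x powr (\<nu> + 1)"
  proof -
    have "\<nu> + 1 + 1 = \<nu> + 2" by simp
    then show ?thesis
      using x unfolding bessel_clifford_recurrence[OF nu, of "x * s", symmetric]
      by (simp add: powr_add algebra_simps)
  qed
  then show ?thesis using DERIV_mult[OF 2 1] by simp
qed

text \<open>The Wronskian-type boundary term of Lommel's integral. The first powers of
  \<open>l\<close> and \<open>w\<close>, in place of squares, belong to the combination of the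
  orders \<nu> and \<nu> + 1, whose prefactor is l - w and not l^2 - w^2.\<close>

definition lommel :: "real \<Rightarrow> real \<Rightarrow> real \<Rightarrow> real \<Rightarrow> real" where
  "lommel \<nu> w l x = l * (x powr (\<nu> + 1) * bessel_clifford (\<nu> + 1) (x * l\<^sup>2)) * bessel_clifford \<nu> (x * w\<^sup>2) -
     w * (x powr (\<nu> + 1) * bessel_clifford (\<nu> + 1) (x * w\<^sup>2)) * bessel_clifford \<nu> (x * l\<^sup>2)"

text \<open>Differentiating the factors of order \<nu> + 1 gives the coefficient l - w;
  differentiating those of order \<nu> gives w l^2 - w^2 l = w l (l - w), which has the same
  factor.\<close>

lemma DERIV_lommel:
  assumes nu: "\<nu> > -1" and x: "x > 0"
  shows "(lommel \<nu> w l has_real_derivative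
     (l - w) * (x powr \<nu> * bessel_clifford \<nu> (x * w\<^sup>2) * bessel_clifford \<nu> (x * l\<^sup>2) +
        w * l * (x powr (\<nu> + 1) * bessel_clifford (\<nu> + 1) (x * w\<^sup>2) * bessel_clifford (\<nu> + 1) (x * l\<^sup>2)))) (at x)"
proof -
  have C: "((\<lambda>x. bessel_clifford \<nu> (x * s)) has_real_derivative - bessel_clifford (\<nu> + 1) (x * s) * (1 * s)) (at x)" for s
    by (rule DERIV_chain2[OF DERIV_bessel_clifford DERIV_cmult_right[OF DERIV_ident]]) (use nu in simp)
  note E = DERIV_powr_bessel_clifford[OF nu x]
  have D: "(lommel \<nu> w l has_real_derivative
     (l * (x powr \<nu> * bessel_clifford \<nu> (x * l\<^sup>2)) * bessel_clifford \<nu> (x * w\<^sup>2) +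
      (- bessel_clifford (\<nu> + 1) (x * w\<^sup>2) * (1 * w\<^sup>2)) * (l * (x powr (\<nu> + 1) * bessel_clifford (\<nu> + 1) (x * l\<^sup>2)))) -
     (w * (x powr \<nu> * bessel_clifford \<nu> (x * w\<^sup>2)) * bessel_clifford \<nu> (x * l\<^sup>2) +
      (- bessel_clifford (\<nu> + 1) (x * l\<^sup>2) * (1 * l\<^sup>2)) * (w * (x powr (\<nu> + 1) * bessel_clifford (\<nu> + 1) (x * w\<^sup>2))))) (at x)"
    unfolding lommel_def[abs_def] by (intro DERIV_diff DERIV_mult DERIV_cmult E C)
  have "l * (p * dl) * dw + (- cw * (1 * w\<^sup>2)) * (l * (q * cl)) -
     (w * (p * dw) * dl + (- cl * (1 * l\<^sup>2)) * (w * (q * cw))) =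
     (l - w) * (p * dw * dl + w * l * (q * cw * cl))" for p q dw dl cw cl :: real
    by (simp add: algebra_simps power2_eq_square)
  from DERIV_cong[OF D this] show ?thesis .
qed

lemma continuous_on_lommel [continuous_intros]:
  assumes nu: "\<nu> > -1" and f: "continuous_on A f" "\<And>x. x \<in> A \<Longrightarrow> f x \<ge> 0"
  shows "continuous_on A (\<lambda>x. lommel \<nu> w l (f x))"
proof -
  have "continuous_on A (\<lambda>x. f x powr (\<nu> + 1))"
    by (rule continuous_on_powr'[OF f(1) continuous_on_const]) (use nu f(2) in auto)
  then show ?thesis
    unfolding lommel_def
    by (intro continuous_on_diff continuous_on_mult continuous_on_const continuous_on_bessel_clifford f(1))
       (use nu in auto)
qed

lemma lommel_integral:
  assumes nu: "\<nu> > -1" and X: "X > 0"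
  shows "(l - w) * (hankel \<nu> (bessel_cutoff \<nu> X w) (l\<^sup>2) +
      w * l * hankel (\<nu> + 1) (bessel_cutoff (\<nu> + 1) X w) (l\<^sup>2)) = lommel \<nu> w l X"
proof -
  let ?f = "\<lambda>x. (l - w) * (x powr \<nu> * bessel_clifford \<nu> (x * w\<^sup>2) * bessel_clifford \<nu> (x * l\<^sup>2) +
        w * l * (x powr (\<nu> + 1) * bessel_clifford (\<nu> + 1) (x * w\<^sup>2) * bessel_clifford (\<nu> + 1) (x * l\<^sup>2)))"
  have "(?f has_integral (lommel \<nu> w l X - lommel \<nu> w l 0)) {0..X}"
  proof (rule fundamental_theorem_of_calculus_interior)
    show "continuous_on {0..X} (lommel \<nu> w l)"
      using continuous_on_lommel[OF nu continuous_on_id, of "{0..X}"] by auto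
    show "(lommel \<nu> w l has_vector_derivative ?f x) (at x)" if "x \<in> {0<..<X}" for x
      using DERIV_lommel[OF nu, of x w l] that by (simp add: has_real_derivative_iff_has_vector_derivative)
  qed (use X in simp)
  moreover have "lommel \<nu> w l 0 = 0" by (simp add: lommel_def)
  moreover have "(?f has_integral (l - w) * (hankel \<nu> (bessel_cutoff \<nu> X w) (l\<^sup>2) +
      w * l * hankel (\<nu> + 1) (bessel_cutoff (\<nu> + 1) X w) (l\<^sup>2))) {0..X}"
    using nu X by (intro has_integral_mult_right has_integral_add hankel_bessel_cutoff) auto
  ultimately show ?thesis by (auto dest: has_integral_unique)
qed

section \<open>The function \<phi> through Bessel-Clifford functions, and the normalising
  constants\<close>

lemma bessel_J_even_of_real:
  assumes nu: "\<nu> > -1"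
  shows "bessel_J_even \<nu> (of_real w) = of_real (2 powr (- \<nu>) * bessel_clifford \<nu> (w\<^sup>2 / 4))"
proof -
  have "(\<lambda>k. of_real (2 powr (- \<nu>) * (clifford_coeff \<nu> k * (w\<^sup>2 / 4) ^ k)) :: complex) sums
     of_real (2 powr (- \<nu>) * bessel_clifford \<nu> (w\<^sup>2 / 4))"
    by (intro sums_of_real sums_mult sums_clifford nu)
  moreover have "of_real (2 powr (- \<nu>) * (clifford_coeff \<nu> k * (w\<^sup>2 / 4) ^ k)) =
     (-1) ^ k * of_real (2 powr (-\<nu>)) * (of_real w / 2) ^ (2 * k) /
            (fact k * of_real (Gamma (real k + \<nu> + 1)) :: complex)" for k
  proof -
    have "(of_real w / 2 :: complex) ^ (2 * k) = of_real ((w\<^sup>2 / 4) ^ k)"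
      by (simp add: power_mult power_divide)
    then show ?thesis by (simp only: clifford_coeff_def) simp
  qed
  ultimately show ?thesis unfolding bessel_J_even_def by (simp add: sums_iff)
qed

text \<open>The powers of 2 cancel in the even term and leave 1/2 in the odd one, which turns the
  factor z/2 into z/4; z^2/16 is (z/2)^2/4.\<close>

lemma fbm_phi_clifford:
  assumes H: "0 < H" "H < 1"
  shows "fbm_phi H z = of_real (Gamma (1 - H)) * exp (\<i> * of_real (z / 2)) *
    (of_real (bessel_clifford (- H) (z\<^sup>2 / 16)) + \<i> * of_real (z / 4 * bessel_clifford (1 - H) (z\<^sup>2 / 16)))"
proof -
  have 1: "(z / 2)\<^sup>2 / 4 = z\<^sup>2 / 16" by (simp add: power_divide)
  have 2: "(2::real) powr (- H) * 2 powr H = 1" unfolding powr_add[symmetric] by simp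
  have 3: "(2::real) powr (- H) * 2 powr (- (1 - H)) = 1 / 2"
  proof -
    have "- H + - (1 - H) = - 1" by simp
    then show ?thesis unfolding powr_add[symmetric] by (simp add: powr_minus)
  qed
  have "g * a * e * (b * c + \<i> * (z2 * (b' * c'))) = g * e * ((a * b) * c + \<i> * (z2 * (a * b') * c'))"
    for g a e b c z2 b' c' :: complex by (simp add: algebra_simps)
  note * = this[of "of_real (Gamma (1 - H))" "of_real (2 powr (-H))" "exp (\<i> * of_real z / 2)" "of_real (2 powr (- (- H)))"
      "of_real (bessel_clifford (- H) (z\<^sup>2 / 16))" "of_real (z / 2)" "of_real (2 powr (- (1 - H)))"
      "of_real (bessel_clifford (1 - H) (z\<^sup>2 / 16))"]
  have a: "complex_of_real (2 powr (- H)) * of_real (2 powr (- (- H))) = 1"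
    unfolding of_real_mult[symmetric] using 2 by simp
  have b: "complex_of_real (2 powr (- H)) * of_real (2 powr (- (1 - H))) = of_real (1 / 2)"
    unfolding of_real_mult[symmetric] 3 ..
  have J: "bessel_J_even (- H) (of_real (z / 2)) = of_real (2 powr (- (- H)) * bessel_clifford (- H) (z\<^sup>2 / 16))"
    "bessel_J_even (1 - H) (of_real (z / 2)) = of_real (2 powr (- (1 - H)) * bessel_clifford (1 - H) (z\<^sup>2 / 16))"
    using bessel_J_even_of_real[of "- H" "z / 2"] bessel_J_even_of_real[of "1 - H" "z / 2"] H
    unfolding 1 by auto
  have "fbm_phi H z = of_real (Gamma (1 - H)) * of_real (2 powr (-H)) * exp (\<i> * of_real z / 2) *
     (of_real (2 powr (- (- H))) * of_real (bessel_clifford (- H) (z\<^sup>2 / 16)) +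
       \<i> * (of_real (z / 2) * (of_real (2 powr (- (1 - H))) * of_real (bessel_clifford (1 - H) (z\<^sup>2 / 16)))))"
    by (simp only: fbm_phi_eq[OF H(2)] J of_real_mult)
  then show ?thesis unfolding * a b by simp
qed

lemma continuous_on_fbm_phi:
  assumes H: "0 < H" "H < 1" and f: "continuous_on A f"
  shows "continuous_on A (\<lambda>x. fbm_phi H (f x))"
  unfolding fbm_phi_clifford[OF H] using H f by (intro continuous_intros) auto

lemma Gamma_duplication_real:
  fixes z :: real
  assumes "z > 0"
  shows "Gamma z * Gamma (z + 1 / 2) = 2 powr (1 - 2 * z) * sqrt pi * Gamma (2 * z)"
proof -
  have "of_real z \<notin> (\<int>\<^sub>\<le>\<^sub>0 :: complex set)" "of_real z + 1 / 2 \<notin> (\<int>\<^sub>\<le>\<^sub>0 :: complex set)"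
    using assms of_real_in_nonpos_Ints_iff[of z, where 'a = complex]
      of_real_in_nonpos_Ints_iff[of "z + 1 / 2", where 'a = complex]
    by (auto elim!: nonpos_Ints_cases)
  from Gamma_legendre_duplication[OF this]
  have "Gamma (of_real z) * Gamma (of_real z + 1 / 2 :: complex) =
     exp ((1 - 2 * of_real z) * of_real (ln 2)) * of_real (sqrt pi) * Gamma (2 * of_real z)" .
  moreover have "of_real z + 1 / 2 = complex_of_real (z + 1 / 2)" "2 * complex_of_real z = of_real (2 * z)"
    "exp ((1 - complex_of_real (2 * z)) * of_real (ln 2)) = of_real (2 powr (1 - 2 * z))"
    by (simp_all add: powr_def exp_of_real[symmetric])
  ultimately have "complex_of_real (Gamma z * Gamma (z + 1 / 2)) =
      of_real (2 powr (1 - 2 * z) * sqrt pi * Gamma (2 * z))"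
    by (simp only: Gamma_complex_of_real of_real_mult[symmetric])
  then show ?thesis by (simp only: of_real_eq_iff)
qed

lemma Gamma_reflection_real:
  fixes z :: real
  shows "Gamma z * Gamma (1 - z) = pi / sin (pi * z)"
proof -
  have "complex_of_real (Gamma z * Gamma (1 - z)) = Gamma (of_real z) * Gamma (1 - of_real z)"
    by (simp add: Gamma_complex_of_real[symmetric])
  also have "\<dots> = of_real (pi / sin (pi * z))"
    by (simp add: Gamma_reflection_complex sin_of_real[symmetric])
  finally show ?thesis by (simp only: of_real_eq_iff)
qed

text \<open>Collected from the integral for S: the density of dV, the factor Gamma(1-H) of each
  \<phi>, the power of 4 from u = 4 r with r^2 = x, and a 2 because r du = 2 dx.\<close>

definition fbm_kernel_const :: "real \<Rightarrow> real" where
  "fbm_kernel_const H = 2 * (fbm_d2 H * (2 - 2 * H)) * (Gamma (1 - H))\<^sup>2 * 4 powr (1 - 2 * H)"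

text \<open>This is where the value of \<open>fbm_d2\<close> matters: it makes the kernel reproduce
  with factor 1. The Gamma values are eliminated by duplication at H and at 1 - H and by reflection
  at H.\<close>

lemma fbm_const_mult_kernel_const:
  assumes H: "0 < H" "H < 1"
  shows "fbm_const H * fbm_kernel_const H = 1"
proof -
  define a b c d e f where "a = Gamma H" and "b = Gamma (H + 1 / 2)" and "c = Gamma (1 - H)"
    and "d = Gamma (3 / 2 - H)" and "e = Gamma (2 * H)" and "f = Gamma (2 - 2 * H)"
  define P where "P = (2::real) powr (1 - 2 * H)"
  define s where "s = sin (pi * H)"
  have pos: "a > 0" "b > 0" "c > 0" "d > 0" "e > 0" "f > 0" "P > 0"
    using H by (auto simp: a_def b_def c_def d_def e_def f_def P_def intro!: Gamma_real_pos)
  have s: "s > 0" using H by (auto simp: s_def intro!: sin_gt_zero)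
  have ab: "a * b = P * sqrt pi * e"
    using Gamma_duplication_real[of H] H by (simp add: a_def b_def e_def P_def)
  have "c * d = 2 powr (1 - 2 * (1 - H)) * sqrt pi * f"
    using Gamma_duplication_real[of "1 - H"] H by (simp add: c_def d_def f_def algebra_simps)
  moreover have "P * 2 powr (1 - 2 * (1 - H)) = 1"
    unfolding P_def powr_add[symmetric] by simp
  ultimately have cd: "P * (c * d) = sqrt pi * f" by simp
  have ac: "s * (a * c) = pi"
    using Gamma_reflection_real[of H] s by (simp add: a_def c_def s_def)
  have G1: "Gamma (1 + 2 * H) = 2 * H * e"
  proof -
    have "2 * H \<notin> \<int>\<^sub>\<le>\<^sub>0" using H by (auto elim!: nonpos_Ints_cases)
    from Gamma_plus1[OF this] show ?thesis by (simp add: e_def add.commute)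
  qed
  have G2: "Gamma (3 - 2 * H) = (2 - 2 * H) * f"
  proof -
    have "2 - 2 * H \<notin> \<int>\<^sub>\<le>\<^sub>0" using H by (auto elim!: nonpos_Ints_cases)
    from Gamma_plus1[OF this] show ?thesis by (simp add: f_def algebra_simps)
  qed
  have P4: "4 powr (1 - 2 * H) = P * P"
  proof -
    have "(4::real) = 2 * 2" by simp
    then show ?thesis unfolding P_def by (simp only: powr_mult)
  qed
  have H2: "2 - 2 * H \<noteq> 0" "H \<noteq> 0" using H by auto
  have "fbm_const H * fbm_kernel_const H =
      s * (2 * H * e) / (2 * pi) * (2 * (d / (2 * H * b * ((2 - 2 * H) * f)) * (2 - 2 * H)) * c\<^sup>2 * (P * P))"
    unfolding fbm_const_def fbm_kernel_const_def fbm_d2_def G1 G2 P4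
    by (simp only: s_def b_def c_def d_def)
  also have "\<dots> = s * e * (P * (c * d)) * c * P / (pi * b * f)"
    using H2 pos by (simp add: divide_simps power2_eq_square) 
  also have "\<dots> = s * c * (P * sqrt pi * e) / (pi * b)"
    unfolding cd using pos by (simp add: divide_simps)
  also have "\<dots> = s * (a * c) / pi"
    unfolding ab[symmetric] using pos by (simp add: divide_simps)
  also have "\<dots> = 1" unfolding ac by simp
  finally show ?thesis .
qed

text \<open>The product of the two \<phi> factors splits, apart from the phase \<open>E\<close>,
  into d0 c0 + w l r^2 d1 c1 and i r (l c1 d0 - w d1 c0). The first comes from differentiating the
  Lommel term, the second from differentiating the phase.\<close>

lemma lommel_phase_identity:
  fixes E :: complex and p r l w c0 c1 d0 d1 q G :: real
  shows "of_real (2 * q * G\<^sup>2) * (E * of_real ((l - w) * (p * d0 * c0 + w * l * (p * r\<^sup>2 * d1 * c1)) * (r / 2)) +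
      (\<i> * of_real ((l - w) / 2) * E) * of_real (l * (p * r\<^sup>2 * c1) * d0 - w * (p * r\<^sup>2 * d1) * c0)) =
    of_real (l - w) * ((q * (r * p)) *\<^sub>R (E * (of_real G * (of_real d0 - \<i> * of_real (r * w * d1))) *
       (of_real G * (of_real c0 + \<i> * of_real (r * l * c1)))))"
proof -
  \<comment> \<open>Without the common factor \<open>E\<close> all variables are real, so comparing
    real and imaginary parts leaves polynomial identities.\<close>
  have "of_real (2 * q * G\<^sup>2) * (of_real ((l - w) * (p * d0 * c0 + w * l * (p * r\<^sup>2 * d1 * c1)) * (r / 2)) +
      (\<i> * of_real ((l - w) / 2)) * of_real (l * (p * r\<^sup>2 * c1) * d0 - w * (p * r\<^sup>2 * d1) * c0)) =
    of_real (l - w) * ((q * (r * p)) *\<^sub>R ((of_real G * (of_real d0 - \<i> * of_real (r * w * d1))) *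
       (of_real G * (of_real c0 + \<i> * of_real (r * l * c1)))))" (is "?L = ?R")
  proof (rule complex_eqI)
    show "Re ?L = Re ?R" by (simp add: algebra_simps power2_eq_square)
    show "Im ?L = Im ?R" by (simp add: field_simps power2_eq_square)
  qed
  then have eq: "E * ?L = E * ?R" by (rule arg_cong)
  have 1: "A * (E * X + (J * E) * Y) = E * (A * (X + J * Y))" for A J X Y
    by (simp add: algebra_simps)
  have 2: "c * (k *\<^sub>R (E * P * Q)) = E * (c * (k *\<^sub>R (P * Q)))" for c P Q :: complex and k :: real
    by (simp add: mult_ac)
  show ?thesis unfolding 1 2 by (rule eq)
qed

text \<open>After multiplication by l - w the integrand is the u-derivative of the phase times the
  Lommel term at u^2/16, so only the value at u = T survives; the one at 0 vanishes.\<close>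

lemma fbm_S_lommel:
  assumes H: "0 < H" "H < 1" and T: "T > 0"
  shows "of_real (l - w) * fbm_S H T w l =
    of_real (fbm_kernel_const H) * exp (\<i> * of_real ((l - w) / 2 * T)) * of_real (lommel (- H) w l (T\<^sup>2 / 16))"
proof -
  let ?M = "powr_measure (1 - 2 * H)"
  define G where "G u = cnj (fbm_phi H (u * w)) * fbm_phi H (u * l)" for u
  define K where "K = fbm_d2 H * (2 - 2 * H)"
  define q where "q = (4::real) powr (1 - 2 * H)"
  define g where "g = Gamma (1 - H)"
  have K: "K > 0" using fbm_d2_pos[OF H] H by (simp add: K_def)
  have nu: "1 - 2 * H > -1" "- H > -1" "- H + 1 > -1" using H by auto
  have Gc: "continuous_on A G" for A
    unfolding G_def by (intro continuous_intros continuous_on_fbm_phi H)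
  have [measurable]: "G \<in> borel_measurable borel"
    by (rule borel_measurable_continuous_onI[OF Gc])
  have "compact (G ` {0..T})" by (intro compact_continuous_image Gc) auto
  then obtain B where B: "\<And>u. u \<in> {0..T} \<Longrightarrow> norm (G u) \<le> B"
    unfolding compact_eq_bounded_closed bounded_iff by (metis image_eqI)
  have B0: "B \<ge> 0" using B[of 0] T by (auto intro: order_trans[OF norm_ge_zero])
  have int: "integrable ?M (\<lambda>u. indicator {0..T} u *\<^sub>R G u)"
  proof (rule Bochner_Integration.integrable_bound)
    show "integrable ?M (\<lambda>u. B * (exp T * exp (- u)))"
      using exp_integral_powr_measure[OF nu(1), of 1] by (simp add: has_bochner_integral_iff)
    have le: "norm (indicator {0..T} u *\<^sub>R G u) \<le> norm (B * (exp T * exp (- u)))" for u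
    proof (cases "u \<in> {0..T}")
      case True
      have "norm (G u) \<le> B * 1" using B[OF True] by simp
      also have "B * 1 \<le> B * (exp T * exp (- u))"
        using True B0 by (intro mult_left_mono) (auto simp flip: exp_add)
      finally show ?thesis using True B0 by simp
    qed simp
    show "AE u in ?M. norm (indicator {0..T} u *\<^sub>R G u) \<le> norm (B * (exp T * exp (- u)))"
      by (intro AE_I2 le)
  qed measurable
  define I where "I = (\<integral>u. indicator {0..T} u *\<^sub>R G u \<partial>?M)"
  have S: "fbm_S H T w l = of_real K * I"
  proof -
    have "fbm_S H T w l = (\<integral>u. indicator {0..T} u *\<^sub>R G u \<partial>density ?M (\<lambda>_. ennreal K))"
      unfolding fbm_S_def set_lebesgue_integral_def interval_measure_fbm_V[OF H] G_def K_def ..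
    also have "\<dots> = (\<integral>u. K *\<^sub>R (indicator {0..T} u *\<^sub>R G u) \<partial>?M)"
      using K by (intro integral_density) auto
    also have "\<dots> = K *\<^sub>R I"
      unfolding I_def by (rule integral_scaleR_right)
    finally show ?thesis by (simp add: scaleR_conv_of_real)
  qed
  have "has_bochner_integral ?M (\<lambda>u. indicator {0..T} u *\<^sub>R G u) I"
    using int by (simp add: has_bochner_integral_iff I_def)
  then have "has_bochner_integral lborel
      (\<lambda>u. (indicator {0<..} u * u powr (1 - 2 * H)) *\<^sub>R (indicator {0..T} u *\<^sub>R G u)) I"
    by (subst (asm) has_bochner_integral_powr_measure_iff) auto
  then have "((\<lambda>u. (indicator {0<..} u * u powr (1 - 2 * H)) *\<^sub>R (indicator {0..T} u *\<^sub>R G u)) has_integral I) UNIV"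
    using has_integral_integral_lborel unfolding has_bochner_integral_iff by metis
  also have "(\<lambda>u. (indicator {0<..} u * u powr (1 - 2 * H)) *\<^sub>R (indicator {0..T} u *\<^sub>R G u)) =
     (\<lambda>u. if u \<in> {0..T} then u powr (1 - 2 * H) *\<^sub>R G u else 0)"
    by (auto simp: fun_eq_iff indicator_def)
  finally have HI: "((\<lambda>u. u powr (1 - 2 * H) *\<^sub>R G u) has_integral I) {0..T}"
    by (subst (asm) has_integral_restrict_UNIV)
  define E where "E z = exp (\<i> * of_real ((l - w) / 2) * z)" for z :: complex
  define W where "W = lommel (- H) w l"
  define Z where "Z u = of_real (2 * q * g\<^sup>2) * (E (of_real u) * of_real (W (u\<^sup>2 / 16)))" for u :: real
  have FTC: "((\<lambda>u. of_real (l - w) * (u powr (1 - 2 * H) *\<^sub>R G u)) has_integral (Z T - Z 0)) {0..T}"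
  proof (rule fundamental_theorem_of_calculus_interior)
    show "continuous_on {0..T} Z"
      unfolding Z_def[abs_def] E_def W_def using nu by (intro continuous_intros) auto
    fix u assume "u \<in> {0<..<T}"
    then have u: "u > 0" by simp
    define r where "r = u / 4"
    define x where "x = u\<^sup>2 / 16"
    have r: "r > 0" and x: "x > 0" using u by (auto simp: r_def x_def)
    have xr: "x = r\<^sup>2" by (simp add: x_def r_def power_divide)
    define p where "p = x powr (- H)"
    define c0 c1 d0 d1 where "c0 = bessel_clifford (- H) (x * l\<^sup>2)" and "c1 = bessel_clifford (- H + 1) (x * l\<^sup>2)"
      and "d0 = bessel_clifford (- H) (x * w\<^sup>2)" and "d1 = bessel_clifford (- H + 1) (x * w\<^sup>2)"
    have px: "x powr (- H + 1) = p * r\<^sup>2" using powr_add[of x "- H" 1] x by (simp add: p_def xr[symmetric])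
    have pu: "u powr (1 - 2 * H) = q * (r * p)"
    proof -
      have "u powr (1 - 2 * H) = q * r powr (1 - 2 * H)"
        using u unfolding q_def r_def by (subst powr_mult[symmetric]) auto
      also have "r powr (1 - 2 * H) = r * r powr (2 * (- H))"
        using r powr_add[of r 1 "2 * (- H)"] by simp
      also have "r powr (2 * (- H)) = p"
        unfolding p_def xr using r powr_powr[of r 2 "- H"] by simp
      finally show ?thesis .
    qed
    have "(E has_field_derivative (\<i> * of_real ((l - w) / 2) * E (of_real u))) (at (of_real u))"
      unfolding E_def[abs_def] by (auto intro!: derivative_eq_intros)
    then have dE: "((\<lambda>u. E (of_real u)) has_vector_derivative (\<i> * of_real ((l - w) / 2) * E (of_real u))) (at u)"
      by (rule has_vector_derivative_real_field)
    have "(W has_real_derivative ((l - w) * (p * d0 * c0 + w * l * (p * r\<^sup>2 * d1 * c1)))) (at x)"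
      using DERIV_lommel[OF nu(2) x, of w l] unfolding px W_def p_def[symmetric] c0_def c1_def d0_def d1_def .
    then have "((\<lambda>u. W (u\<^sup>2 / 16)) has_real_derivative ((l - w) * (p * d0 * c0 + w * l * (p * r\<^sup>2 * d1 * c1))) * (r / 2)) (at u)"
      unfolding x_def by (rule DERIV_chain2) (auto intro!: derivative_eq_intros simp: r_def)
    then have dW: "((\<lambda>u. complex_of_real (W (u\<^sup>2 / 16))) has_vector_derivative
        of_real (((l - w) * (p * d0 * c0 + w * l * (p * r\<^sup>2 * d1 * c1))) * (r / 2))) (at u)"
      by (intro has_vector_derivative_of_real) (simp add: has_real_derivative_iff_has_vector_derivative)
    have Wx: "W (u\<^sup>2 / 16) = l * (p * r\<^sup>2 * c1) * d0 - w * (p * r\<^sup>2 * d1) * c0"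
      unfolding W_def lommel_def x_def[symmetric] px c0_def c1_def d0_def d1_def ..
    have phi: "fbm_phi H (u * y) = of_real g * exp (\<i> * of_real (u * y / 2)) *
        (of_real (bessel_clifford (- H) (x * y\<^sup>2)) + \<i> * of_real (r * y * bessel_clifford (- H + 1) (x * y\<^sup>2)))" for y
    proof -
      have "(u * y)\<^sup>2 / 16 = x * y\<^sup>2" "u * y / 4 = r * y" "1 - H = - H + 1"
        by (simp_all add: x_def r_def power_mult_distrib)
      then show ?thesis by (simp only: fbm_phi_clifford[OF H] g_def)
    qed
    have Ex: "E (of_real u) = cnj (exp (\<i> * of_real (u * w / 2))) * exp (\<i> * of_real (u * l / 2))"
      unfolding E_def exp_cnj exp_add[symmetric]
      by (intro arg_cong[of _ _ exp]) (simp add: algebra_simps diff_divide_distrib)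
    have Gu: "G u = E (of_real u) * (of_real g * (of_real d0 - \<i> * of_real (r * w * d1))) *
       (of_real g * (of_real c0 + \<i> * of_real (r * l * c1)))"
      unfolding G_def phi Ex c0_def c1_def d0_def d1_def by (simp add: mult_ac)
    have "(Z has_vector_derivative of_real (2 * q * g\<^sup>2) *
        (E (of_real u) * of_real ((l - w) * (p * d0 * c0 + w * l * (p * r\<^sup>2 * d1 * c1)) * (r / 2)) +
        (\<i> * of_real ((l - w) / 2) * E (of_real u)) * of_real (W (u\<^sup>2 / 16)))) (at u)"
      unfolding Z_def[abs_def] by (intro has_vector_derivative_mult_right has_vector_derivative_mult dE dW)
    then show "(Z has_vector_derivative of_real (l - w) * (u powr (1 - 2 * H) *\<^sub>R G u)) (at u)"
      unfolding Wx lommel_phase_identity pu Gu .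
  qed (use T in simp)
  have "of_real (l - w) * I = Z T - Z 0"
    using has_integral_mult_right[OF HI, of "of_real (l - w)"] FTC has_integral_unique by blast
  also have "Z 0 = 0" by (simp add: Z_def W_def lommel_def)
  finally have "of_real (l - w) * I = Z T" by simp
  then have "of_real (l - w) * fbm_S H T w l = of_real K * Z T"
    unfolding S by (metis mult.left_commute)
  also have "\<dots> = of_real (fbm_kernel_const H) * exp (\<i> * of_real ((l - w) / 2 * T)) * of_real (lommel (- H) w l (T\<^sup>2 / 16))"
    unfolding Z_def E_def W_def fbm_kernel_const_def K_def q_def g_def by (simp add: mult_ac)
  finally show ?thesis .
qed

text \<open>Two evaluations of the Lommel term are compared and l - w is cancelled. The excluded l
  is a single point and hence null for the spectral measure.\<close>

lemma fbm_S_hankel: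
  assumes H: "0 < H" "H < 1" and T: "T > 0" and lw: "l \<noteq> w"
  shows "fbm_S H T w l = exp (\<i> * of_real ((l - w) / 2 * T)) * of_real (fbm_kernel_const H *
    (hankel (- H) (bessel_cutoff (- H) (T\<^sup>2 / 16) w) (l\<^sup>2) +
     w * l * hankel (1 - H) (bessel_cutoff (1 - H) (T\<^sup>2 / 16) w) (l\<^sup>2)))"
proof -
  have "- H + 1 = 1 - H" by simp
  then have L: "lommel (- H) w l (T\<^sup>2 / 16) = (l - w) * (hankel (- H) (bessel_cutoff (- H) (T\<^sup>2 / 16) w) (l\<^sup>2) +
     w * l * hankel (1 - H) (bessel_cutoff (1 - H) (T\<^sup>2 / 16) w) (l\<^sup>2))"
    using lommel_integral[of "- H" "T\<^sup>2 / 16" l w] H T by simp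
  have "of_real (l - w) * fbm_S H T w l = of_real (l - w) * (exp (\<i> * of_real ((l - w) / 2 * T)) * of_real (fbm_kernel_const H *
    (hankel (- H) (bessel_cutoff (- H) (T\<^sup>2 / 16) w) (l\<^sup>2) +
     w * l * hankel (1 - H) (bessel_cutoff (1 - H) (T\<^sup>2 / 16) w) (l\<^sup>2))))"
    unfolding fbm_S_lommel[OF H T] L of_real_mult by (simp only: mult_ac)
  then show ?thesis using lw by (subst (asm) mult_cancel_left) auto
qed

section \<open>The reproducing property for the exponential kernels\<close>

definition even_kernel :: "real \<Rightarrow> real \<Rightarrow> real \<Rightarrow> real \<Rightarrow> real" where
  "even_kernel H T w l = hankel (- H) (bessel_cutoff (- H) (T\<^sup>2 / 16) w) (l\<^sup>2)"

text \<open>The factor \<open>l\<close> makes this odd; in a product of two such functions it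
  supplies the l^2 that raises the order of the weight from -H to 1 - H.\<close>

definition odd_kernel :: "real \<Rightarrow> real \<Rightarrow> real \<Rightarrow> real \<Rightarrow> real" where
  "odd_kernel H T w l = w * (l * hankel (1 - H) (bessel_cutoff (1 - H) (T\<^sup>2 / 16) w) (l\<^sup>2))"

lemma borel_measurable_even_kernel [measurable]: "even_kernel H T w \<in> borel_measurable borel"
  unfolding even_kernel_def[abs_def] by measurable

lemma borel_measurable_odd_kernel [measurable]: "odd_kernel H T w \<in> borel_measurable borel"
  unfolding odd_kernel_def[abs_def] by measurable

lemma even_kernel_minus [simp]: "even_kernel H T w (- l) = even_kernel H T w l"
  and odd_kernel_minus [simp]: "odd_kernel H T w (- l) = - odd_kernel H T w l"
  by (simp_all add: even_kernel_def odd_kernel_def)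

definition sinc_kernel :: "real \<Rightarrow> real \<Rightarrow> real" where
  "sinc_kernel y l = (if l = 0 then y else sin (y * l) / l)"

text \<open>At \<open>l = 0\<close> the convention \<open>x / 0 = 0\<close> gives the limit of the quotient.\<close>

definition cos_kernel :: "real \<Rightarrow> real \<Rightarrow> real \<Rightarrow> real" where
  "cos_kernel a x l = (cos (x * l) - cos (a * l)) / l"

lemma borel_measurable_sinc_kernel [measurable]: "sinc_kernel y \<in> borel_measurable borel"
  unfolding sinc_kernel_def[abs_def] by measurable

lemma borel_measurable_cos_kernel [measurable]: "cos_kernel a x \<in> borel_measurable borel"
  unfolding cos_kernel_def[abs_def] by measurable

lemma sinc_kernel_minus [simp]: "sinc_kernel y (- l) = sinc_kernel y l" "sinc_kernel (- y) l = - sinc_kernel y l"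
  by (simp_all add: sinc_kernel_def)

lemma cos_kernel_minus [simp]: "cos_kernel a x (- l) = - cos_kernel a x l" "cos_kernel a (- x) l = cos_kernel a x l"
  by (simp_all add: cos_kernel_def)

text \<open>Both orders meet in the weight \<open>1 - 2 * H\<close> on the \<lambda>-axis. The
  division by 2 is the Jacobian of \<tau> = \<lambda>^2.\<close>

lemma square_substitution:
  fixes f :: "real \<Rightarrow> real"
  assumes H: "0 < H" "H < 1"
  shows "has_bochner_integral (powr_measure (- H)) f I \<Longrightarrow>
      has_bochner_integral (powr_measure (1 - 2 * H)) (\<lambda>l. f (l\<^sup>2)) (I / 2)"
    and "has_bochner_integral (powr_measure (1 - H)) f I \<Longrightarrow>
      has_bochner_integral (powr_measure (1 - 2 * H)) (\<lambda>l. l\<^sup>2 * f (l\<^sup>2)) (I / 2)"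
proof -
  have e: "2 * - H + 1 = 1 - 2 * H" by simp
  show *: "has_bochner_integral (powr_measure (1 - 2 * H)) (\<lambda>l. f (l\<^sup>2)) (I / 2)"
    if "has_bochner_integral (powr_measure (- H)) f I" for f :: "real \<Rightarrow> real"
    using has_bochner_integral_powr_measure_square[OF _ that] H unfolding e by simp
  show "has_bochner_integral (powr_measure (1 - 2 * H)) (\<lambda>l. l\<^sup>2 * f (l\<^sup>2)) (I / 2)"
    if "has_bochner_integral (powr_measure (1 - H)) f I"
  proof -
    have "- H + 1 = 1 - H" by simp
    then have "has_bochner_integral (powr_measure (- H)) (\<lambda>x. x * f x) I"
      using has_bochner_integral_powr_measure_Suc[of "- H" f I] that by simp
    from *[OF this] show ?thesis .
  qed
qed

lemma even_kernel_square:
  assumes H: "0 < H" "H < 1" and T: "T > 0"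
  shows "has_bochner_integral (powr_measure (1 - 2 * H)) (\<lambda>l. (even_kernel H T w l)\<^sup>2)
    ((\<integral>x. (bessel_cutoff (- H) (T\<^sup>2 / 16) w x)\<^sup>2 \<partial>powr_measure (- H)) / 2)"
proof -
  let ?f = "bessel_cutoff (- H) (T\<^sup>2 / 16) w"
  have "?f \<in> hankel_class (- H)" using H T by (intro bessel_cutoff_hankel_class) auto
  from hankel_isometry[OF _ this] H
  have "has_bochner_integral (powr_measure (- H)) (\<lambda>\<tau>. (hankel (- H) ?f \<tau>)\<^sup>2)
      (\<integral>x. (?f x)\<^sup>2 \<partial>powr_measure (- H))"
    by (simp add: has_bochner_integral_iff)
  from square_substitution(1)[OF H this] show ?thesis by (simp add: even_kernel_def)
qed

lemma odd_kernel_square: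
  assumes H: "0 < H" "H < 1" and T: "T > 0"
  shows "has_bochner_integral (powr_measure (1 - 2 * H)) (\<lambda>l. (odd_kernel H T w l)\<^sup>2)
    (w\<^sup>2 * ((\<integral>x. (bessel_cutoff (1 - H) (T\<^sup>2 / 16) w x)\<^sup>2 \<partial>powr_measure (1 - H)) / 2))"
proof -
  let ?f = "bessel_cutoff (1 - H) (T\<^sup>2 / 16) w"
  have "?f \<in> hankel_class (1 - H)" using H T by (intro bessel_cutoff_hankel_class) auto
  from hankel_isometry[OF _ this] H
  have "has_bochner_integral (powr_measure (1 - H)) (\<lambda>\<tau>. (hankel (1 - H) ?f \<tau>)\<^sup>2)
      (\<integral>x. (?f x)\<^sup>2 \<partial>powr_measure (1 - H))"
    by (simp add: has_bochner_integral_iff)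
  from has_bochner_integral_mult_right[OF square_substitution(2)[OF H this], of "w\<^sup>2"]
  show ?thesis by (simp add: odd_kernel_def power_mult_distrib)
qed

text \<open>Here the band limit enters: for a factor supported below Y <= X the truncation of the
  Bessel function at X is invisible, so the pairing is a full transform.\<close>

lemma power_cutoff_times_bessel_cutoff:
  assumes "Y \<le> X"
  shows "power_cutoff b Y x * bessel_cutoff \<nu> X w x = power_cutoff b Y x * bessel_clifford \<nu> (x * w\<^sup>2)"
  using assms by (auto simp: power_cutoff_def bessel_cutoff_def)

lemma bessel_clifford_zero: "bessel_clifford \<nu> 0 = 1 / Gamma (\<nu> + 1)"
  unfolding bessel_clifford_def powser_zero by (simp add: clifford_coeff_def)

text \<open>The parameter b = H + 1/2 lifts the order -H to 1/2, where the Bessel-Clifford function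
  is a sine, and the cut-off at y^2/4 makes its argument (y l)^2/4.\<close>

lemma hankel_sinc:
  assumes H: "0 < H" "H < 1" and y: "y > 0"
  shows "hankel (- H) (power_cutoff (H + 1 / 2) (y\<^sup>2 / 4)) (l\<^sup>2) = Gamma (H + 1 / 2) / sqrt pi * sinc_kernel y l"
proof -
  have 1: "hankel (- H) (power_cutoff (H + 1 / 2) (y\<^sup>2 / 4)) (l\<^sup>2) =
    Gamma (H + 1 / 2) * (y\<^sup>2 / 4) powr (- H + (H + 1 / 2)) * bessel_clifford (- H + (H + 1 / 2)) (y\<^sup>2 / 4 * l\<^sup>2)"
    using H y by (intro hankel_power_cutoff) auto
  have 2: "- H + (H + 1 / 2) = 1 / 2" by simp
  have 3: "(y\<^sup>2 / 4) powr (1 / 2) = y / 2"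
    using y by (simp add: powr_half_sqrt real_sqrt_divide)
  have 4: "y / 2 * bessel_clifford (1 / 2) (y\<^sup>2 / 4 * l\<^sup>2) = 1 / sqrt pi * sinc_kernel y l"
  proof (cases "l = 0")
    case True
    have "Gamma (1 / 2 + 1 :: real) = 1 / 2 * sqrt pi"
      using Gamma_half_plus_nat[of 1] by (simp add: fact_numeral)
    then show ?thesis using True by (simp add: sinc_kernel_def bessel_clifford_zero)
  next
    case False
    have "y\<^sup>2 / 4 * l\<^sup>2 = (y * l)\<^sup>2 / 4" by (simp add: power_mult_distrib)
    then have "l * (y / 2 * bessel_clifford (1 / 2) (y\<^sup>2 / 4 * l\<^sup>2)) = 1 / sqrt pi * sin (y * l)"
      using bessel_clifford_half[of "y * l"] by (simp add: mult_ac)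
    then show ?thesis using False by (simp add: sinc_kernel_def field_simps)
  qed
  show ?thesis unfolding 1 2 3 mult.assoc 4 by simp
qed

text \<open>The same cut-off function, taken at order 1 - H, leads to the order 3/2. At l = 0 both
  sides are 0 by the convention for division.\<close>

lemma hankel_sin_minus_cos:
  assumes H: "0 < H" "H < 1" and y: "y > 0"
  shows "l * hankel (1 - H) (power_cutoff (H + 1 / 2) (y\<^sup>2 / 4)) (l\<^sup>2) =
    Gamma (H + 1 / 2) / sqrt pi / 2 * (sin (y * l) / l\<^sup>2 - y * cos (y * l) / l)"
proof (cases "l = 0")
  case False
  let ?B = "bessel_clifford (3 / 2) (y\<^sup>2 / 4 * l\<^sup>2)"
  have "hankel (1 - H) (power_cutoff (H + 1 / 2) (y\<^sup>2 / 4)) (l\<^sup>2) =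
    Gamma (H + 1 / 2) * (y\<^sup>2 / 4) powr (1 - H + (H + 1 / 2)) * bessel_clifford (1 - H + (H + 1 / 2)) (y\<^sup>2 / 4 * l\<^sup>2)"
    using H y by (intro hankel_power_cutoff) auto
  moreover have "1 - H + (H + 1 / 2) = 3 / 2" by simp
  moreover have "(y\<^sup>2 / 4) powr (3 / 2) = y ^ 3 / 8"
  proof -
    have "y\<^sup>2 / 4 = (y / 2) powr 2" using y by (simp add: power_divide)
    then have "(y\<^sup>2 / 4) powr (3 / 2) = (y / 2) powr 3" by (simp add: powr_powr)
    then show ?thesis using y by (simp add: power_divide)
  qed
  ultimately have 1: "hankel (1 - H) (power_cutoff (H + 1 / 2) (y\<^sup>2 / 4)) (l\<^sup>2) = Gamma (H + 1 / 2) * (y ^ 3 / 8) * ?B"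
    by simp
  have "y\<^sup>2 / 4 * l\<^sup>2 = (y * l)\<^sup>2 / 4" by (simp add: power_mult_distrib)
  then have 2: "(y * l) ^ 3 / 4 * ?B = (sin (y * l) - y * l * cos (y * l)) / sqrt pi"
    by (simp only: bessel_clifford_three_halves)
  have "l * (Gamma (H + 1 / 2) * (y ^ 3 / 8) * ?B) = Gamma (H + 1 / 2) / 2 * ((y * l) ^ 3 / 4 * ?B) / l\<^sup>2"
    using False by (simp add: power_mult_distrib power2_eq_square power3_eq_cube)
  also have "\<dots> = Gamma (H + 1 / 2) / sqrt pi / 2 * (sin (y * l) / l\<^sup>2 - y * cos (y * l) / l)"
    unfolding 2 using False by (simp add: field_simps power2_eq_square)
  finally show ?thesis unfolding 1 .
qed simp

text \<open>Parseval turns the pairing of the cut-off power with the truncated Bessel function,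
  which is the transform at w^2, into an integral over \<tau> of the product of the
  transforms.\<close>

lemma sinc_even_kernel_pos:
  assumes H: "0 < H" "H < 1" and T: "T > 0" and y: "0 < y" "y \<le> T / 2"
  shows "has_bochner_integral (powr_measure (1 - 2 * H)) (\<lambda>l. sinc_kernel y l * even_kernel H T w l)
     (sinc_kernel y w / 2)"
proof -
  let ?f = "power_cutoff (H + 1 / 2) (y\<^sup>2 / 4)" and ?g = "bessel_cutoff (- H) (T\<^sup>2 / 16) w"
  define b where "b = Gamma (H + 1 / 2) / sqrt pi"
  have b: "b > 0" using H by (auto simp: b_def intro!: divide_pos_pos Gamma_real_pos)
  have f: "?f \<in> hankel_class (- H)" using H y by (intro power_cutoff_hankel_class) auto
  have g: "?g \<in> hankel_class (- H)" using H T by (intro bessel_cutoff_hankel_class) auto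
  have "y\<^sup>2 \<le> (T / 2)\<^sup>2" using y by (intro power_mono) auto
  then have le: "y\<^sup>2 / 4 \<le> T\<^sup>2 / 16" by (simp add: power_divide)
  have "has_bochner_integral (powr_measure (- H)) (\<lambda>\<tau>. hankel (- H) ?f \<tau> * hankel (- H) ?g \<tau>)
     (\<integral>x. ?f x * ?g x \<partial>powr_measure (- H))"
    using H by (intro hankel_Parseval f g) auto
  also have "(\<integral>x. ?f x * ?g x \<partial>powr_measure (- H)) = hankel (- H) ?f (w\<^sup>2)"
    unfolding hankel_def power_cutoff_times_bessel_cutoff[OF le] ..
  finally have "has_bochner_integral (powr_measure (1 - 2 * H))
      (\<lambda>l. hankel (- H) ?f (l\<^sup>2) * hankel (- H) ?g (l\<^sup>2)) (hankel (- H) ?f (w\<^sup>2) / 2)"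
    by (rule square_substitution(1)[OF H])
  then have "has_bochner_integral (powr_measure (1 - 2 * H))
      (\<lambda>l. b * sinc_kernel y l * even_kernel H T w l) (b * sinc_kernel y w / 2)"
    unfolding hankel_sinc[OF H y(1)] even_kernel_def b_def .
  from has_bochner_integral_mult_right[OF this, of "1 / b"] show ?thesis using b by simp
qed

lemma sinc_even_kernel:
  assumes H: "0 < H" "H < 1" and T: "T > 0" and y: "\<bar>y\<bar> \<le> T / 2"
  shows "has_bochner_integral (powr_measure (1 - 2 * H)) (\<lambda>l. sinc_kernel y l * even_kernel H T w l)
     (sinc_kernel y w / 2)"
proof -
  consider "y > 0" | "y = 0" | "- y > 0" by linarith
  then show ?thesis
  proof cases
    case 1
    then show ?thesis using sinc_even_kernel_pos[OF H T] y by simp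
  next
    case 2
    then have "sinc_kernel y l = 0" for l by (simp add: sinc_kernel_def)
    then show ?thesis by (simp add: has_bochner_integral_zero)
  next
    case 3
    then have "has_bochner_integral (powr_measure (1 - 2 * H)) (\<lambda>l. sinc_kernel (- y) l * even_kernel H T w l)
     (sinc_kernel (- y) w / 2)"
      using y by (intro sinc_even_kernel_pos H T) auto
    from has_bochner_integral_minus[OF this] show ?thesis by simp
  qed
qed

lemma sin_minus_cos_odd_kernel:
  assumes H: "0 < H" "H < 1" and T: "T > 0" and y: "0 < y" "y \<le> T / 2"
  shows "has_bochner_integral (powr_measure (1 - 2 * H))
     (\<lambda>l. (sin (y * l) / l\<^sup>2 - y * cos (y * l) / l) * odd_kernel H T w l)
     ((sin (y * w) / w\<^sup>2 - y * cos (y * w) / w) / 2)"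
proof -
  let ?f = "power_cutoff (H + 1 / 2) (y\<^sup>2 / 4)" and ?g = "bessel_cutoff (1 - H) (T\<^sup>2 / 16) w"
  define b where "b = Gamma (H + 1 / 2) / sqrt pi / 2"
  have b: "b > 0" using H by (auto simp: b_def intro!: divide_pos_pos Gamma_real_pos)
  have f: "?f \<in> hankel_class (1 - H)" using H y by (intro power_cutoff_hankel_class) auto
  have g: "?g \<in> hankel_class (1 - H)" using H T by (intro bessel_cutoff_hankel_class) auto
  have "y\<^sup>2 \<le> (T / 2)\<^sup>2" using y by (intro power_mono) auto
  then have le: "y\<^sup>2 / 4 \<le> T\<^sup>2 / 16" by (simp add: power_divide)
  have "has_bochner_integral (powr_measure (1 - H)) (\<lambda>\<tau>. hankel (1 - H) ?f \<tau> * hankel (1 - H) ?g \<tau>)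
     (\<integral>x. ?f x * ?g x \<partial>powr_measure (1 - H))"
    using H by (intro hankel_Parseval f g) auto
  also have "(\<integral>x. ?f x * ?g x \<partial>powr_measure (1 - H)) = hankel (1 - H) ?f (w\<^sup>2)"
    unfolding hankel_def power_cutoff_times_bessel_cutoff[OF le] ..
  finally have "has_bochner_integral (powr_measure (1 - 2 * H))
      (\<lambda>l. l\<^sup>2 * (hankel (1 - H) ?f (l\<^sup>2) * hankel (1 - H) ?g (l\<^sup>2))) (hankel (1 - H) ?f (w\<^sup>2) / 2)"
    by (rule square_substitution(2)[OF H])
  \<comment> \<open>One factor of \<open>l\<^sup>2\<close> goes to each transform. The factor
    \<open>w\<close> completes the odd kernel on the left and makes the value on the right the same
    odd function at w.\<close>
  from has_bochner_integral_mult_right[OF this, of w]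
  have "has_bochner_integral (powr_measure (1 - 2 * H))
      (\<lambda>l. (l * hankel (1 - H) ?f (l\<^sup>2)) * odd_kernel H T w l) ((w * hankel (1 - H) ?f (w\<^sup>2)) / 2)"
    by (simp add: odd_kernel_def power2_eq_square mult_ac)
  then have "has_bochner_integral (powr_measure (1 - 2 * H))
      (\<lambda>l. b * (sin (y * l) / l\<^sup>2 - y * cos (y * l) / l) * odd_kernel H T w l)
      (b * (sin (y * w) / w\<^sup>2 - y * cos (y * w) / w) / 2)"
    unfolding hankel_sin_minus_cos[OF H y(1)] b_def .
  from has_bochner_integral_mult_right[OF this, of "1 / b"] b
  show ?thesis by (simp add: mult.assoc)
qed

text \<open>A common majorant of the sine and cosine kernels on the half-line. Its square is
  integrable for the weight l^(1-2H): near 0 because H < 1, and at infinity, where l^(-1-2H)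
  results, because H > 0.\<close>

definition decay :: "real \<Rightarrow> real \<Rightarrow> real" where
  "decay a l = min a (2 / \<bar>l\<bar>)"

lemma borel_measurable_decay [measurable]: "decay a \<in> borel_measurable borel"
  unfolding decay_def[abs_def] by measurable

lemma decay_square_integrable:
  assumes H: "0 < H" "H < 1" and a: "a > 0"
  shows "integrable (powr_measure (1 - 2 * H)) (\<lambda>l. (decay a l)\<^sup>2)"
proof -
  let ?M = "powr_measure (1 - 2 * H)"
  have 1: "integrable ?M (\<lambda>l. exp (- l))"
    using exp_integral_powr_measure[of "1 - 2 * H" 1] H by (simp add: has_bochner_integral_iff)
  have "((\<lambda>l. l powr (- 1 - 2 * H)) has_integral - (1 powr (- 1 - 2 * H + 1)) / (- 1 - 2 * H + 1)) {1..}"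
    using H by (intro has_integral_powr_to_inf) auto
  then have "((\<lambda>l. if l \<in> {1..} then l powr (- 1 - 2 * H) else 0) has_integral
      - (1 powr (- 1 - 2 * H + 1)) / (- 1 - 2 * H + 1)) {0<..}"
    by (subst has_integral_restrict) auto
  then have "((\<lambda>l. l powr (1 - 2 * H) * (indicator {1..} l * l powr (- 2))) has_integral
      - (1 powr (- 1 - 2 * H + 1)) / (- 1 - 2 * H + 1)) {0<..}"
    by (rule has_integral_eq[rotated]) (auto simp: indicator_def powr_add[symmetric])
  then have "has_bochner_integral ?M (\<lambda>l. indicator {1..} l * l powr (- 2))
     (- (1 powr (- 1 - 2 * H + 1)) / (- 1 - 2 * H + 1))"
    by (intro has_bochner_integral_powr_measureI) auto
  then have 2: "integrable ?M (\<lambda>l. indicator {1..} l * l powr (- 2))"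
    by (simp add: has_bochner_integral_iff)
  show ?thesis
  proof (rule Bochner_Integration.integrable_bound)
    show "integrable ?M (\<lambda>l. a\<^sup>2 * exp 1 * exp (- l) + 4 * (indicator {1..} l * l powr (- 2)))"
      using 1 2 by simp
    show "AE l in ?M. norm ((decay a l)\<^sup>2) \<le> norm (a\<^sup>2 * exp 1 * exp (- l) + 4 * (indicator {1..} l * l powr (- 2)))"
      using AE_powr_measure_pos
    proof eventually_elim
      case (elim l)
      have d: "0 \<le> decay a l" "decay a l \<le> a" "decay a l \<le> 2 / l"
        using a elim by (auto simp: decay_def)
      show ?case
      proof (cases "l < 1")
        case True
        have "(decay a l)\<^sup>2 \<le> a\<^sup>2 * 1" using d by (simp add: power_mono)
        also have "\<dots> \<le> a\<^sup>2 * (exp 1 * exp (- l))"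
          using True by (intro mult_left_mono) (auto simp flip: exp_add)
        finally show ?thesis using True by (simp add: mult.assoc)
      next
        case False
        have "(decay a l)\<^sup>2 \<le> (2 / l)\<^sup>2" using d by (intro power_mono) auto
        also have "\<dots> = 4 * l powr (- 2)" using elim by (simp add: power_divide powr_minus divide_inverse power_inverse)
        also have "\<dots> \<le> a\<^sup>2 * exp 1 * exp (- l) + 4 * (indicator {1..} l * l powr (- 2))"
          using False by simp
        finally show ?thesis using False by simp
      qed
    qed
  qed measurable
qed

lemma sinc_kernel_le_decay:
  assumes "\<bar>y\<bar> \<le> a" "l > 0"
  shows "\<bar>sinc_kernel y l\<bar> \<le> decay a l"
proof -
  have "\<bar>sin (y * l)\<bar> \<le> \<bar>y * l\<bar>" by (rule abs_sin_x_le_abs_x)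
  also have "\<dots> \<le> a * l" using assms by (simp add: abs_mult)
  finally have "\<bar>sin (y * l)\<bar> \<le> a * l" .
  moreover have "\<bar>sin (y * l)\<bar> \<le> 2" using abs_sin_le_one[of "y * l"] by linarith
  ultimately show ?thesis
    using assms(2) by (simp add: sinc_kernel_def decay_def divide_simps)
qed

lemma cos_kernel_le_decay:
  assumes "0 \<le> x" "x \<le> a" "l > 0"
  shows "\<bar>cos_kernel a x l\<bar> \<le> decay a l"
proof -
  have "\<bar>cos (x * l) - cos (a * l)\<bar> \<le> \<bar>x * l - a * l\<bar>"
  proof -
    have "cos (x * l) - cos (a * l) = 2 * sin ((x * l + a * l) / 2) * sin ((a * l - x * l) / 2)"
      by (rule cos_diff_cos)
    then have "\<bar>cos (x * l) - cos (a * l)\<bar> = 2 * \<bar>sin ((x * l + a * l) / 2)\<bar> * \<bar>sin ((a * l - x * l) / 2)\<bar>"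
      by (simp add: abs_mult)
    also have "\<dots> \<le> 2 * 1 * \<bar>(a * l - x * l) / 2\<bar>"
      by (intro mult_mono abs_sin_x_le_abs_x abs_sin_le_one) auto
    finally show ?thesis by simp
  qed
  also have "\<dots> = (a - x) * l" using assms by (simp add: algebra_simps mult_right_mono)
  also have "\<dots> \<le> a * l" using assms by (intro mult_right_mono) auto
  finally have "\<bar>cos (x * l) - cos (a * l)\<bar> \<le> a * l" .
  moreover have "\<bar>cos (x * l) - cos (a * l)\<bar> \<le> 2"
    using abs_cos_le_one[of "x * l"] abs_cos_le_one[of "a * l"] by linarith
  ultimately show ?thesis
    using assms(3) by (simp add: cos_kernel_def decay_def divide_simps)
qed

lemma decay_nonneg: "a \<ge> 0 \<Longrightarrow> decay a l \<ge> 0"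
  by (simp add: decay_def)

lemma integrable_mult_L2:
  fixes f g :: "'a \<Rightarrow> real"
  assumes "f \<in> borel_measurable M" "g \<in> borel_measurable M"
    and "integrable M (\<lambda>x. (f x)\<^sup>2)" "integrable M (\<lambda>x. (g x)\<^sup>2)"
  shows "integrable M (\<lambda>x. f x * g x)"
  using L2_Cauchy_Schwarz(1)[of f M g] assms by simp

lemma integrable_decay_mult:
  fixes f g :: "real \<Rightarrow> real"
  assumes H: "0 < H" "H < 1" and a: "a > 0"
    and [measurable]: "f \<in> borel_measurable borel" "g \<in> borel_measurable borel"
    and f: "\<And>l. l > 0 \<Longrightarrow> \<bar>f l\<bar> \<le> decay a l"
    and g: "integrable (powr_measure (1 - 2 * H)) (\<lambda>l. (g l)\<^sup>2)"
  shows "integrable (powr_measure (1 - 2 * H)) (\<lambda>l. f l * g l)"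
proof (rule integrable_mult_L2)
  show "integrable (powr_measure (1 - 2 * H)) (\<lambda>l. (f l)\<^sup>2)"
  proof (rule Bochner_Integration.integrable_bound[OF decay_square_integrable[OF H a]])
    show "AE l in powr_measure (1 - 2 * H). norm ((f l)\<^sup>2) \<le> norm ((decay a l)\<^sup>2)"
      using AE_powr_measure_pos
    proof eventually_elim
      case (elim l)
      have "\<bar>f l\<bar>\<^sup>2 \<le> (decay a l)\<^sup>2" using f[OF elim] by (intro power_mono) auto
      then show ?case by simp
    qed
  qed measurable
qed (use g in auto)

text \<open>The function \<open>cos_kernel a y\<close> is not itself one of the transforms \<open>R\<close> computed above, but
  \<open>R = V - y cos_kernel a y\<close>, where \<open>V\<close> is its primitive in \<open>y\<close>.  Hence the defect \<open>D\<close> of the claim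
  satisfies \<open>\<integral>\<^sub>0\<^sup>y D = y D(y)\<close>, so it is constant, and it vanishes at \<open>y = a\<close>.\<close>

lemma cos_odd_kernel_nonneg:
  assumes H: "0 < H" "H < 1" and T: "T > 0" and x: "0 \<le> x" "x \<le> T / 2"
  shows "has_bochner_integral (powr_measure (1 - 2 * H)) (\<lambda>l. cos_kernel (T / 2) x l * odd_kernel H T w l)
     (cos_kernel (T / 2) x w / 2)"
proof -
  let ?M = "powr_measure (1 - 2 * H)"
  define a where "a = T / 2"
  define F where "F = odd_kernel H T w"
  have a: "a > 0" using T by (simp add: a_def)
  have [measurable]: "F \<in> borel_measurable borel" by (simp add: F_def)
  have F2: "integrable ?M (\<lambda>l. (F l)\<^sup>2)"
    using odd_kernel_square[OF H T, of w] by (simp add: has_bochner_integral_iff F_def)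
  \<comment> \<open>A single dominating function for all limits in \<open>y\<close> below, both for
    continuity and for differentiation under the integral.\<close>
  have dom: "integrable ?M (\<lambda>l. decay a l * F l)"
    by (rule integrable_decay_mult[OF H a _ _ _ F2]) (use a in \<open>auto simp: decay_nonneg\<close>)
  have Q_int: "integrable ?M (\<lambda>l. cos_kernel a x l * F l)" if "0 \<le> x" "x \<le> a" for x
    by (rule integrable_decay_mult[OF H a _ _ _ F2]) (use that cos_kernel_le_decay in auto)
  define V where "V y l = (sin (y * l) / l - y * cos (a * l)) / l" for y l :: real
  define R where "R y l = sin (y * l) / l\<^sup>2 - y * cos (y * l) / l" for y l :: real
  have VR: "V y l = R y l + y * cos_kernel a y l" for y l
    by (cases "l = 0") (auto simp: V_def R_def cos_kernel_def field_simps power2_eq_square)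
  have V_deriv: "((\<lambda>y. V y l) has_real_derivative cos_kernel a y l) (at y within S)" for y l S
  proof (cases "l = 0")
    case False
    then show ?thesis
      unfolding V_def cos_kernel_def by (auto intro!: derivative_eq_intros simp: divide_simps left_diff_distrib)
  qed (simp add: V_def cos_kernel_def)
  have [measurable]: "V y \<in> borel_measurable borel" for y
    unfolding V_def[abs_def] by measurable
  define J where "J y = (\<integral>l. cos_kernel a y l * F l \<partial>?M)" for y
  define U where "U y = (\<integral>l. V y l * F l \<partial>?M)" for y
  have RF: "has_bochner_integral ?M (\<lambda>l. R y l * F l) (R y w / 2)" if "0 < y" "y \<le> a" for y
    unfolding R_def F_def by (rule sin_minus_cos_odd_kernel[OF H T]) (use that in \<open>simp_all add: a_def\<close>)
  have V_int: "integrable ?M (\<lambda>l. V y l * F l)" "U y = R y w / 2 + y * J y" if "0 < y" "y \<le> a" for y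
  proof -
    have "has_bochner_integral ?M (\<lambda>l. R y l * F l + y * (cos_kernel a y l * F l)) (R y w / 2 + y * J y)"
      unfolding J_def using that
      by (intro has_bochner_integral_add RF has_bochner_integral_mult_right has_bochner_integral_integrable Q_int) auto
    moreover have "R y l * F l + y * (cos_kernel a y l * F l) = V y l * F l" for l
      unfolding VR by (simp add: distrib_right)
    ultimately show "integrable ?M (\<lambda>l. V y l * F l)" "U y = R y w / 2 + y * J y"
      by (auto simp: has_bochner_integral_iff U_def)
  qed
  have dom_bound: "AE l in ?M. norm (f l * F l) \<le> norm (decay a l * F l)"
    if "\<And>l. l > 0 \<Longrightarrow> \<bar>f l\<bar> \<le> decay a l" for f
    using AE_powr_measure_pos
  proof eventually_elim
    case (elim l)
    have "decay a l \<ge> 0" using a by (simp add: decay_nonneg)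
    then show ?case using that[OF elim] by (simp add: abs_mult mult_right_mono)
  qed
  have Q_lim: "(\<lambda>n. cos_kernel a (X n) l) \<longlonglongrightarrow> cos_kernel a y l" if "X \<longlonglongrightarrow> y" for X y l
    unfolding cos_kernel_def divide_inverse by (intro tendsto_intros that)
  have J_lim: "(\<lambda>n. J (X n)) \<longlonglongrightarrow> J y" if X: "\<And>n. X n \<in> {0..a}" "X \<longlonglongrightarrow> y" for X y
    unfolding J_def
  proof (rule integral_dominated_convergence[OF _ _ integrable_norm[OF dom]])
    show "AE l in ?M. (\<lambda>n. cos_kernel a (X n) l * F l) \<longlonglongrightarrow> cos_kernel a y l * F l"
      by (intro AE_I2 tendsto_intros Q_lim X)
    show "AE l in ?M. norm (cos_kernel a (X n) l * F l) \<le> norm (decay a l * F l)" for n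
      using X(1)[of n] by (intro dom_bound cos_kernel_le_decay) auto
  qed measurable
  have U_deriv: "(U has_real_derivative J y) (at y within {0<..<a})" if y: "y \<in> {0<..<a}" for y
    unfolding has_field_derivative_iff tendsto_at_iff_sequentially comp_def
  proof (intro allI impI)
    fix X assume X: "\<forall>i. X i \<in> {0<..<a} - {y}" and lim: "X \<longlonglongrightarrow> y"
    define q where "q n l = (V (X n) l - V y l) / (X n - y)" for n l
    have [measurable]: "q n \<in> borel_measurable borel" for n unfolding q_def[abs_def] by measurable
    have Xn: "X n \<in> {0<..<a}" "X n \<noteq> y" for n using X by auto
    have eq: "(U (X n) - U y) / (X n - y) = (\<integral>l. q n l * F l \<partial>?M)" for n
    proof -
      have "(\<integral>l. q n l * F l \<partial>?M) = (\<integral>l. inverse (X n - y) * (V (X n) l * F l - V y l * F l) \<partial>?M)"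
        by (simp add: q_def divide_inverse algebra_simps)
      also have "\<dots> = inverse (X n - y) * (U (X n) - U y)"
        unfolding U_def using V_int(1)[of "X n"] V_int(1)[of y] Xn(1)[of n] y by simp
      finally show ?thesis by (simp add: divide_inverse mult.commute)
    qed
    show "(\<lambda>n. (U (X n) - U y) / (X n - y)) \<longlonglongrightarrow> J y"
      unfolding eq J_def
    proof (rule integral_dominated_convergence[OF _ _ integrable_norm[OF dom]])
      show "AE l in ?M. (\<lambda>n. q n l * F l) \<longlonglongrightarrow> cos_kernel a y l * F l"
      proof (intro AE_I2 tendsto_intros)
        fix l
        have "((\<lambda>z. (V z l - V y l) / (z - y)) \<longlongrightarrow> cos_kernel a y l) (at y)"
          using V_deriv[of l y UNIV] by (simp add: has_field_derivative_iff)
        then have "((\<lambda>z. (V z l - V y l) / (z - y)) \<circ> X) \<longlonglongrightarrow> cos_kernel a y l"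
          using lim Xn(2) unfolding tendsto_at_iff_sequentially by blast
        then show "(\<lambda>n. q n l) \<longlonglongrightarrow> cos_kernel a y l" by (simp add: q_def comp_def)
      qed
      show "AE l in ?M. norm (q n l * F l) \<le> norm (decay a l * F l)" for n
      proof (intro dom_bound)
        fix l :: real assume l: "l > 0"
        \<comment> \<open>The mean value inequality in \<open>y\<close> dominates the difference
          quotients by the bound for the derivative, independently of \<open>n\<close>.\<close>
        have "norm (V (X n) l - V y l) \<le> decay a l * norm (X n - y)"
        proof (rule field_differentiable_bound[of "{0<..<a}" "\<lambda>y. V y l" "\<lambda>y. cos_kernel a y l"])
          show "norm (cos_kernel a z l) \<le> decay a l" if "z \<in> {0<..<a}" for z
            using cos_kernel_le_decay[of z a l] that l by simp
        qed (use V_deriv Xn(1) y in auto)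
        then show "\<bar>q n l\<bar> \<le> decay a l"
          using Xn(2)[of n] by (simp add: q_def divide_simps)
      qed
    qed measurable
  qed
  define D where "D y = J y - cos_kernel a y w / 2" for y
  have Dc: "continuous_on {0..a} D"
  proof (rule continuous_on_sequentiallyI)
    fix X y assume X: "\<forall>n. X n \<in> {0..a}" and lim: "X \<longlonglongrightarrow> y"
    show "(\<lambda>n. D (X n)) \<longlonglongrightarrow> D y"
      unfolding D_def using X lim by (intro tendsto_diff tendsto_divide J_lim Q_lim tendsto_const) auto
  qed
  \<comment> \<open>The part \<open>R\<close> drops out, since its integral is already known to be
    half its value at \<open>w\<close>.\<close>
  have u: "U y - V y w / 2 = y * D y" if "0 < y" "y \<le> a" for y
    unfolding V_int(2)[OF that] VR D_def by (simp add: algebra_simps)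
  \<comment> \<open>\<open>D\<close> is not known to be differentiable in advance. It is written as
    a quotient of differentiable functions, and the numerator of the quotient rule is D y * y - y *
    D y = 0.\<close>
  have "(D has_real_derivative 0) (at y within {0<..<a})" if y: "y \<in> {0<..<a}" for y
  proof -
    have "((\<lambda>y. (U y - V y w / 2) / y) has_real_derivative
      ((J y - cos_kernel a y w / 2) * y - (U y - V y w / 2) * 1) / (y * y)) (at y within {0<..<a})"
      using y by (intro DERIV_divide DERIV_diff DERIV_cdivide V_deriv U_deriv DERIV_ident) auto
    moreover have "((J y - cos_kernel a y w / 2) * y - (U y - V y w / 2) * 1) / (y * y) = 0"
      using u[of y] y by (simp add: D_def)
    ultimately have "((\<lambda>y. (U y - V y w / 2) / y) has_real_derivative 0) (at y within {0<..<a})"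
      by (rule DERIV_cong)
    then show ?thesis
    proof (rule has_field_derivative_transform_within[where d = 1])
      show "(U z - V z w / 2) / z = D z" if "z \<in> {0<..<a}" for z
        using u[of z] that by simp
    qed (use y in auto)
  qed
  then obtain c where c: "\<And>y. y \<in> {0<..<a} \<Longrightarrow> D y = c"
    using has_field_derivative_zero_constant[of "{0<..<a}" D] by auto
  have closure: "closure {0<..<a} = {0..a}" using a by (simp add: closure_greaterThanLessThan)
  \<comment> \<open>Continuity carries the constant to the endpoint \<open>a\<close>, where the
    cosine kernel vanishes identically and thereby determines it.\<close>
  have Dconst: "D y = c" if "y \<in> {0..a}" for y
    by (rule continuous_constant_on_closure[of "{0<..<a}" D]) (use Dc c that closure in auto)
  have "D a = 0" by (simp add: D_def J_def cos_kernel_def)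
  then have "D x = 0" using Dconst[of a] Dconst[of x] x a by (simp add: a_def)
  then have "J x = cos_kernel a x w / 2" by (simp add: D_def)
  then show ?thesis
    using Q_int[of x] x by (simp add: has_bochner_integral_iff J_def F_def a_def)
qed

lemma cos_odd_kernel:
  assumes H: "0 < H" "H < 1" and T: "T > 0" and x: "\<bar>x\<bar> \<le> T / 2"
  shows "has_bochner_integral (powr_measure (1 - 2 * H)) (\<lambda>l. cos_kernel (T / 2) x l * odd_kernel H T w l)
     (cos_kernel (T / 2) x w / 2)"
  using cos_odd_kernel_nonneg[OF H T, of x w] cos_odd_kernel_nonneg[OF H T, of "- x" w] x
  by (cases "x \<ge> 0") auto

text \<open>e_t is the integral of exp(i u l) over u in [0, t]. With u = a + v the phase comes out
  and v runs over [-a, t - a]; the cosine part integrates to the two sinc terms, the sine part to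
  the cosine difference.\<close>

lemma exp_kernel_decomposition:
  "exp_kernel t l = exp (\<i> * of_real (a * l)) *
     (of_real (sinc_kernel (t - a) l + sinc_kernel a l) - \<i> * of_real (cos_kernel a (t - a) l))"
proof (cases "l = 0")
  case False
  have e: "exp (\<i> * of_real z) = of_real (cos z) + \<i> * of_real (sin z)" for z
    using cis_conv_exp[of z] by (simp add: cis.ctr complex_eq_iff)
  have 1: "exp (\<i> * complex_of_real l * of_real t) =
      exp (\<i> * of_real (a * l)) * exp (\<i> * of_real ((t - a) * l))"
    unfolding exp_add[symmetric] by (simp add: algebra_simps)
  have 2: "1 = exp (\<i> * of_real (a * l)) * exp (\<i> * of_real (- (a * l)))"
    unfolding exp_add[symmetric] by simp
  have "exp (\<i> * complex_of_real l * of_real t) - 1 =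
     exp (\<i> * of_real (a * l)) * (exp (\<i> * of_real ((t - a) * l)) - exp (\<i> * of_real (- (a * l))))"
    unfolding 1 by (subst 2) (simp only: right_diff_distrib)
  then have "exp_kernel t l = exp (\<i> * of_real (a * l)) *
     ((exp (\<i> * of_real ((t - a) * l)) - exp (\<i> * of_real (- (a * l)))) / (\<i> * of_real l))"
    using False by (simp add: exp_kernel_def)
  also have "(exp (\<i> * of_real ((t - a) * l)) - exp (\<i> * of_real (- (a * l)))) / (\<i> * of_real l) =
     of_real (sinc_kernel (t - a) l + sinc_kernel a l) - \<i> * of_real (cos_kernel a (t - a) l)"
    unfolding e using False
    by (simp add: complex_eq_iff Re_divide Im_divide sinc_kernel_def cos_kernel_def field_simps power2_eq_square)
  finally show ?thesis .
qed (simp add: exp_kernel_def sinc_kernel_def cos_kernel_def)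

text \<open>A replacement for \<open>fbm_S\<close> off the diagonal l = w. It shows the parity in l
  and the measurability that the integral hides, so the reproducing property is proved for it and
  transferred at the end.\<close>

definition fbm_kernel :: "real \<Rightarrow> real \<Rightarrow> real \<Rightarrow> real \<Rightarrow> complex" where
  "fbm_kernel H T w l = exp (\<i> * of_real ((l - w) / 2 * T)) *
     of_real (fbm_kernel_const H * (even_kernel H T w l + odd_kernel H T w l))"

lemma fbm_S_eq_kernel:
  assumes "0 < H" "H < 1" "T > 0" "l \<noteq> w"
  shows "fbm_S H T w l = fbm_kernel H T w l"
  unfolding fbm_S_hankel[OF assms] fbm_kernel_def even_kernel_def odd_kernel_def by (simp add: mult.assoc)

lemma borel_measurable_fbm_kernel [measurable]: "fbm_kernel H T w \<in> borel_measurable borel"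
  unfolding fbm_kernel_def[abs_def] by measurable

lemma borel_measurable_exp_kernel [measurable]: "exp_kernel t \<in> borel_measurable borel"
  unfolding exp_kernel_def[abs_def] by measurable

lemma borel_measurable_cnj_comp [measurable]:
  assumes [measurable]: "f \<in> borel_measurable M"
  shows "(\<lambda>x. cnj (f x)) \<in> borel_measurable M"
proof -
  have [measurable]: "cnj \<in> borel_measurable borel"
    by (intro borel_measurable_continuous_onI continuous_intros)
  show ?thesis by measurable
qed

text \<open>The phase of e_t and the conjugate phase of the kernel multiply to the constant exp(i a
  w), since a = T/2. What remains is a product of sums of even and odd functions, whose even part is
  given by the sine and cosine formulas above.\<close>

lemma exp_kernel_reproducing:
  assumes H: "0 < H" "H < 1" and T: "T > 0" and t: "0 \<le> t" "t \<le> T"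
  shows "has_bochner_integral (fbm_spectral_measure H) (\<lambda>l. exp_kernel t l * cnj (fbm_kernel H T w l)) (exp_kernel t w)"
proof -
  let ?M = "powr_measure (1 - 2 * H)"
  define a where "a = T / 2"
  define y where "y = t - a"
  have a: "a > 0" and y: "\<bar>y\<bar> \<le> a" using T t unfolding a_def y_def by linarith+
  define K1 K2 where "K1 = even_kernel H T w" and "K2 = odd_kernel H T w"
  define P Q where "P l = sinc_kernel y l + sinc_kernel a l" and "Q l = cos_kernel a y l" for l
  define c where "c = exp (\<i> * of_real (a * w)) * of_real (fbm_kernel_const H)"
  define F where "F l = exp_kernel t l * cnj (fbm_kernel H T w l)" for l
  have [measurable]: "K1 \<in> borel_measurable borel" "K2 \<in> borel_measurable borel"
    "P \<in> borel_measurable borel" "Q \<in> borel_measurable borel" "F \<in> borel_measurable borel"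
    unfolding K1_def K2_def P_def[abs_def] Q_def[abs_def] F_def[abs_def] by measurable
  have K1i: "integrable ?M (\<lambda>l. (K1 l)\<^sup>2)" and K2i: "integrable ?M (\<lambda>l. (K2 l)\<^sup>2)"
    using even_kernel_square[OF H T, of w] odd_kernel_square[OF H T, of w]
    by (simp_all add: has_bochner_integral_iff K1_def K2_def)
  have A: "has_bochner_integral ?M (\<lambda>l. P l * K1 l) (P w / 2)"
    using has_bochner_integral_add[OF sinc_even_kernel[OF H T, of y w] sinc_even_kernel[OF H T, of a w]] y a
    by (simp add: P_def K1_def a_def distrib_right add_divide_distrib)
  have B: "has_bochner_integral ?M (\<lambda>l. Q l * K2 l) (Q w / 2)"
    using cos_odd_kernel[OF H T, of y w] y by (simp add: Q_def K2_def a_def)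
  \<comment> \<open>The mixed products are odd. Their half-line integrals \<open>X\<close> and
    \<open>Y\<close> enter \<open>F1\<close> and \<open>F2\<close> with opposite signs, so existence
    is enough.\<close>
  have "integrable ?M (\<lambda>l. sinc_kernel y l * K2 l + sinc_kernel a l * K2 l)"
    by (intro Bochner_Integration.integrable_add integrable_decay_mult[OF H a _ _ _ K2i] sinc_kernel_le_decay)
       (use y a in auto)
  then have "integrable ?M (\<lambda>l. P l * K2 l)" by (simp add: P_def distrib_right)
  then obtain X where X: "has_bochner_integral ?M (\<lambda>l. P l * K2 l) X"
    by (auto simp: integrable.simps)
  have "integrable ?M (\<lambda>l. Q l * K1 l)"
  proof (rule integrable_decay_mult[OF H a _ _ _ K1i])
    show "\<bar>Q l\<bar> \<le> decay a l" if "l > 0" for l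
    proof -
      have "cos_kernel a y l = cos_kernel a \<bar>y\<bar> l" by (cases "y \<ge> 0") auto
      then show ?thesis using cos_kernel_le_decay[of "\<bar>y\<bar>" a l] y that by (simp add: Q_def)
    qed
  qed measurable
  then obtain Y where Y: "has_bochner_integral ?M (\<lambda>l. Q l * K1 l) Y"
    by (auto simp: integrable.simps)
  have F: "F l = c * ((of_real (P l) - \<i> * of_real (Q l)) * of_real (K1 l + K2 l))" for l
  proof -
    have "exp (\<i> * of_real (a * l)) * cnj (exp (\<i> * of_real ((l - w) / 2 * T))) = exp (\<i> * of_real (a * w))"
      unfolding exp_cnj exp_add[symmetric]
      by (intro arg_cong[of _ _ exp]) (simp add: a_def algebra_simps diff_divide_distrib)
    moreover have "E1 * Z * cnj (E2 * of_real (k * S)) = (E1 * cnj E2) * of_real k * (Z * of_real S)"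
      for E1 E2 Z :: complex and k S :: real
      by simp
    ultimately show ?thesis
      unfolding F_def exp_kernel_decomposition[of t l a] fbm_kernel_def c_def P_def Q_def K1_def K2_def y_def
      by (simp only:)
  qed
  have minus: "P (- l) = P l" "Q (- l) = - Q l" "K1 (- l) = K1 l" "K2 (- l) = - K2 l" for l
    by (simp_all add: P_def Q_def K1_def K2_def)
  have F1: "has_bochner_integral ?M F (c * (of_real (P w / 2) + of_real X - \<i> * of_real Y - \<i> * of_real (Q w / 2)))"
  proof -
    have "F l = c * (of_real (P l * K1 l) + of_real (P l * K2 l) - \<i> * of_real (Q l * K1 l) - \<i> * of_real (Q l * K2 l))" for l
      unfolding F by (simp add: algebra_simps)
    moreover have "has_bochner_integral ?M
        (\<lambda>l. c * (of_real (P l * K1 l) + of_real (P l * K2 l) - \<i> * of_real (Q l * K1 l) - \<i> * of_real (Q l * K2 l)))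
        (c * (of_real (P w / 2) + of_real X - \<i> * of_real Y - \<i> * of_real (Q w / 2)))"
      by (intro has_bochner_integral_mult_right has_bochner_integral_add has_bochner_integral_diff
           has_bochner_integral_of_real A B X Y)
    ultimately show ?thesis by presburger
  qed
  have F2: "has_bochner_integral ?M (\<lambda>l. F (- l)) (c * (of_real (P w / 2) - of_real X + \<i> * of_real Y - \<i> * of_real (Q w / 2)))"
  proof -
    have "F (- l) = c * (of_real (P l * K1 l) - of_real (P l * K2 l) + \<i> * of_real (Q l * K1 l) - \<i> * of_real (Q l * K2 l))" for l
      unfolding F minus by (simp add: algebra_simps)
    moreover have "has_bochner_integral ?M
        (\<lambda>l. c * (of_real (P l * K1 l) - of_real (P l * K2 l) + \<i> * of_real (Q l * K1 l) - \<i> * of_real (Q l * K2 l)))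
        (c * (of_real (P w / 2) - of_real X + \<i> * of_real Y - \<i> * of_real (Q w / 2)))"
      by (intro has_bochner_integral_mult_right has_bochner_integral_add has_bochner_integral_diff
           has_bochner_integral_of_real A B X Y)
    ultimately show ?thesis by presburger
  qed
  have "has_bochner_integral (fbm_spectral_measure H) F (fbm_const H *\<^sub>R
    (c * (of_real (P w / 2) + of_real X - \<i> * of_real Y - \<i> * of_real (Q w / 2)) +
     c * (of_real (P w / 2) - of_real X + \<i> * of_real Y - \<i> * of_real (Q w / 2))))"
    by (rule fbm_spectral_measure_fold[OF H _ F1 F2]) measurable
  also have "fbm_const H *\<^sub>R
    (c * (of_real (P w / 2) + of_real X - \<i> * of_real Y - \<i> * of_real (Q w / 2)) +
     c * (of_real (P w / 2) - of_real X + \<i> * of_real Y - \<i> * of_real (Q w / 2))) =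
     of_real (fbm_const H) * (c * (of_real (P w) - \<i> * of_real (Q w)))"
    by (simp add: scaleR_conv_of_real algebra_simps)
  also have "\<dots> = of_real (fbm_const H * fbm_kernel_const H) * (exp (\<i> * of_real (a * w)) * (of_real (P w) - \<i> * of_real (Q w)))"
    by (simp add: c_def mult_ac)
  also have "\<dots> = exp_kernel t w"
    unfolding fbm_const_mult_kernel_const[OF H] exp_kernel_decomposition[of t w a] P_def Q_def y_def by simp
  finally show ?thesis by (simp add: F_def[abs_def])
qed

section \<open>Passage to the closure\<close>

text \<open>The phase has modulus 1 and the mixed term is odd, so the two isometries give the norm.
  One of the two factors \<open>fbm_kernel_const H\<close> is absorbed by the constant of the
  spectral density.\<close>

lemma fbm_kernel_square:
  assumes H: "0 < H" "H < 1" and T: "T > 0"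
  shows "integrable (fbm_spectral_measure H) (\<lambda>l. (norm (fbm_kernel H T w l))\<^sup>2)"
    and "(\<integral>l. (norm (fbm_kernel H T w l))\<^sup>2 \<partial>fbm_spectral_measure H) =
      fbm_kernel_const H * ((\<integral>x. (bessel_cutoff (- H) (T\<^sup>2 / 16) w x)\<^sup>2 \<partial>powr_measure (- H)) +
        w\<^sup>2 * (\<integral>x. (bessel_cutoff (1 - H) (T\<^sup>2 / 16) w x)\<^sup>2 \<partial>powr_measure (1 - H)))"
proof -
  let ?M = "powr_measure (1 - 2 * H)"
  define K1 K2 where "K1 = even_kernel H T w" and "K2 = odd_kernel H T w"
  define k where "k = fbm_kernel_const H"
  define A where "A = (\<integral>x. (bessel_cutoff (- H) (T\<^sup>2 / 16) w x)\<^sup>2 \<partial>powr_measure (- H))"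
  define B where "B = w\<^sup>2 * (\<integral>x. (bessel_cutoff (1 - H) (T\<^sup>2 / 16) w x)\<^sup>2 \<partial>powr_measure (1 - H))"
  have [measurable]: "K1 \<in> borel_measurable borel" "K2 \<in> borel_measurable borel"
    unfolding K1_def K2_def by measurable
  have K1: "has_bochner_integral ?M (\<lambda>l. (K1 l)\<^sup>2) (A / 2)"
    using even_kernel_square[OF H T, of w] by (simp add: K1_def A_def)
  have K2: "has_bochner_integral ?M (\<lambda>l. (K2 l)\<^sup>2) (B / 2)"
    using odd_kernel_square[OF H T, of w] by (simp add: K2_def B_def)
  obtain X where X: "has_bochner_integral ?M (\<lambda>l. K1 l * K2 l) X"
    using integrable_mult_L2[of K1 ?M K2] K1 K2 by (auto simp: integrable.simps)
  have sq: "(norm (fbm_kernel H T w l))\<^sup>2 = k\<^sup>2 * (K1 l + K2 l)\<^sup>2" for l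
    by (simp add: fbm_kernel_def K1_def K2_def k_def norm_mult power_mult_distrib flip: of_real_mult)
  define F where "F l = complex_of_real (k\<^sup>2 * (K1 l + K2 l)\<^sup>2)" for l
  have F1: "has_bochner_integral ?M F (of_real (k\<^sup>2 * (A / 2 + B / 2 + 2 * X)))"
    unfolding F_def power2_sum mult.assoc
    by (intro has_bochner_integral_of_real has_bochner_integral_mult_right has_bochner_integral_add K1 K2 X)
  have F2: "has_bochner_integral ?M (\<lambda>l. F (- l)) (of_real (k\<^sup>2 * (A / 2 + B / 2 - 2 * X)))"
  proof -
    have "F (- l) = of_real (k\<^sup>2 * ((K1 l)\<^sup>2 + (K2 l)\<^sup>2 - 2 * (K1 l * K2 l)))" for l
      by (simp add: F_def K1_def K2_def power2_diff)
    moreover have "has_bochner_integral ?M (\<lambda>l. complex_of_real (k\<^sup>2 * ((K1 l)\<^sup>2 + (K2 l)\<^sup>2 - 2 * (K1 l * K2 l))))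
       (of_real (k\<^sup>2 * (A / 2 + B / 2 - 2 * X)))"
      by (intro has_bochner_integral_of_real has_bochner_integral_mult_right has_bochner_integral_add
          has_bochner_integral_diff K1 K2 X)
    ultimately show ?thesis by presburger
  qed
  have [measurable]: "F \<in> borel_measurable borel" unfolding F_def[abs_def] by measurable
  have "has_bochner_integral (fbm_spectral_measure H) F
     (fbm_const H *\<^sub>R (of_real (k\<^sup>2 * (A / 2 + B / 2 + 2 * X)) + of_real (k\<^sup>2 * (A / 2 + B / 2 - 2 * X))))"
    by (rule fbm_spectral_measure_fold[OF H _ F1 F2]) measurable
  also have "fbm_const H *\<^sub>R (of_real (k\<^sup>2 * (A / 2 + B / 2 + 2 * X)) + of_real (k\<^sup>2 * (A / 2 + B / 2 - 2 * X))) =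
     complex_of_real (fbm_const H * (k\<^sup>2 * (A + B)))"
    by (simp add: scaleR_conv_of_real algebra_simps flip: of_real_add of_real_mult)
  also have "fbm_const H * (k\<^sup>2 * (A + B)) = k * (A + B)"
    using fbm_const_mult_kernel_const[OF H] by (simp add: k_def power2_eq_square flip: mult.assoc)
  finally have *: "has_bochner_integral (fbm_spectral_measure H) (\<lambda>l. complex_of_real (k\<^sup>2 * (K1 l + K2 l)\<^sup>2))
     (complex_of_real (k * (A + B)))"
    by (simp only: F_def[abs_def])
  show "integrable (fbm_spectral_measure H) (\<lambda>l. (norm (fbm_kernel H T w l))\<^sup>2)"
    using * unfolding sq has_bochner_integral_iff complex_of_real_integrable_eq by blast
  show "(\<integral>l. (norm (fbm_kernel H T w l))\<^sup>2 \<partial>fbm_spectral_measure H) = fbm_kernel_const H *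
    ((\<integral>x. (bessel_cutoff (- H) (T\<^sup>2 / 16) w x)\<^sup>2 \<partial>powr_measure (- H)) +
        w\<^sup>2 * (\<integral>x. (bessel_cutoff (1 - H) (T\<^sup>2 / 16) w x)\<^sup>2 \<partial>powr_measure (1 - H)))"
    using * unfolding sq has_bochner_integral_iff integral_complex_of_real of_real_eq_iff
    by (simp add: k_def A_def B_def)
qed

lemma fbm_kernel_square_bounded:
  assumes H: "0 < H" "H < 1" and T: "T > 0"
  obtains M where "\<And>w. \<bar>w\<bar> \<le> R \<Longrightarrow>
    (\<integral>l. (norm (fbm_kernel H T w l))\<^sup>2 \<partial>fbm_spectral_measure H) \<le> M"
proof -
  let ?A = "\<lambda>w. \<integral>x. (bessel_cutoff (- H) (T\<^sup>2 / 16) w x)\<^sup>2 \<partial>powr_measure (- H)"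
  let ?B = "\<lambda>w. \<integral>x. (bessel_cutoff (1 - H) (T\<^sup>2 / 16) w x)\<^sup>2 \<partial>powr_measure (1 - H)"
  obtain A where A: "\<And>w. \<bar>w\<bar> \<le> R \<Longrightarrow> ?A w \<le> A"
    using bessel_cutoff_square_bound(2)[of "- H" "T\<^sup>2 / 16" R] H T by auto
  obtain B where B: "\<And>w. \<bar>w\<bar> \<le> R \<Longrightarrow> ?B w \<le> B"
    using bessel_cutoff_square_bound(2)[of "1 - H" "T\<^sup>2 / 16" R] H T by auto
  have k: "fbm_kernel_const H > 0"
    using fbm_const_mult_kernel_const[OF H] fbm_const_pos[OF H] by (metis zero_less_mult_pos zero_less_one)
  show thesis
  proof (rule that)
    fix w assume w: "\<bar>w\<bar> \<le> R"
    have "w\<^sup>2 \<le> R\<^sup>2" using w by (simp add: abs_le_square_iff[symmetric])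
    moreover have "?B w \<ge> 0" by simp
    ultimately have "w\<^sup>2 * ?B w \<le> R\<^sup>2 * B" using B[OF w] by (intro mult_mono) auto
    then show "(\<integral>l. (norm (fbm_kernel H T w l))\<^sup>2 \<partial>fbm_spectral_measure H) \<le> fbm_kernel_const H * (A + R\<^sup>2 * B)"
      unfolding fbm_kernel_square(2)[OF H T] using A[OF w] k by (intro mult_left_mono) auto
  qed
qed

lemma continuous_on_exp_kernel: "continuous_on A (exp_kernel t)"
proof (rule continuous_at_imp_continuous_on, rule ballI)
  fix l
  show "isCont (exp_kernel t) l"
  proof (cases "l = 0")
    case True
    \<comment> \<open>The limit at the removable point is a derivative of the complex exponential,
      which is then composed with the embedding of the reals.\<close>
    have "((\<lambda>z. exp (\<i> * z * of_real t)) has_field_derivative \<i> * of_real t) (at 0)"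
      by (auto intro!: derivative_eq_intros)
    then have "((\<lambda>z. (exp (\<i> * z * of_real t) - 1) / z) \<longlongrightarrow> \<i> * of_real t) (at 0)"
      by (simp add: has_field_derivative_iff)
    moreover have "filterlim complex_of_real (at 0) (at 0)"
      unfolding filterlim_at by (auto simp: eventually_at_filter intro!: tendsto_eq_intros)
    ultimately have "((\<lambda>x. (exp (\<i> * of_real x * of_real t) - 1) / of_real x) \<longlongrightarrow> \<i> * of_real t) (at (0::real))"
      by (rule filterlim_compose)
    from tendsto_divide[OF this tendsto_const[of \<i>]]
    have "((\<lambda>x. (exp (\<i> * of_real x * of_real t) - 1) / of_real x / \<i>) \<longlongrightarrow> of_real t) (at (0::real))"
      by simp
    moreover have "eventually (\<lambda>x. (exp (\<i> * of_real x * of_real t) - 1) / of_real x / \<i> = exp_kernel t x) (at (0::real))"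
    proof -
      have "(exp (\<i> * of_real x * of_real t) - 1) / of_real x / \<i> = exp_kernel t x" if "x \<noteq> 0" for x :: real
        using that by (simp only: exp_kernel_def if_False divide_divide_eq_left mult.commute[of _ \<i>])
      then show ?thesis by (simp only: eventually_at_filter) (intro always_eventually allI impI, blast)
    qed
    ultimately have "(exp_kernel t \<longlongrightarrow> of_real t) (at 0)"
      by (rule Lim_transform_eventually)
    then show ?thesis using True by (simp add: isCont_def exp_kernel_def)
  next
    case False
    have "isCont (\<lambda>x. (exp (\<i> * of_real x * of_real t) - 1) / (\<i> * of_real x)) l"
      using False by (intro continuous_intros) auto
    moreover have ev: "eventually (\<lambda>x. (exp (\<i> * of_real x * of_real t) - 1) / (\<i> * of_real x) = exp_kernel t x) (nhds l)"
      using t1_space_nhds[OF False] by eventually_elim (simp add: exp_kernel_def)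
    ultimately show ?thesis using isCont_cong[OF ev] by simp
  qed
qed

lemma exp_kernel_span_properties:
  assumes H: "0 < H" "H < 1" and T: "T > 0" and g: "g \<in> exp_kernel_span T"
  shows "continuous_on A g" and "g \<in> borel_measurable borel"
    and "has_bochner_integral (fbm_spectral_measure H) (\<lambda>l. g l * cnj (fbm_kernel H T w l)) (g w)"
proof -
  obtain A' c where g: "g = (\<lambda>x. \<Sum>t\<in>A'. c t * exp_kernel t x)" and A': "A' \<subseteq> {0..T}"
    using g by (auto simp: exp_kernel_span_def)
  show "continuous_on A g" for A
    unfolding g by (intro continuous_on_sum continuous_on_mult continuous_on_const continuous_on_exp_kernel)
  then show "g \<in> borel_measurable borel" by (intro borel_measurable_continuous_onI)
  have "has_bochner_integral (fbm_spectral_measure H)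
     (\<lambda>l. \<Sum>t\<in>A'. c t * (exp_kernel t l * cnj (fbm_kernel H T w l))) (\<Sum>t\<in>A'. c t * exp_kernel t w)"
    using A' by (intro has_bochner_integral_sum has_bochner_integral_mult_right exp_kernel_reproducing H T) auto
  then show "has_bochner_integral (fbm_spectral_measure H) (\<lambda>l. g l * cnj (fbm_kernel H T w l)) (g w)"
    unfolding g by (simp only: sum_distrib_right mult.assoc)
qed

lemma sets_fbm_spectral_measure [simp, measurable_cong]: "sets (fbm_spectral_measure H) = sets borel"
  and space_fbm_spectral_measure [simp]: "space (fbm_spectral_measure H) = UNIV"
  by (simp_all add: fbm_spectral_measure_def)

lemma emeasure_fbm_spectral_measure_sing: "emeasure (fbm_spectral_measure H) {w} = 0"
proof -
  have ae: "AE x in lborel. x \<in> {w} \<longrightarrow> f x = 0" for f :: "real \<Rightarrow> ennreal"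
    using AE_lborel_singleton[of w] by eventually_elim simp
  have "{w} \<in> null_sets (fbm_spectral_measure H)"
    unfolding fbm_spectral_measure_def
    by (subst null_sets_density_iff) (measurable, intro conjI ae, simp)
  then show ?thesis by blast
qed

text \<open>The density vanishes at most at 0, so a lower bound on an interval cannot be lost in
  mean square. This identifies continuous functions pointwise.\<close>

lemma emeasure_fbm_spectral_measure_interval:
  assumes H: "0 < H" "H < 1" and ab: "a < b"
  shows "emeasure (fbm_spectral_measure H) {a<..<b} > 0"
proof (rule ccontr)
  assume "\<not> ?thesis"
  then have "{a<..<b} \<in> null_sets (fbm_spectral_measure H)" by (intro null_setsI) auto
  then have "AE x in lborel. x \<in> {a<..<b} \<longrightarrow>
      ennreal (sin (pi * H) * Gamma (1 + 2 * H) / (2 * pi) * \<bar>x\<bar> powr (1 - 2 * H)) = 0"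
    unfolding fbm_spectral_measure_def by (subst (asm) null_sets_density_iff) auto
  moreover have "AE x in lborel. x \<noteq> (0::real)" by (rule AE_lborel_singleton)
  ultimately have "AE x in lborel. x \<notin> {a<..<b}"
  proof eventually_elim
    case (elim x)
    have "fbm_const H * \<bar>x\<bar> powr (1 - 2 * H) > 0"
      using fbm_const_pos[OF H] elim by simp
    then show ?case using elim by (auto simp: fbm_const_def)
  qed
  then have "emeasure lborel {a<..<b} = 0"
    by (subst (asm) AE_iff_null_sets[symmetric]) auto
  then show False using ab by simp
qed

theorem theorem4p1:
  fixes H T \<omega> :: real and \<psi> :: "real \<Rightarrow> complex" and F :: "complex \<Rightarrow> complex"
  assumes "0 < H" and "H < 1" and "T > 0"
    and "\<psi> \<in> fbm_space H T"
    and "F holomorphic_on UNIV" and "\<And>x. \<psi> x = F (of_real x)"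
  shows "has_bochner_integral (fbm_spectral_measure H)
           (\<lambda>x. \<psi> x * cnj (fbm_S H T \<omega> x)) (\<psi> \<omega>)"
proof -
  note H = assms(1,2) and T = assms(3)
  let ?M = "fbm_spectral_measure H"
  let ?K = "fbm_kernel H T"
  have psi_meas [measurable]: "\<psi> \<in> borel_measurable borel"
    and psi_sq: "integrable ?M (\<lambda>x. (norm (\<psi> x))\<^sup>2)"
    and approx: "\<And>\<epsilon>. \<epsilon> > 0 \<Longrightarrow> \<exists>g\<in>exp_kernel_span T.
        (\<integral>\<^sup>+x. ennreal ((norm (\<psi> x - g x))\<^sup>2) \<partial>?M) < ennreal (\<epsilon>\<^sup>2)"
    using assms(4) unfolding fbm_space_def L2_closure_def square_integrable_def by auto
  have psi_cont: "continuous_on A \<psi>" for A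
  proof -
    have "continuous_on A (\<lambda>x. F (of_real x))"
      by (intro continuous_on_compose2[OF holomorphic_on_imp_continuous_on[OF assms(5)]] continuous_intros) auto
    then show ?thesis using assms(6) by presburger
  qed
  \<comment> \<open>\<open>G\<close> is what the integral represents. It will be the locally uniform
    limit of the approximants \<open>g n\<close>, which reproduce themselves; they converge to
    \<psi> only in mean square.\<close>
  define G where "G w = (\<integral>x. \<psi> x * cnj (?K w x) \<partial>?M)" for w
  have K_sq: "integrable ?M (\<lambda>x. (norm (cnj (?K w x)))\<^sup>2)" for w
    using fbm_kernel_square(1)[OF H T, of w] by simp
  have psi_int: "integrable ?M (\<lambda>x. \<psi> x * cnj (?K w x))" for w
    by (rule L2_Cauchy_Schwarz(1)[OF _ _ psi_sq K_sq]) measurable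
  have approx_bound: "norm (G w - g w) \<le> \<epsilon> * sqrt (\<integral>x. (norm (?K w x))\<^sup>2 \<partial>?M)"
    if g: "g \<in> exp_kernel_span T" and e: "\<epsilon> > 0"
      and lt: "(\<integral>\<^sup>+x. ennreal ((norm (\<psi> x - g x))\<^sup>2) \<partial>?M) < ennreal (\<epsilon>\<^sup>2)" for g \<epsilon> w
  proof -
    note [measurable] = exp_kernel_span_properties(2)[OF H T g]
    have d_sq: "integrable ?M (\<lambda>x. (norm (\<psi> x - g x))\<^sup>2)"
      using lt by (intro integrableI_bounded) (auto simp: less_top[symmetric] intro: less_trans)
    have "ennreal (\<integral>x. (norm (\<psi> x - g x))\<^sup>2 \<partial>?M) < ennreal (\<epsilon>\<^sup>2)"
      using lt nn_integral_eq_integral[OF d_sq] by simp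
    then have "(\<integral>x. (norm (\<psi> x - g x))\<^sup>2 \<partial>?M) \<le> \<epsilon>\<^sup>2"
      by (simp add: ennreal_less_iff)
    then have le: "sqrt (\<integral>x. (norm (\<psi> x - g x))\<^sup>2 \<partial>?M) \<le> \<epsilon>"
      using e by (intro real_le_lsqrt) auto
    \<comment> \<open>Both terms are integrals against the same kernel, \<open>g w\<close> by its
      own reproducing property.\<close>
    have "G w - g w = (\<integral>x. (\<psi> x - g x) * cnj (?K w x) \<partial>?M)"
      using psi_int[of w] exp_kernel_span_properties(3)[OF H T g, of w]
      by (simp add: G_def left_diff_distrib has_bochner_integral_iff)
    also have "norm \<dots> \<le> sqrt (\<integral>x. (norm (\<psi> x - g x))\<^sup>2 \<partial>?M) * sqrt (\<integral>x. (norm (cnj (?K w x)))\<^sup>2 \<partial>?M)"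
      by (rule L2_Cauchy_Schwarz(2)[OF _ _ d_sq K_sq]) measurable
    also have "\<dots> \<le> \<epsilon> * sqrt (\<integral>x. (norm (?K w x))\<^sup>2 \<partial>?M)"
      using le by (simp add: mult_right_mono)
    finally show ?thesis .
  qed
  have "\<exists>g. g \<in> exp_kernel_span T \<and>
      (\<integral>\<^sup>+x. ennreal ((norm (\<psi> x - g x))\<^sup>2) \<partial>?M) < ennreal ((inverse (real (Suc n)))\<^sup>2)" for n
    using approx[of "inverse (real (Suc n))"] by auto
  then obtain g where g: "\<And>n. g n \<in> exp_kernel_span T"
    and g_lt: "\<And>n. (\<integral>\<^sup>+x. ennreal ((norm (\<psi> x - g n x))\<^sup>2) \<partial>?M) < ennreal ((inverse (real (Suc n)))\<^sup>2)"
    by metis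
  have "G \<omega> = \<psi> \<omega>"
  proof (rule ccontr)
    assume neq: "G \<omega> \<noteq> \<psi> \<omega>"
    \<comment> \<open>The margin 1 leaves room for the interval of radius \<open>r\<close>, at most
      1, around \<omega>.\<close>
    define R where "R = \<bar>\<omega>\<bar> + 1"
    obtain M where M: "\<And>w. \<bar>w\<bar> \<le> R \<Longrightarrow> (\<integral>x. (norm (?K w x))\<^sup>2 \<partial>?M) \<le> M"
      using fbm_kernel_square_bounded[OF H T, of R] by blast
    have le: "norm (G w - g n w) \<le> inverse (real (Suc n)) * sqrt M" if "\<bar>w\<bar> \<le> R" for n w
    proof -
      have "norm (G w - g n w) \<le> inverse (real (Suc n)) * sqrt (\<integral>x. (norm (?K w x))\<^sup>2 \<partial>?M)"
        by (rule approx_bound[OF g _ g_lt]) simp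
      also have "\<dots> \<le> inverse (real (Suc n)) * sqrt M"
        using M[OF that] by (intro mult_left_mono) auto
      finally show ?thesis .
    qed
    have lim0: "(\<lambda>n. inverse (real (Suc n)) * sqrt M) \<longlonglongrightarrow> 0"
      by (rule tendsto_mult_left_zero[OF LIMSEQ_inverse_real_of_nat])
    have unif: "uniform_limit {- R..R} g G sequentially"
    proof (rule uniform_limitI)
      fix e :: real assume "e > 0"
      with lim0 have "eventually (\<lambda>n. inverse (real (Suc n)) * sqrt M < e) sequentially"
        by (rule order_tendstoD(2))
      then show "\<forall>\<^sub>F n in sequentially. \<forall>x\<in>{- R..R}. dist (g n x) (G x) < e"
      proof eventually_elim
        case (elim n)
        show ?case
        proof
          fix x assume "x \<in> {- R..R}"
          then have "\<bar>x\<bar> \<le> R" by auto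
          from le[OF this, of n] elim show "dist (g n x) (G x) < e"
            by (simp add: dist_norm norm_minus_commute)
        qed
      qed
    qed
    have "continuous_on {- R..R} G"
      by (rule uniform_limit_theorem[OF _ unif])
         (auto intro!: always_eventually exp_kernel_span_properties(1)[OF H T g])
    then have "continuous_on {- R<..<R} (\<lambda>x. G x - \<psi> x)"
      by (intro continuous_on_diff psi_cont) (auto intro: continuous_on_subset)
    then have cont: "isCont (\<lambda>x. G x - \<psi> x) \<omega>"
    proof (rule continuous_on_interior)
      have "- R < \<omega>" "\<omega> < R" unfolding R_def by linarith+
      then show "\<omega> \<in> interior {- R<..<R}" by simp
    qed
    define d where "d = norm (G \<omega> - \<psi> \<omega>)"
    have d: "d > 0" using neq by (simp add: d_def)
    obtain \<eta> where \<eta>: "\<eta> > 0" "\<And>x. dist x \<omega> < \<eta> \<Longrightarrow> dist (G x - \<psi> x) (G \<omega> - \<psi> \<omega>) < d / 2"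
      using cont d unfolding continuous_at_eps_delta by (metis half_gt_zero dist_commute)
    define r where "r = min \<eta> 1"
    have r: "r > 0" "r \<le> \<eta>" "r \<le> 1" using \<eta>(1) by (auto simp: r_def)
    let ?I = "{\<omega> - r<..<\<omega> + r}"
    have big: "norm (G x - \<psi> x) > d / 2" if "x \<in> ?I" for x
    proof -
      have "dist x \<omega> < \<eta>" using that r by (auto simp: dist_real_def)
      from \<eta>(2)[OF this] have "norm ((G \<omega> - \<psi> \<omega>) - (G x - \<psi> x)) < d / 2"
        by (simp add: dist_norm norm_minus_commute)
      moreover have "norm (G \<omega> - \<psi> \<omega>) \<le> norm (G x - \<psi> x) + norm ((G \<omega> - \<psi> \<omega>) - (G x - \<psi> x))"
        using norm_triangle_ineq[of "G x - \<psi> x" "(G \<omega> - \<psi> \<omega>) - (G x - \<psi> x)"] by simp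
      ultimately show ?thesis unfolding d_def by linarith
    qed
    have "eventually (\<lambda>n. inverse (real (Suc n)) * sqrt M < d / 4) sequentially"
      by (rule order_tendstoD(2)[OF lim0]) (use d in simp)
    \<comment> \<open>On \<open>?I\<close> the distance of \<open>G\<close> and \<psi> exceeds d/2,
      while \<open>g n\<close> is eventually within d/4 of \<open>G\<close>. So \<open>g n\<close>
      stays at least d/4 away from \<psi> on a set of positive mass, contrary to mean square
      convergence.\<close>
    then have ev: "eventually (\<lambda>n. ennreal ((d / 4)\<^sup>2) * emeasure ?M ?I \<le> ennreal ((inverse (real (Suc n)))\<^sup>2)) sequentially"
    proof eventually_elim
      case (elim n)
      note [measurable] = exp_kernel_span_properties(2)[OF H T g[of n]]
      have "ennreal ((d / 4)\<^sup>2) * emeasure ?M ?I = (\<integral>\<^sup>+x. ennreal ((d / 4)\<^sup>2) * indicator ?I x \<partial>?M)"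
        by (subst nn_integral_cmult_indicator) auto
      also have "\<dots> \<le> (\<integral>\<^sup>+x. ennreal ((norm (\<psi> x - g n x))\<^sup>2) \<partial>?M)"
      proof (rule nn_integral_mono)
        fix x
        show "ennreal ((d / 4)\<^sup>2) * indicator ?I x \<le> ennreal ((norm (\<psi> x - g n x))\<^sup>2)"
        proof (cases "x \<in> ?I")
          case True
          then have "\<bar>x\<bar> \<le> R" using r by (auto simp: R_def)
          from le[OF this, of n] elim have "norm (G x - g n x) < d / 4" by linarith
          moreover have "norm (G x - \<psi> x) \<le> norm (G x - g n x) + norm (\<psi> x - g n x)"
            using norm_triangle_ineq4[of "G x - g n x" "\<psi> x - g n x"] by simp
          ultimately have "d / 4 \<le> norm (\<psi> x - g n x)" using big[OF True] by linarith
          then have "(d / 4)\<^sup>2 \<le> (norm (\<psi> x - g n x))\<^sup>2" using d by (intro power_mono) auto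
          then show ?thesis using True by simp
        qed simp
      qed
      finally show ?case using g_lt[of n] by (meson less_imp_le order_trans)
    qed
    have "(\<lambda>n. ennreal ((inverse (real (Suc n)))\<^sup>2)) \<longlonglongrightarrow> ennreal (0\<^sup>2)"
      by (intro tendsto_ennrealI tendsto_power LIMSEQ_inverse_real_of_nat)
    then have "ennreal ((d / 4)\<^sup>2) * emeasure ?M ?I \<le> ennreal (0\<^sup>2)"
      by (rule tendsto_lowerbound[OF _ ev]) simp
    moreover have "emeasure ?M ?I > 0"
      using r by (intro emeasure_fbm_spectral_measure_interval H) auto
    ultimately show False using d by (auto simp: ennreal_zero_less_mult_iff)
  qed
  then have "has_bochner_integral ?M (\<lambda>x. \<psi> x * cnj (?K \<omega> x)) (\<psi> \<omega>)"
    using psi_int[of \<omega>] by (simp add: has_bochner_integral_iff G_def)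
  moreover have "has_bochner_integral ?M (\<lambda>x. \<psi> x * cnj (?K \<omega> x)) (\<psi> \<omega>) \<longleftrightarrow>
      has_bochner_integral ?M (\<lambda>x. \<psi> x * cnj (fbm_S H T \<omega> x)) (\<psi> \<omega>)"
    by (rule has_bochner_integral_discrete_difference[where X = "{\<omega>}"])
       (auto simp: emeasure_fbm_spectral_measure_sing fbm_S_eq_kernel[OF H T])
  ultimately show ?thesis by blast
qed

end
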